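(* Let $d\in\mathbb{N}$, $a\in\mathbb{R}$, and for every $m\in\mathbb{N}$ let $G_m:\mathbb{R}^d\to\mathbb{R}$ satisfy $G_m(x)\in L^1(\mathbb{R}^d)$ and $xG_m(x)\in L^1(\mathbb{R}^d)$, such that $G_m(x)\to G(x)$ in $L^1(\mathbb{R}^d)$ and $xG_m(x)\to xG(x)$ in $L^1(\mathbb{R}^d)$ as $m\to\infty$. Let $F:\mathbb{R}\times\mathbb{R}^d\to\mathbb{R}$ satisfy the Caratheodory condition and suppose that (i) $|F(u,x)|\le k|u|+h(x)$ for all $u\in\mathbb{R}$, $x\in\mathbb{R}^d$, with a constant $k>0$ and a function $h:\mathbb{R}^d\to\mathbb{R}^+$, $h\in L^2(\mathbb{R}^d)$; (ii) $|F(u_1,x)-F(u_2,x)|\le l|u_1-u_2|$ for all $u_1,u_2\in\mathbb{R}$, $x\in\mathbb{R}^d$, with a constant $l>0$. Assume also that for all $m\in\mathbb{N}$ the following orthogonality conditions hold: if $d=1$, $$\Big(G_m(x),\frac{e^{\pm ie^{a}x}}{\sqrt{2\pi}}\Big)_{L^2(\mathbb{R})}=0,$$ and if $d\ge2$, $$\Big(G_m(x),\frac{e^{ipx}}{(2\pi)^{d/2}}\Big)_{L^2(\mathbb{R}^d)}=0,\quad p\in S^d_{e^a};$$ and that for a certain fixed $0<\varepsilon<1$, $$(2\pi)^{d/2}N_{a,m}\,l\le 1-\varepsilon\quad\text{for all } m\in\mathbb{N},\qquad\text{where } N_{a,m}:=\Big\|\frac{\widehat{G_m}(p)}{\ln(|p|/e^a)}\Big\|_{L^\infty(\mathbb{R}^d)}.$$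 Then for each $m\in\mathbb{N}$ the equation $$\Big[-\tfrac12\ln(-\Delta)\Big]u_m+au_m+\int_{\mathbb{R}^d}G_m(x-y)F(u_m(y),y)\,dy=0,\quad x\in\mathbb{R}^d,$$ has a unique solution $u_m\in L^2(\mathbb{R}^d)$, and the limiting equation $$\Big[-\tfrac12\ln(-\Delta)\Big]u+au+\int_{\mathbb{R}^d}G(x-y)F(u(y),y)\,dy=0,\quad x\in\mathbb{R}^d,$$ has a unique solution $u\in L^2(\mathbb{R}^d)$. Moreover, $u_m\to u$ in $L^2(\mathbb{R}^d)$ as $m\to\infty$. For each $m\in\mathbb{N}$, the unique solution $u_m$ does not vanish identically in the whole space provided that the intersection of the supports of the Fourier transforms of functions $\operatorname{supp}\widehat{F(0,x)}\cap\operatorname{supp}\widehat{G_m}$ is a set of nonzero Lebesgue measure in $\mathbb{R}^d$. Analogously, the unique solution $u$ of the limiting equation is nontrivial if $\operatorname{supp}\widehat{F(0,x)}\cap\operatorname{supp}\widehat{G}$ is a set of nonzero Lebesgue measure in $\mathbb{R}^d$.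
   Context: Fourier transform: $\widehat G(p):=\frac{1}{(2\pi)^{d/2}}\int_{\mathbb{R}^d}G(x)e^{-ipx}\,dx$, $p\in\mathbb{R}^d$ (extended to $L^2(\mathbb{R}^d)$ in the usual way). $\operatorname{supp}$ denotes the support of a function. The logarithmic Laplacian $\ln(-\Delta)$ is the operator on $L^2(\mathbb{R}^d)$ with Fourier symbol $2\ln|p|$, i.e. $\frac12\ln(-\Delta)$ is multiplication by $\ln|p|$ on the Fourier side. $(f_1,f_2)_{L^2(\mathbb{R}^d)}:=\int_{\mathbb{R}^d}f_1(x)\overline{f_2(x)}\,dx$, used also when $f_1\in L^1(\mathbb{R}^d)$ and $f_2\in L^\infty(\mathbb{R}^d)$. $S_r^d$ denotes the sphere in $\mathbb{R}^d$ of radius $r$ centered at the origin. The Caratheodory condition on $F(u,x)$: $x\mapsto F(u,x)$ is measurable for every $u\in\mathbb{R}$ and $u\mapsto F(u,x)$ is continuous for almost every $x\in\mathbb{R}^d$. The condition $xG_m(x)\in L^1(\mathbb{R}^d)$ means $|x|\,G_m(x)\in L^1(\mathbb{R}^d)$, and $xG_m\to xG$ in $L^1(\mathbb{R}^d)$ means $\||x|(G_m-G)\|_{L^1(\mathbb{R}^d)}\to0$. The limit $G$ is a real-valued function on $\mathbb{R}^d$.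
   Formalization: In the nontriviality claims, "supp" is read as the set where the function is nonzero, without closure; with closed supports the claim fails, since closed supports may meet only in a boundary of positive measure, where the product of the transforms is zero and u=0 is the solution. *)

theory Defs
  imports "HOL-Analysis.Analysis" "HOL-Probability.Essential_Supremum"
begin

definition L2 :: "('a::euclidean_space \<Rightarrow> 'b::euclidean_space) \<Rightarrow> bool" where
  "L2 f \<longleftrightarrow> f \<in> borel_measurable lebesgue \<and> integrable lebesgue (\<lambda>x. (norm (f x))\<^sup>2)"

definition L2_norm :: "('a::euclidean_space \<Rightarrow> 'b::euclidean_space) \<Rightarrow> real" where
  "L2_norm f = sqrt (LINT x|lebesgue. (norm (f x))\<^sup>2)"

definition tendsto_L2 ::
    "(nat \<Rightarrow> 'a::euclidean_space \<Rightarrow> 'b::euclidean_space) \<Rightarrow> ('a \<Rightarrow> 'b) \<Rightarrow> bool" where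
  "tendsto_L2 f g \<longleftrightarrow> (\<forall>n. L2 (f n)) \<and> L2 g \<and> (\<lambda>n. L2_norm (\<lambda>x. f n x - g x)) \<longlonglongrightarrow> 0"

definition tendsto_L1 :: "(nat \<Rightarrow> 'a::euclidean_space \<Rightarrow> real) \<Rightarrow> ('a \<Rightarrow> real) \<Rightarrow> bool" where
  "tendsto_L1 f g \<longleftrightarrow> (\<forall>n. integrable lebesgue (f n)) \<and> integrable lebesgue g
     \<and> (\<lambda>n. LINT x|lebesgue. \<bar>f n x - g x\<bar>) \<longlonglongrightarrow> 0"

definition L2_inner :: "('a::euclidean_space \<Rightarrow> complex) \<Rightarrow> ('a \<Rightarrow> complex) \<Rightarrow> complex" where
  "L2_inner f g = (LINT x|lebesgue. f x * cnj (g x))"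

definition Linf_norm :: "('a::euclidean_space \<Rightarrow> complex) \<Rightarrow> ereal" where
  "Linf_norm f = esssup lebesgue (\<lambda>x. ereal (cmod (f x)))"

definition fourier :: "('a::euclidean_space \<Rightarrow> complex) \<Rightarrow> 'a \<Rightarrow> complex" where
  "fourier f p = (LINT x|lebesgue. f x * exp (- \<i> * complex_of_real (p \<bullet> x)))
     / complex_of_real ((2 * pi) powr (real DIM('a) / 2))"

text \<open>
  The Fourier transform on \<open>L\<^sup>2\<close> is the \<open>L\<^sup>2\<close>-limit of the transforms of the truncations to
  balls (which are in both \<open>L\<^sup>1\<close> and \<open>L\<^sup>2\<close>). It is a relation because the transform is only
  determined up to null sets.
\<close>

definition has_L2_fourier :: "('a::euclidean_space \<Rightarrow> complex) \<Rightarrow> ('a \<Rightarrow> complex) \<Rightarrow> bool" where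
  "has_L2_fourier f \<phi> \<longleftrightarrow>
     L2 f \<and> tendsto_L2 (\<lambda>n. fourier (\<lambda>x. if norm x \<le> real n then f x else 0)) \<phi>"

text \<open>
  \<open>v = ln(-\<Delta>) u\<close>, on the maximal domain of the multiplier \<open>2 ln |p|\<close>. The value of
  \<^const>\<open>ln\<close> at \<open>0\<close> only affects the null set \<open>{p. p = 0}\<close>.
\<close>

definition has_ln_laplacian :: "('a::euclidean_space \<Rightarrow> complex) \<Rightarrow> ('a \<Rightarrow> complex) \<Rightarrow> bool" where
  "has_ln_laplacian u v \<longleftrightarrow>
     (\<exists>\<phi>. has_L2_fourier u \<phi> \<and>
          has_L2_fourier v (\<lambda>p. complex_of_real (2 * ln (norm p)) * \<phi> p))"

definition caratheodory :: "(real \<Rightarrow> 'a::euclidean_space \<Rightarrow> real) \<Rightarrow> bool" where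
  "caratheodory F \<longleftrightarrow> (\<forall>u. (\<lambda>x. F u x) \<in> borel_measurable lebesgue) \<and>
     (AE x in lebesgue. continuous_on UNIV (\<lambda>u. F u x))"

definition is_solution ::
    "real \<Rightarrow> ('a::euclidean_space \<Rightarrow> real) \<Rightarrow> (real \<Rightarrow> 'a \<Rightarrow> real) \<Rightarrow> ('a \<Rightarrow> real) \<Rightarrow> bool" where
  "is_solution a G F u \<longleftrightarrow> L2 u \<and>
     (\<exists>v. has_ln_laplacian (\<lambda>x. complex_of_real (u x)) v \<and>
          (AE x in lebesgue. integrable lebesgue (\<lambda>y. G (x - y) * F (u y) y) \<and>
             - (1 / 2) * v x + complex_of_real (a * u x)
               + complex_of_real (LINT y|lebesgue. G (x - y) * F (u y) y) = 0))"

text \<open>Uniqueness in \<open>L\<^sup>2\<close>, whose elements are functions modulo equality almost everywhere.\<close>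

definition is_unique_solution ::
    "real \<Rightarrow> ('a::euclidean_space \<Rightarrow> real) \<Rightarrow> (real \<Rightarrow> 'a \<Rightarrow> real) \<Rightarrow> ('a \<Rightarrow> real) \<Rightarrow> bool" where
  "is_unique_solution a G F u \<longleftrightarrow> is_solution a G F u \<and>
     (\<forall>w. is_solution a G F w \<longrightarrow> (AE x in lebesgue. w x = u x))"

text \<open>
  The support of a function is the set of points where it is nonzero (\<^const>\<open>support_on\<close>), without
  taking the closure: closed supports may meet in a set of positive measure (contained in their
  boundaries) although the product of the two functions vanishes almost everywhere. With this
  reading, whether the measure below is nonzero does not depend on the choice of \<open>\<phi>\<close>.
\<close>

definition supports_overlap :: "('a::euclidean_space \<Rightarrow> real) \<Rightarrow> ('a \<Rightarrow> real) \<Rightarrow> bool" where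
  "supports_overlap f G \<longleftrightarrow>
     (\<exists>\<phi>. has_L2_fourier (\<lambda>x. complex_of_real (f x)) \<phi> \<and>
          emeasure lebesgue
            (support_on UNIV \<phi> \<inter> support_on UNIV (fourier (\<lambda>x. complex_of_real (G x)))) \<noteq> 0)"

end

(*
  On the Fourier side the equation reads u^ = M F(u)^ with the multiplier
  M(p) = (2 pi)^(d/2) G^(p) / ln(|p| / e^a), so u is a fixed point of the map u |-> w with
  w^ = M F(u)^. By Plancherel and the Lipschitz condition this map contracts L^2 with constant
  l * sup |M| <= 1 - eps. L^1 convergence of G_m gives uniform convergence of the transforms,
  hence almost everywhere convergence M_m -> M with |M| under the same bound; dominated
  convergence of M_m F(u)^ then yields u_m -> u. If u = 0, then M F(0,.)^ = 0 almost everywhere.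

  Plancherel on L^1 and L^2 is obtained by testing |f^|^2 against Gaussians, which turns it into the
  average of the autocorrelation of f over a Gaussian concentrating at 0. Surjectivity of the L^2
  transform U follows from its isometry and the duality (U f, g) = (f, U g) of bilinear pairings.
*)
theory Submission
  imports Defs "HOL-Probability.Probability"
begin

section \<open>Inequalities, modes of convergence and completeness in L2\<close>

section \<open>The space of square integrable functions\<close>

text \<open>Two obstacles shape the proof. First, equality in the isometry uses continuity of the
  autocorrelation of \<open>f\<close> at 0, which dominated convergence yields for bounded
  continuous \<open>f\<close>; the bound of the autocorrelation by the squared norm takes just
  Cauchy--Schwarz. Hence the transform is first shown to be a contraction for every \<open>f\<close>
  in both L1 and L2, and the contraction then carries the equality from continuous functions to
  their limits. Second, L2 functions are functions and not classes: limits and fixed points hold off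
  null sets, and the candidate solution given by surjectivity is complex, so Hermitian symmetry of
  the multiplier has to make it real. The unbounded symbol ln|p| costs nothing: ln|p| M = a M + (2
  pi)^(d/2) G^ with G^ bounded, so every fixed point lies in the domain. In the stability estimate,
  u_m^ - u^ = M_m (F(u_m)^ - F(u)^) + (M_m - M) F(u)^. The first term is absorbed on the left
  because the contraction constant is common to all m; the second involves the single function
  F(u)^, for which pointwise convergence of the multipliers suffices.\<close>

lemma L2_measurable: "L2 f \<Longrightarrow> f \<in> borel_measurable lebesgue"
  by (simp add: L2_def)

lemma L2_norm_nonneg [simp]: "0 \<le> L2_norm f"
  by (simp add: L2_norm_def)

lemma L2_norm_power2: "(L2_norm f)\<^sup>2 = (LINT x|lebesgue. (norm (f x))\<^sup>2)"
  by (simp add: L2_norm_def)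

lemma nn_integral_L2:
  assumes "L2 f"
  shows "(\<integral>\<^sup>+x. ennreal ((norm (f x))\<^sup>2) \<partial>lebesgue) = ennreal ((L2_norm f)\<^sup>2)"
  using assms unfolding L2_norm_power2 L2_def by (intro nn_integral_eq_integral) auto

lemma L2_from_nn_integral:
  assumes "f \<in> borel_measurable lebesgue" "0 \<le> C"
    and "(\<integral>\<^sup>+x. ennreal ((norm (f x))\<^sup>2) \<partial>lebesgue) \<le> ennreal (C\<^sup>2)"
  shows "L2 f" "L2_norm f \<le> C"
proof -
  show *: "L2 f" unfolding L2_def
    using assms by (auto intro!: integrableI_bounded simp: power_abs intro: le_less_trans)
  have "ennreal ((L2_norm f)\<^sup>2) \<le> ennreal (C\<^sup>2)" using nn_integral_L2[OF *] assms by simp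
  then have "(L2_norm f)\<^sup>2 \<le> C\<^sup>2" by (simp)
  then show "L2_norm f \<le> C" using assms(2) by (rule power2_le_imp_le)
qed

lemma L2_bound:
  assumes "L2 g" "f \<in> borel_measurable lebesgue" "AE x in lebesgue. norm (f x) \<le> norm (g x)"
  shows "L2 f" "L2_norm f \<le> L2_norm g"
proof -
  have "(\<integral>\<^sup>+x. ennreal ((norm (f x))\<^sup>2) \<partial>lebesgue) \<le> (\<integral>\<^sup>+x. ennreal ((norm (g x))\<^sup>2) \<partial>lebesgue)"
    using assms(3) by (intro nn_integral_mono_AE) (auto elim!: eventually_mono intro!: ennreal_leI power_mono)
  then have "(\<integral>\<^sup>+x. ennreal ((norm (f x))\<^sup>2) \<partial>lebesgue) \<le> ennreal ((L2_norm g)\<^sup>2)"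
    by (simp add: nn_integral_L2[OF assms(1)])
  from L2_from_nn_integral[OF assms(2) _ this] show "L2 f" "L2_norm f \<le> L2_norm g" by auto
qed

lemma L2_norm_cong_AE:
  assumes "f \<in> borel_measurable lebesgue" "g \<in> borel_measurable lebesgue" "AE x in lebesgue. f x = g x"
  shows "L2_norm f = L2_norm g"
  unfolding L2_norm_def using assms
  by (intro arg_cong[where f=sqrt] integral_cong_AE) auto

lemma L2_cong_AE:
  assumes "L2 f" "AE x in lebesgue. f x = g x"
  shows "L2 g" "L2_norm g = L2_norm f"
proof -
  have g: "g \<in> borel_measurable lebesgue"
    using borel_measurable_AE[OF L2_measurable[OF assms(1)] assms(2)] .
  show "L2 g" by (rule L2_bound(1)[OF assms(1) g]) (use assms(2) in eventually_elim, simp)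
  show "L2_norm g = L2_norm f"
    by (rule L2_norm_cong_AE[OF g L2_measurable[OF assms(1)]]) (use assms(2) in eventually_elim, simp)
qed

lemma L2_zero [simp]: "L2 (\<lambda>x. 0)" "L2_norm (\<lambda>x. 0) = 0"
  by (auto simp: L2_def L2_norm_def)

lemma L2_of_real [simp]:
  "L2 (\<lambda>x. complex_of_real (f x)) \<longleftrightarrow> L2 f" "L2_norm (\<lambda>x. complex_of_real (f x)) = L2_norm f"
proof -
  have "(\<lambda>x. complex_of_real (f x)) \<in> borel_measurable lebesgue \<longleftrightarrow> f \<in> borel_measurable lebesgue"
  proof
    assume *: "(\<lambda>x. complex_of_real (f x)) \<in> borel_measurable lebesgue"
    have "(\<lambda>x. Re (complex_of_real (f x))) \<in> borel_measurable lebesgue"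
      by (rule measurable_compose[OF *]) simp
    then show "f \<in> borel_measurable lebesgue" unfolding Re_complex_of_real .
  qed (auto intro: borel_measurable_of_real)
  then show "L2 (\<lambda>x. complex_of_real (f x)) \<longleftrightarrow> L2 f" by (simp add: L2_def)
qed (simp add: L2_norm_def)

lemma L2_add:
  assumes "L2 f" "L2 g"
  shows "L2 (\<lambda>x. f x + g x)"
proof -
  have m: "(\<lambda>x. f x + g x) \<in> borel_measurable lebesgue" using assms by (auto simp: L2_def)
  have "integrable lebesgue (\<lambda>x. 2 * (norm (f x))\<^sup>2 + 2 * (norm (g x))\<^sup>2)"
    using assms by (auto simp: L2_def)
  then have "integrable lebesgue (\<lambda>x. (norm (f x + g x))\<^sup>2)"
  proof (rule Bochner_Integration.integrable_bound, goal_cases)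
    case 2
    have "(norm (f x + g x))\<^sup>2 \<le> 2 * (norm (f x))\<^sup>2 + 2 * (norm (g x))\<^sup>2" for x
    proof -
      have "(norm (f x + g x))\<^sup>2 \<le> (norm (f x) + norm (g x))\<^sup>2"
        by (intro power_mono norm_triangle_ineq) auto
      also have "\<dots> \<le> 2 * (norm (f x))\<^sup>2 + 2 * (norm (g x))\<^sup>2"
        using zero_le_power2[of "norm (f x) - norm (g x)"]
        by (simp add: power2_eq_square algebra_simps)
      finally show ?thesis .
    qed
    then show ?case by auto
  qed (use m in auto)
  with m show ?thesis by (simp add: L2_def)
qed

lemma L2_minus: assumes "L2 f" shows "L2 (\<lambda>x. - f x)"
  using assms by (auto simp: L2_def)

lemma L2_diff:
  assumes "L2 f" "L2 g"
  shows "L2 (\<lambda>x. f x - g x)"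
  using L2_add[OF assms(1) L2_minus[OF assms(2)]] by simp

lemma L2_norm_minus_commute: "L2_norm (\<lambda>x. f x - g x) = L2_norm (\<lambda>x. g x - f x)"
  by (simp add: L2_norm_def norm_minus_commute)

lemma L2_multiplier:
  fixes f m :: "'a::euclidean_space \<Rightarrow> complex"
  assumes "L2 f" "m \<in> borel_measurable lebesgue" "AE x in lebesgue. cmod (m x) \<le> C"
  shows "L2 (\<lambda>x. m x * f x)" "L2_norm (\<lambda>x. m x * f x) \<le> C * L2_norm f"
proof -
  \<comment> \<open>A negative bound would make the a.e. statement false everywhere, and the whole
    space is not a null set.\<close>
  have C: "0 \<le> C"
  proof (rule ccontr)
    assume "\<not> 0 \<le> C"
    then have "AE x in (lebesgue::'a measure). False"
      by (intro eventually_mono[OF assms(3)]) (meson norm_ge_zero order_trans)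
    then show False
      by (simp add: trivial_limit_def[symmetric] ae_filter_eq_bot_iff)
  qed
  have m: "(\<lambda>x. m x * f x) \<in> borel_measurable lebesgue" using assms by (auto simp: L2_def)
  have "(\<integral>\<^sup>+x. ennreal ((norm (m x * f x))\<^sup>2) \<partial>lebesgue)
      \<le> (\<integral>\<^sup>+x. ennreal (C\<^sup>2) * ennreal ((norm (f x))\<^sup>2) \<partial>lebesgue)"
    using assms(3)
    by (intro nn_integral_mono_AE)
      (auto elim!: eventually_mono intro!: ennreal_leI mult_right_mono power_mono
        simp: ennreal_mult[symmetric] norm_mult power_mult_distrib)
  also have "\<dots> = ennreal (C\<^sup>2) * ennreal ((L2_norm f)\<^sup>2)"
    using assms by (subst nn_integral_cmult) (auto simp: nn_integral_L2 L2_def)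
  also have "\<dots> = ennreal ((C * L2_norm f)\<^sup>2)"
    by (simp add: ennreal_mult[symmetric] power_mult_distrib)
  finally show "L2 (\<lambda>x. m x * f x)" "L2_norm (\<lambda>x. m x * f x) \<le> C * L2_norm f"
    using L2_from_nn_integral[OF m, of "C * L2_norm f"] C by auto
qed

lemma L2_cmult:
  fixes c :: complex
  assumes "L2 f"
  shows "L2 (\<lambda>x. c * f x)" "L2_norm (\<lambda>x. c * f x) = cmod c * L2_norm f"
proof -
  show "L2 (\<lambda>x. c * f x)"
    using L2_multiplier(1)[OF assms, of "\<lambda>_. c" "cmod c"] by auto
  show "L2_norm (\<lambda>x. c * f x) = cmod c * L2_norm f"
    by (simp add: L2_norm_def norm_mult power_mult_distrib real_sqrt_mult)
qed

text \<open>Working first with nonnegative integrals gives finiteness, hence integrability of the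
  product, from the same inequality that gives the bound.\<close>

lemma L2_Cauchy_Schwarz:
  assumes "L2 f" "L2 g"
  shows "integrable lebesgue (\<lambda>x. norm (f x) * norm (g x))"
    "(LINT x|lebesgue. norm (f x) * norm (g x)) \<le> L2_norm f * L2_norm g"
proof -
  have [measurable]: "f \<in> borel_measurable lebesgue" "g \<in> borel_measurable lebesgue"
    using assms by (auto simp: L2_def)
  have "(\<integral>\<^sup>+x. ennreal (norm (f x)) * ennreal (norm (g x)) \<partial>lebesgue)\<^sup>2
    \<le> (\<integral>\<^sup>+x. ennreal (norm (f x)) ^ 2 \<partial>lebesgue) * (\<integral>\<^sup>+x. ennreal (norm (g x)) ^ 2 \<partial>lebesgue)"
    by (rule Cauchy_Schwarz_nn_integral) auto
  also have "\<dots> = ennreal ((L2_norm f * L2_norm g)\<^sup>2)"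
    using assms by (simp add: nn_integral_L2 ennreal_power ennreal_mult[symmetric] power_mult_distrib)
  finally have *: "(\<integral>\<^sup>+x. ennreal (norm (f x) * norm (g x)) \<partial>lebesgue)\<^sup>2
      \<le> ennreal ((L2_norm f * L2_norm g)\<^sup>2)"
    by (simp add: ennreal_mult)
  have "(\<integral>\<^sup>+x. ennreal (norm (f x) * norm (g x)) \<partial>lebesgue)\<^sup>2 < \<infinity>"
    using * by (rule le_less_trans) auto
  then have fin: "(\<integral>\<^sup>+x. ennreal (norm (f x) * norm (g x)) \<partial>lebesgue) < \<infinity>"
    by (simp add: power_less_top_ennreal)
  then show int: "integrable lebesgue (\<lambda>x. norm (f x) * norm (g x))"
    by (intro integrableI_bounded) (auto simp: abs_mult)
  have "ennreal ((LINT x|lebesgue. norm (f x) * norm (g x))\<^sup>2) \<le> ennreal ((L2_norm f * L2_norm g)\<^sup>2)"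
    using * by (subst (asm) nn_integral_eq_integral[OF int]) (auto simp: ennreal_power integral_nonneg_AE)
  then have "(LINT x|lebesgue. norm (f x) * norm (g x))\<^sup>2 \<le> (L2_norm f * L2_norm g)\<^sup>2"
    by simp
  then show "(LINT x|lebesgue. norm (f x) * norm (g x)) \<le> L2_norm f * L2_norm g"
    by (rule power2_le_imp_le) auto
qed

lemma L2_integrable_mult:
  fixes f g :: "'a::euclidean_space \<Rightarrow> complex"
  assumes "L2 f" "L2 g"
  shows "integrable lebesgue (\<lambda>x. f x * g x)"
    "cmod (LINT x|lebesgue. f x * g x) \<le> L2_norm f * L2_norm g"
proof -
  have "(\<lambda>x. f x * g x) \<in> borel_measurable lebesgue" using assms by (auto simp: L2_def)
  then show "integrable lebesgue (\<lambda>x. f x * g x)"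
    by (intro Bochner_Integration.integrable_bound[OF L2_Cauchy_Schwarz(1)[OF assms]])
      (auto simp: norm_mult)
  have "cmod (LINT x|lebesgue. f x * g x) \<le> (LINT x|lebesgue. cmod (f x * g x))"
    by (rule integral_norm_bound)
  also have "\<dots> \<le> L2_norm f * L2_norm g"
    using L2_Cauchy_Schwarz(2)[OF assms] by (simp add: norm_mult)
  finally show "cmod (LINT x|lebesgue. f x * g x) \<le> L2_norm f * L2_norm g" .
qed

lemma L2_norm_triangle:
  assumes "L2 f" "L2 g"
  shows "L2_norm (\<lambda>x. f x + g x) \<le> L2_norm f + L2_norm g"
proof -
  have m: "(\<lambda>x. f x + g x) \<in> borel_measurable lebesgue" using assms by (auto simp: L2_def)
  note CS = L2_Cauchy_Schwarz[OF assms]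
  have i: "integrable lebesgue (\<lambda>x. (norm (f x))\<^sup>2 + 2 * (norm (f x) * norm (g x)) + (norm (g x))\<^sup>2)"
    using assms CS(1) by (auto simp: L2_def)
  have "(L2_norm (\<lambda>x. f x + g x))\<^sup>2
      \<le> (LINT x|lebesgue. (norm (f x))\<^sup>2 + 2 * (norm (f x) * norm (g x)) + (norm (g x))\<^sup>2)"
    unfolding L2_norm_power2
  proof (rule integral_mono[OF _ i])
    show "integrable lebesgue (\<lambda>x. (norm (f x + g x))\<^sup>2)"
      using L2_add[OF assms] by (simp add: L2_def)
    fix x
    have "(norm (f x + g x))\<^sup>2 \<le> (norm (f x) + norm (g x))\<^sup>2"
      by (intro power_mono norm_triangle_ineq) auto
    also have "\<dots> = (norm (f x))\<^sup>2 + 2 * (norm (f x) * norm (g x)) + (norm (g x))\<^sup>2"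
      by (simp add: power2_eq_square algebra_simps)
    finally show "(norm (f x + g x))\<^sup>2 \<le> \<dots>" .
  qed
  also have "\<dots> = (L2_norm f)\<^sup>2 + 2 * (LINT x|lebesgue. norm (f x) * norm (g x)) + (L2_norm g)\<^sup>2"
    using assms CS(1) unfolding L2_norm_power2 by (simp add: L2_def)
  also have "\<dots> \<le> (L2_norm f + L2_norm g)\<^sup>2"
    using CS(2) by (simp add: power2_eq_square algebra_simps)
  finally show ?thesis by (rule power2_le_imp_le) auto
qed

lemma L2_norm_triangle_diff:
  assumes "L2 f" "L2 g" "L2 h"
  shows "L2_norm (\<lambda>x. f x - h x) \<le> L2_norm (\<lambda>x. f x - g x) + L2_norm (\<lambda>x. g x - h x)"
  using L2_norm_triangle[OF L2_diff[OF assms(1,2)] L2_diff[OF assms(2,3)]] by simp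

lemma L2_norm_reverse_triangle:
  assumes "L2 f" "L2 g"
  shows "\<bar>L2_norm f - L2_norm g\<bar> \<le> L2_norm (\<lambda>x. f x - g x)"
  using L2_norm_triangle[OF L2_diff[OF assms] assms(2)]
    L2_norm_triangle[OF L2_diff[OF assms(2,1)] assms(1)] L2_norm_minus_commute[of f g]
  by simp

lemma L2_norm_eq_0:
  assumes "L2 f" "L2_norm f = 0"
  shows "AE x in lebesgue. f x = 0"
proof -
  have "(LINT x|lebesgue. (norm (f x))\<^sup>2) = 0"
    using assms(2) L2_norm_power2[of f] by simp
  then have "AE x in lebesgue. (norm (f x))\<^sup>2 = 0"
    using assms(1) by (subst integral_nonneg_eq_0_iff_AE[symmetric]) (auto simp: L2_def)
  then show ?thesis by simp
qed

lemma tendsto_L2_unique: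
  assumes "tendsto_L2 f g" "tendsto_L2 f h"
  shows "AE x in lebesgue. g x = h x"
proof -
  have L: "L2 g" "L2 h" "\<And>n. L2 (f n)" using assms by (auto simp: tendsto_L2_def)
  have "(\<lambda>n. L2_norm (\<lambda>x. f n x - g x) + L2_norm (\<lambda>x. f n x - h x)) \<longlonglongrightarrow> 0 + 0"
    using assms by (intro tendsto_add) (auto simp: tendsto_L2_def)
  moreover have "L2_norm (\<lambda>x. g x - h x) \<le> L2_norm (\<lambda>x. f n x - g x) + L2_norm (\<lambda>x. f n x - h x)" for n
    using L2_norm_triangle_diff[OF L(1) L(3)[of n] L(2)] L2_norm_minus_commute[of g "f n"] by simp
  ultimately have "L2_norm (\<lambda>x. g x - h x) \<le> 0 + 0"
    by (intro LIMSEQ_le_const) auto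
  then have "L2_norm (\<lambda>x. g x - h x) = 0" using L2_norm_nonneg[of "\<lambda>x. g x - h x"] by linarith
  from L2_norm_eq_0[OF L2_diff[OF L(1,2)] this] show ?thesis by simp
qed

lemma tendsto_L2_norm:
  assumes "tendsto_L2 f g"
  shows "(\<lambda>n. L2_norm (f n)) \<longlonglongrightarrow> L2_norm g"
proof (rule LIM_zero_cancel, rule Lim_null_comparison)
  show "(\<lambda>n. L2_norm (\<lambda>x. f n x - g x)) \<longlonglongrightarrow> 0" using assms by (auto simp: tendsto_L2_def)
  show "\<forall>\<^sub>F n in sequentially. norm (L2_norm (f n) - L2_norm g) \<le> L2_norm (\<lambda>x. f n x - g x)"
    using assms L2_norm_reverse_triangle[of "f n" g for n] by (auto simp: tendsto_L2_def intro!: always_eventually)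
qed

lemma tendsto_L2_bound:
  assumes "\<And>n. L2 (f n)" "L2 g" "\<And>n. L2_norm (\<lambda>x. f n x - g x) \<le> b n" "b \<longlonglongrightarrow> 0"
  shows "tendsto_L2 f g"
  unfolding tendsto_L2_def using assms
  by (auto intro: Lim_null_comparison[of _ b])

lemma tendsto_L2_add:
  assumes "tendsto_L2 f f'" "tendsto_L2 g g'"
  shows "tendsto_L2 (\<lambda>n x. f n x + g n x) (\<lambda>x. f' x + g' x)"
proof (rule tendsto_L2_bound)
  have L: "L2 f'" "L2 g'" "\<And>n. L2 (f n)" "\<And>n. L2 (g n)" using assms by (auto simp: tendsto_L2_def)
  show "L2_norm (\<lambda>x. f n x + g n x - (f' x + g' x))
      \<le> L2_norm (\<lambda>x. f n x - f' x) + L2_norm (\<lambda>x. g n x - g' x)" for n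
    using L2_norm_triangle[OF L2_diff[OF L(3)[of n] L(1)] L2_diff[OF L(4)[of n] L(2)]]
    by (simp add: algebra_simps)
  show "(\<lambda>n. L2_norm (\<lambda>x. f n x - f' x) + L2_norm (\<lambda>x. g n x - g' x)) \<longlonglongrightarrow> 0"
    using assms by (intro tendsto_add_zero) (auto simp: tendsto_L2_def)
qed (use assms in \<open>auto simp: tendsto_L2_def intro: L2_add\<close>)

lemma tendsto_L2_multiplier:
  fixes m :: "'a::euclidean_space \<Rightarrow> complex"
  assumes "tendsto_L2 f g" "m \<in> borel_measurable lebesgue" "AE x in lebesgue. cmod (m x) \<le> C"
  shows "tendsto_L2 (\<lambda>n x. m x * f n x) (\<lambda>x. m x * g x)"
proof (rule tendsto_L2_bound)
  have L: "L2 g" "\<And>n. L2 (f n)" using assms by (auto simp: tendsto_L2_def)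
  show "L2_norm (\<lambda>x. m x * f n x - m x * g x) \<le> C * L2_norm (\<lambda>x. f n x - g x)" for n
    using L2_multiplier(2)[OF L2_diff[OF L(2)[of n] L(1)] assms(2,3)] by (simp add: algebra_simps)
  show "(\<lambda>n. C * L2_norm (\<lambda>x. f n x - g x)) \<longlonglongrightarrow> 0"
    using assms by (intro tendsto_mult_right_zero) (auto simp: tendsto_L2_def)
qed (use assms in \<open>auto simp: tendsto_L2_def intro: L2_multiplier\<close>)

lemma tendsto_L2_cmult:
  fixes c :: complex
  assumes "tendsto_L2 f g"
  shows "tendsto_L2 (\<lambda>n x. c * f n x) (\<lambda>x. c * g x)"
  using tendsto_L2_multiplier[OF assms, of "\<lambda>_. c" "cmod c"] by auto

lemma tendsto_L2_diff:
  fixes f g :: "nat \<Rightarrow> 'a::euclidean_space \<Rightarrow> complex"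
  assumes "tendsto_L2 f f'" "tendsto_L2 g g'"
  shows "tendsto_L2 (\<lambda>n x. f n x - g n x) (\<lambda>x. f' x - g' x)"
  using tendsto_L2_add[OF assms(1) tendsto_L2_cmult[OF assms(2), of "-1"]] by simp

lemma tendsto_L2_integral_mult:
  fixes f :: "nat \<Rightarrow> 'a::euclidean_space \<Rightarrow> complex"
  assumes "tendsto_L2 f g" "L2 h"
  shows "(\<lambda>n. LINT x|lebesgue. f n x * h x) \<longlonglongrightarrow> (LINT x|lebesgue. g x * h x)"
proof (rule LIM_zero_cancel, rule Lim_null_comparison)
  have L: "L2 g" "\<And>n. L2 (f n)" using assms by (auto simp: tendsto_L2_def)
  show "(\<lambda>n. L2_norm (\<lambda>x. f n x - g x) * L2_norm h) \<longlonglongrightarrow> 0"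
    using assms by (intro tendsto_mult_left_zero) (auto simp: tendsto_L2_def)
  have "norm ((LINT x|lebesgue. f n x * h x) - (LINT x|lebesgue. g x * h x))
      \<le> L2_norm (\<lambda>x. f n x - g x) * L2_norm h" for n
    using L2_integrable_mult(2)[OF L2_diff[OF L(2)[of n] L(1)] assms(2)]
      L2_integrable_mult(1)[OF L(1) assms(2)] L2_integrable_mult(1)[OF L(2)[of n] assms(2)]
    by (simp add: algebra_simps)
  then show "\<forall>\<^sub>F n in sequentially. norm ((LINT x|lebesgue. f n x * h x) - (LINT x|lebesgue. g x * h x))
      \<le> L2_norm (\<lambda>x. f n x - g x) * L2_norm h" by simp
qed

lemma tendsto_L2_dominated:
  assumes "\<And>n. f n \<in> borel_measurable lebesgue" "g \<in> borel_measurable lebesgue" "L2 h"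
    and "\<And>n. AE x in lebesgue. norm (f n x) \<le> norm (h x)"
    and lim: "AE x in lebesgue. (\<lambda>n. f n x) \<longlonglongrightarrow> g x"
  shows "tendsto_L2 f g"
proof -
  have all: "AE x in lebesgue. \<forall>n. norm (f n x) \<le> norm (h x)"
    using assms(4) by (simp add: AE_all_countable)
  \<comment> \<open>The pointwise limit inherits the majorant, so 2|h| dominates the differences
    \<open>f n x - g x\<close>.\<close>
  have gb: "AE x in lebesgue. norm (g x) \<le> norm (h x)"
    using all lim by eventually_elim (rule LIMSEQ_le_const2[OF tendsto_norm], auto)
  have L: "L2 (f n)" for n using assms by (intro L2_bound(1)[OF assms(3)]) auto
  have G: "L2 g" using assms gb by (intro L2_bound(1)[OF assms(3)]) auto
  have "(\<lambda>n. LINT x|lebesgue. (norm (f n x - g x))\<^sup>2) \<longlonglongrightarrow> (LINT x|(lebesgue::'a measure). 0)"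
  proof (rule integral_dominated_convergence[where w="\<lambda>x. (2 * norm (h x))\<^sup>2"])
    show "integrable lebesgue (\<lambda>x. (2 * norm (h x))\<^sup>2)"
      using assms(3) by (auto simp: L2_def power_mult_distrib)
    show "AE x in lebesgue. (\<lambda>n. (norm (f n x - g x))\<^sup>2) \<longlonglongrightarrow> 0"
      using lim by eventually_elim
        (auto intro!: tendsto_null_power tendsto_norm_zero LIM_zero)
    show "AE x in lebesgue. norm ((norm (f n x - g x))\<^sup>2) \<le> (2 * norm (h x))\<^sup>2" for n
      using all gb
    proof eventually_elim
      case (elim x)
      have "norm (f n x - g x) \<le> 2 * norm (h x)"
        using norm_triangle_ineq4[of "f n x" "g x"] elim(1)[rule_format, of n] elim(2) by linarith
      then have "(norm (f n x - g x))\<^sup>2 \<le> (2 * norm (h x))\<^sup>2" by (rule power_mono) auto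
      then show ?case by simp
    qed
  qed (use assms in auto)
  then have "(\<lambda>n. sqrt (LINT x|lebesgue. (norm (f n x - g x))\<^sup>2)) \<longlonglongrightarrow> sqrt 0"
    by (intro tendsto_real_sqrt) simp
  then show ?thesis using L G by (simp add: tendsto_L2_def L2_norm_def)
qed

text \<open>Fatou's lemma for the squared norms. It yields membership of the limit in L2 together
  with the bound, and serves both completeness and the removal of the Gaussian cutoffs.\<close>

lemma L2_Fatou:
  assumes "\<And>n. L2 (f n)" "g \<in> borel_measurable lebesgue"
    and "AE x in lebesgue. (\<lambda>n. f n x) \<longlonglongrightarrow> g x"
    and "\<forall>\<^sub>F n in sequentially. L2_norm (f n) \<le> C" "0 \<le> C"
  shows "L2 g" "L2_norm g \<le> C"
proof -
  have "(\<integral>\<^sup>+x. ennreal ((norm (g x))\<^sup>2) \<partial>lebesgue)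
      = (\<integral>\<^sup>+x. liminf (\<lambda>n. ennreal ((norm (f n x))\<^sup>2)) \<partial>lebesgue)"
  proof (rule nn_integral_cong_AE, use assms(3) in eventually_elim)
    case (elim x)
    have "(\<lambda>n. ennreal ((norm (f n x))\<^sup>2)) \<longlonglongrightarrow> ennreal ((norm (g x))\<^sup>2)"
      by (intro tendsto_intros elim)
    then show ?case by (intro lim_imp_Liminf[symmetric]) auto
  qed
  also have "\<dots> \<le> liminf (\<lambda>n. \<integral>\<^sup>+x. ennreal ((norm (f n x))\<^sup>2) \<partial>lebesgue)"
    using assms(1) by (intro nn_integral_liminf) (auto simp: L2_def)
  also have "\<dots> \<le> liminf (\<lambda>n::nat. ennreal (C\<^sup>2))"
    using assms(4) by (intro Liminf_mono) (auto elim!: eventually_mono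
      simp: nn_integral_L2[OF assms(1)] intro!: power_mono)
  also have "\<dots> = ennreal (C\<^sup>2)" by (simp add: Liminf_const)
  finally show "L2 g" "L2_norm g \<le> C"
    using L2_from_nn_integral[OF assms(2,5)] by auto
qed

text \<open>Riesz--Fischer. Along a subsequence whose increments have norm below 2^-k, the series of
  2^k |increment|^2 has finite integral; the weight 2^k is what turns summability of these squares
  into summability of the increments themselves.\<close>

lemma L2_complete:
  assumes L: "\<And>n. L2 (f n)"
    and C: "\<And>e. e > 0 \<Longrightarrow> \<exists>N. \<forall>m\<ge>N. \<forall>n\<ge>N. L2_norm (\<lambda>x. f m x - f n x) < e"
  obtains g where "tendsto_L2 f g"
proof -
  have [measurable]: "f n \<in> borel_measurable lebesgue" for n using L by (auto simp: L2_def)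
  have "\<forall>k. \<exists>N. \<forall>m\<ge>N. \<forall>n\<ge>N. L2_norm (\<lambda>x. f m x - f n x) < (1/2)^k"
    using C by simp
  then obtain N where N: "\<And>k m n. m \<ge> N k \<Longrightarrow> n \<ge> N k \<Longrightarrow> L2_norm (\<lambda>x. f m x - f n x) < (1/2)^k"
    by metis
  \<comment> \<open>The maximum makes \<open>r\<close> both strictly increasing and at least
    \<open>N\<close>, so the increment from \<open>r k\<close> to \<open>r (Suc k)\<close> is
    controlled by (1/2)^k.\<close>
  define r where "r = rec_nat (N 0) (\<lambda>k s. max (Suc s) (N (Suc k)))"
  have r: "strict_mono r" by (rule strict_monoI_Suc) (simp add: r_def)
  have rN: "r k \<ge> N k" for k by (cases k) (auto simp: r_def)
  have rr: "r k \<le> r (Suc k)" for k using r by (simp add: strict_mono_less_eq)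
  define d where "d k x = norm (f (r (Suc k)) x - f (r k) x)" for k x
  have dn: "L2_norm (\<lambda>x. f (r (Suc k)) x - f (r k) x) < (1/2)^k" for k
    using N[of k "r (Suc k)" "r k"] rN[of k] rr[of k] by linarith
  have "(\<integral>\<^sup>+x. (\<Sum>k. ennreal (2^k * (d k x)\<^sup>2)) \<partial>lebesgue)
      = (\<Sum>k. \<integral>\<^sup>+x. ennreal (2^k * (d k x)\<^sup>2) \<partial>lebesgue)"
    by (rule nn_integral_suminf) (auto simp: d_def)
  also have "\<dots> \<le> (\<Sum>k. ennreal ((1/2)^k))"
  proof (rule suminf_le)
    fix k
    have "(\<integral>\<^sup>+x. ennreal (2^k * (d k x)\<^sup>2) \<partial>lebesgue) = ennreal (2^k) * ennreal ((L2_norm (\<lambda>x. f (r (Suc k)) x - f (r k) x))\<^sup>2)"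
      by (simp add: ennreal_mult nn_integral_cmult d_def nn_integral_L2[OF L2_diff[OF L L]])
    also have "\<dots> = ennreal (2^k * (L2_norm (\<lambda>x. f (r (Suc k)) x - f (r k) x))\<^sup>2)"
      by (simp add: ennreal_mult)
    also have "\<dots> \<le> ennreal (2^k * ((1/2)^k)\<^sup>2)"
      using dn[of k] by (intro ennreal_leI mult_left_mono power_mono) auto
    also have "2^k * ((1/2)^k)\<^sup>2 = ((1/2)^k :: real)"
      by (simp add: power2_eq_square power_one_over field_simps)
    finally show "(\<integral>\<^sup>+x. ennreal (2^k * (d k x)\<^sup>2) \<partial>lebesgue) \<le> ennreal ((1/2)^k)" .
  qed auto
  also have "\<dots> = ennreal (\<Sum>k. (1/2)^k)"
    by (rule suminf_ennreal2) (auto intro!: summable_geometric)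
  finally have "(\<integral>\<^sup>+x. (\<Sum>k. ennreal (2^k * (d k x)\<^sup>2)) \<partial>lebesgue) < \<infinity>"
    by (rule le_less_trans) auto
  then have "AE x in lebesgue. (\<Sum>k. ennreal (2^k * (d k x)\<^sup>2)) \<noteq> \<infinity>"
    by (intro nn_integral_PInf_AE) (auto simp: d_def)
  then have conv: "AE x in lebesgue. convergent (\<lambda>k. f (r k) x)"
  proof eventually_elim
    case (elim x)
    then have s: "summable (\<lambda>k. 2^k * (d k x)\<^sup>2)"
      by (intro summable_suminf_not_top) auto
    have g: "summable (\<lambda>k. (1/2::real)^k)" by (rule summable_geometric) auto
    have "summable (\<lambda>k. d k x)"
    proof (rule summable_comparison_test'[OF summable_add[OF s g], of 0])
      fix k :: nat
      \<comment> \<open>The arithmetic-geometric mean inequality, from the square of 2^k d - 1; both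
        terms on the right are summable in k.\<close>
      have "2 * d k x \<le> 2^k * (d k x)\<^sup>2 + (1/2)^k"
      proof -
        have "0 \<le> (2^k * d k x - 1)\<^sup>2 / 2^k" by simp
        also have "\<dots> = 2^k * (d k x)\<^sup>2 - 2 * d k x + (1/2)^k"
          by (simp add: power2_eq_square power_one_over field_simps)
        finally show ?thesis by simp
      qed
      moreover have "0 \<le> d k x" by (simp add: d_def)
      ultimately show "norm (d k x) \<le> 2^k * (d k x)\<^sup>2 + (1/2)^k" by simp
    qed
    then have "summable (\<lambda>k. f (r (Suc k)) x - f (r k) x)"
      unfolding d_def by (rule summable_norm_cancel)
    then have "convergent (\<lambda>n. \<Sum>k<n. f (r (Suc k)) x - f (r k) x)"
      by (simp add: summable_iff_convergent)
    then have "convergent (\<lambda>n. f (r n) x - f (r 0) x)"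
      by (simp only: sum_lessThan_telescope[of "\<lambda>k. f (r k) x"])
    from convergent_add[OF this convergent_const[of "f (r 0) x"]]
    show ?case by simp
  qed
  define g where "g x = lim (\<lambda>k. f (r k) x)" for x
  have gm [measurable]: "g \<in> borel_measurable lebesgue"
    unfolding g_def by (rule borel_measurable_lim_metric) auto
  have lim: "AE x in lebesgue. (\<lambda>k. f (r k) x) \<longlonglongrightarrow> g x"
    using conv by eventually_elim (simp add: g_def convergent_LIMSEQ_iff)
  \<comment> \<open>With \<open>n\<close> fixed, Fatou along the subsequence bounds the distance of
    \<open>g\<close> to \<open>f n\<close> for every late \<open>n\<close>, so the whole sequence
    converges and not only the subsequence.\<close>
  have key: "L2 (\<lambda>x. g x - f n x)" "L2_norm (\<lambda>x. g x - f n x) \<le> (1/2)^k" if "n \<ge> N k" for n k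
  proof -
    have "AE x in lebesgue. (\<lambda>j. f (r j) x - f n x) \<longlonglongrightarrow> g x - f n x"
      using lim by eventually_elim (intro tendsto_intros)
    moreover have "\<forall>\<^sub>F j in sequentially. L2_norm (\<lambda>x. f (r j) x - f n x) \<le> (1/2)^k"
      using eventually_ge_at_top[of "N k"]
    proof eventually_elim
      case (elim j)
      with seq_suble[OF r, of j] have "r j \<ge> N k" by linarith
      from N[OF this that] show ?case by simp
    qed
    ultimately show "L2 (\<lambda>x. g x - f n x)" "L2_norm (\<lambda>x. g x - f n x) \<le> (1/2)^k"
      using L2_Fatou[of "\<lambda>j x. f (r j) x - f n x" "\<lambda>x. g x - f n x" "(1/2)^k"] L2_diff[OF L L] by auto
  qed
  have G: "L2 g" using L2_add[OF key(1)[of 0 "N 0"] L[of "N 0"]] by simp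
  have "(\<lambda>n. L2_norm (\<lambda>x. f n x - g x)) \<longlonglongrightarrow> 0"
  proof (rule LIMSEQ_I)
    fix e :: real assume "e > 0"
    then obtain k where k: "(1/2::real)^k < e" using real_arch_pow_inv[of e "1/2"] by auto
    show "\<exists>no. \<forall>n\<ge>no. norm (L2_norm (\<lambda>x. f n x - g x) - 0) < e"
      using key(2)[of k] k by (intro exI[of _ "N k"]) (auto simp: L2_norm_minus_commute[of _ g] intro: le_less_trans)
  qed
  then show ?thesis using that L G by (auto simp: tendsto_L2_def)
qed

section \<open>Changes of variable, Borel representatives and Fubini for the L1 transform\<close>

section \<open>The Fourier transform of integrable functions\<close>

text \<open>The factor c = 1 or -1 covers translations and reflections at once; in both cases the
  Jacobian is 1 and Lebesgue measure is preserved.\<close>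

lemma distr_lebesgue_affine_unit:
  fixes t :: "'a::euclidean_space"
  assumes "c = 1 \<or> c = - 1"
  shows "(\<lambda>x. t + c *\<^sub>R x) \<in> lebesgue \<rightarrow>\<^sub>M lebesgue"
    "distr lebesgue lebesgue (\<lambda>x. t + c *\<^sub>R x) = lebesgue"
proof -
  have eq: "(\<lambda>x. t + (\<Sum>j\<in>Basis. (c * (x \<bullet> j)) *\<^sub>R j)) = (\<lambda>x. t + c *\<^sub>R x)"
    by (simp add: scaleR_sum_right[symmetric] euclidean_representation flip: scaleR_scaleR)
  show m: "(\<lambda>x. t + c *\<^sub>R x) \<in> lebesgue \<rightarrow>\<^sub>M lebesgue"
    using lebesgue_affine_measurable[of "\<lambda>_. c" t] assms unfolding eq by auto
  have "(\<Prod>j\<in>(Basis::'a set). \<bar>c\<bar>) = 1" using assms by auto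
  then show "distr lebesgue lebesgue (\<lambda>x. t + c *\<^sub>R x) = lebesgue"
    using lebesgue_affine_euclidean[of "\<lambda>_. c" t] assms unfolding eq by (auto simp: density_1)
qed

lemma lebesgue_affine_unit:
  fixes t :: "'a::euclidean_space"
  assumes "c = 1 \<or> c = - 1"
  shows borel_measurable_lebesgue_affine:
      "\<And>f::'a \<Rightarrow> 'c::topological_space. f \<in> borel_measurable lebesgue \<Longrightarrow> (\<lambda>x. f (t + c *\<^sub>R x)) \<in> borel_measurable lebesgue"
    and integrable_lebesgue_affine:
      "\<And>f::'a \<Rightarrow> 'b::{banach, second_countable_topology}. integrable lebesgue f \<Longrightarrow> integrable lebesgue (\<lambda>x. f (t + c *\<^sub>R x))"
    and integral_lebesgue_affine:
      "\<And>f::'a \<Rightarrow> 'b::{banach, second_countable_topology}. integrable lebesgue f \<Longrightarrow> (LINT x|lebesgue. f (t + c *\<^sub>R x)) = (LINT x|lebesgue. f x)"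
    and nn_integral_lebesgue_affine:
      "\<And>f. f \<in> borel_measurable lebesgue \<Longrightarrow> (\<integral>\<^sup>+x. f (t + c *\<^sub>R x) \<partial>lebesgue) = (\<integral>\<^sup>+x. f x \<partial>lebesgue)"
    and AE_lebesgue_affine:
      "\<And>P. AE x in lebesgue. P x \<Longrightarrow> AE x in lebesgue. P (t + c *\<^sub>R x)"
proof -
  note m = distr_lebesgue_affine_unit(1)[OF assms, of t]
  note d = distr_lebesgue_affine_unit(2)[OF assms, of t]
  show "(\<lambda>x. f (t + c *\<^sub>R x)) \<in> borel_measurable lebesgue" if "f \<in> borel_measurable lebesgue"
    for f :: "'a \<Rightarrow> 'c"
    using measurable_compose[OF m that] .
  show "integrable lebesgue (\<lambda>x. f (t + c *\<^sub>R x))" if "integrable lebesgue f" for f :: "'a \<Rightarrow> 'b"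
    using integrable_distr[OF m, of f] that unfolding d .
  show "(LINT x|lebesgue. f (t + c *\<^sub>R x)) = (LINT x|lebesgue. f x)" if "integrable lebesgue f" for f :: "'a \<Rightarrow> 'b"
    using integral_distr[OF m, of f] that unfolding d by simp
  show "(\<integral>\<^sup>+x. f (t + c *\<^sub>R x) \<partial>lebesgue) = (\<integral>\<^sup>+x. f x \<partial>lebesgue)" if "f \<in> borel_measurable lebesgue" for f
    using nn_integral_distr[OF m, of f] that unfolding d by simp
  show "AE x in lebesgue. P (t + c *\<^sub>R x)" if "AE x in lebesgue. P x" for P
  proof (rule AE_distrD[OF m])
    show "AE x in distr lebesgue lebesgue (\<lambda>x. t + c *\<^sub>R x). P x" using that unfolding d .
  qed
qed

lemmas integral_lebesgue_shift = integral_lebesgue_affine[where c=1 and t="- y" for y, simplified]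
lemmas nn_integral_lebesgue_shift = nn_integral_lebesgue_affine[where c=1 and t="- y" for y, simplified]
lemmas nn_integral_lebesgue_flip = nn_integral_lebesgue_affine[where c="-1", simplified]
lemmas borel_measurable_lebesgue_flip = borel_measurable_lebesgue_affine[where c="-1", simplified]
lemmas integrable_lebesgue_flip = integrable_lebesgue_affine[where c="-1", simplified]
lemmas integral_lebesgue_flip = integral_lebesgue_affine[where c="-1", simplified]
lemmas AE_lebesgue_flip = AE_lebesgue_affine[where c="-1", simplified]

text \<open>Lets two-variable integrands such as \<open>f (x - y) * g y\<close> be treated by Fubini
  for \<open>lborel\<close>: Borel functions compose with subtraction to jointly measurable ones,
  and the change on a null set does not affect the integrals. The representative is built coordinate
  by coordinate.\<close>

lemma borel_representative:
  fixes f :: "'a::euclidean_space \<Rightarrow> 'b::euclidean_space"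
  assumes "f \<in> borel_measurable lebesgue"
  obtains g where "g \<in> borel_measurable borel" "AE x in lebesgue. f x = g x"
proof -
  have "\<exists>g. g \<in> borel_measurable lborel \<and> (AE x in lborel. f x \<bullet> b = g x)" for b
    using completion_ex_borel_measurable_real[of "\<lambda>x. f x \<bullet> b" lborel] assms by auto
  then obtain g where g: "\<And>b. g b \<in> borel_measurable lborel" "\<And>b. AE x in lborel. f x \<bullet> b = g b x"
    by metis
  show ?thesis
  proof
    show "(\<lambda>x. \<Sum>b\<in>Basis. g b x *\<^sub>R b) \<in> borel_measurable borel"
      using g(1) by (intro borel_measurable_sum borel_measurable_scaleR) auto
    have "AE x in lborel. \<forall>b\<in>Basis. f x \<bullet> b = g b x"
      using g(2) by (intro AE_finite_allI) auto
    then have "AE x in lborel. f x = (\<Sum>b\<in>Basis. g b x *\<^sub>R b)"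
    proof eventually_elim
      case (elim x)
      have "f x = (\<Sum>b\<in>Basis. (f x \<bullet> b) *\<^sub>R b)" by (simp add: euclidean_representation)
      also have "\<dots> = (\<Sum>b\<in>Basis. g b x *\<^sub>R b)" using elim by (intro sum.cong) auto
      finally show ?case .
    qed
    then show "AE x in lebesgue. f x = (\<Sum>b\<in>Basis. g b x *\<^sub>R b)" by (rule AE_completion)
  qed
qed

lemma integrable_borel_representative:
  fixes f :: "'a::euclidean_space \<Rightarrow> 'b::euclidean_space"
  assumes "integrable lebesgue f"
  obtains g where "g \<in> borel_measurable borel" "AE x in lebesgue. f x = g x" "integrable lborel g"
proof -
  have f: "f \<in> borel_measurable lebesgue" using assms by auto
  obtain g where g: "g \<in> borel_measurable borel" "AE x in lebesgue. f x = g x"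
    using borel_representative[OF f] by blast
  have "g \<in> borel_measurable lebesgue" using borel_measurable_AE[OF f g(2)] .
  with assms g(2) have "integrable lebesgue g"
    using integrable_cong_AE[of f lebesgue g] f by blast
  then have "integrable lborel g" using g(1) integrable_completion[of g lborel] by auto
  then show ?thesis using that g by auto
qed

abbreviation fourier_const :: "'a::euclidean_space itself \<Rightarrow> real" where
  "fourier_const TYPE('a) \<equiv> (2 * pi) powr (real DIM('a) / 2)"

lemma norm_exp_i_real: "cmod (exp (- \<i> * complex_of_real t)) = 1"
  using norm_exp_i_times[of "- t"] by simp

lemma borel_measurable_fourier_kernel:
  "(\<lambda>x. exp (- \<i> * complex_of_real (p \<bullet> x))) \<in> borel_measurable lebesgue"
proof -
  have "(\<lambda>x. exp (- \<i> * complex_of_real (p \<bullet> x))) \<in> borel_measurable borel"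
    by (intro borel_measurable_continuous_onI continuous_intros)
  then show ?thesis by (intro measurable_completion) simp
qed

lemma integrable_fourier_kernel:
  assumes "integrable lebesgue f"
  shows "integrable lebesgue (\<lambda>x. f x * exp (- \<i> * complex_of_real (p \<bullet> x)))"
proof (rule Bochner_Integration.integrable_bound[OF assms])
  show "(\<lambda>x. f x * exp (- \<i> * complex_of_real (p \<bullet> x))) \<in> borel_measurable lebesgue"
    using assms borel_measurable_fourier_kernel[of p] by (intro borel_measurable_times) auto
qed (simp add: norm_mult norm_exp_i_real del: mult_minus_left)

lemma fourier_cong_AE:
  assumes "f \<in> borel_measurable lebesgue" "AE x in lebesgue. f x = g x"
  shows "fourier f = fourier g"
proof
  fix p
  have g: "g \<in> borel_measurable lebesgue" using borel_measurable_AE[OF assms] .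
  note e = borel_measurable_fourier_kernel[of p]
  have "(LINT x|lebesgue. f x * exp (- \<i> * complex_of_real (p \<bullet> x)))
      = (LINT x|lebesgue. g x * exp (- \<i> * complex_of_real (p \<bullet> x)))"
    by (rule integral_cong_AE) (use assms(1) g e in \<open>auto intro: borel_measurable_times\<close>,
        use assms(2) in eventually_elim, simp)
  then show "fourier f p = fourier g p" by (simp add: fourier_def)
qed

lemma fourier_lborel:
  assumes "f \<in> borel_measurable borel"
  shows "fourier f (p::'a) = (LINT x|lborel. f x * exp (- \<i> * complex_of_real (p \<bullet> x)))
     / complex_of_real (fourier_const TYPE('a::euclidean_space))"
proof -
  have "(\<lambda>x. exp (- \<i> * complex_of_real (p \<bullet> x))) \<in> borel_measurable borel"
    by (intro borel_measurable_continuous_onI continuous_intros)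
  then have "(\<lambda>x. f x * exp (- \<i> * complex_of_real (p \<bullet> x))) \<in> borel_measurable lborel"
    using assms by auto
  from integral_completion[OF this] show ?thesis by (simp add: fourier_def)
qed

lemma fourier_bound:
  assumes "integrable lebesgue f"
  shows "cmod (fourier f (p::'a::euclidean_space)) \<le> (LINT x|lebesgue. cmod (f x)) / fourier_const TYPE('a)"
proof -
  have "cmod (LINT x|lebesgue. f x * exp (- \<i> * complex_of_real (p \<bullet> x)))
      \<le> (LINT x|lebesgue. cmod (f x * exp (- \<i> * complex_of_real (p \<bullet> x))))"
    by (rule integral_norm_bound)
  also have "\<dots> = (LINT x|lebesgue. cmod (f x))"
    by (simp only: norm_mult norm_exp_i_real mult_1_right)
  finally show ?thesis unfolding fourier_def norm_divide
    by (intro frac_le) (auto simp: integral_nonneg_AE)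
qed

lemma continuous_fourier:
  assumes "integrable lebesgue (f :: 'a::euclidean_space \<Rightarrow> complex)"
  shows "continuous_on UNIV (fourier f)"
proof -
  have "(\<lambda>n. LINT x|lebesgue. f x * exp (- \<i> * complex_of_real (q n \<bullet> x)))
      \<longlonglongrightarrow> (LINT x|lebesgue. f x * exp (- \<i> * complex_of_real (p \<bullet> x)))"
    if "q \<longlonglongrightarrow> p" for q p
  proof (rule integral_dominated_convergence[where w="\<lambda>x. cmod (f x)"])
    show "AE x in lebesgue. (\<lambda>n. f x * exp (- \<i> * complex_of_real (q n \<bullet> x)))
        \<longlonglongrightarrow> f x * exp (- \<i> * complex_of_real (p \<bullet> x))"
      by (intro AE_I2 tendsto_intros that)
    show "AE x in lebesgue. cmod (f x * exp (- \<i> * complex_of_real (q n \<bullet> x))) \<le> cmod (f x)" for n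
      by (simp only: norm_mult norm_exp_i_real mult_1_right) simp
  qed (use assms integrable_fourier_kernel in \<open>auto intro: borel_measurable_integrable\<close>)
  then show ?thesis
    unfolding continuous_on_sequentially fourier_def comp_def
    by (intro ballI allI impI tendsto_divide) auto
qed

lemma borel_measurable_fourier:
  assumes "integrable lebesgue f"
  shows "fourier f \<in> borel_measurable borel" "fourier f \<in> borel_measurable lebesgue"
proof -
  show "fourier f \<in> borel_measurable borel"
    by (rule borel_measurable_continuous_onI[OF continuous_fourier[OF assms]])
  then show "fourier f \<in> borel_measurable lebesgue" by (intro measurable_completion) simp
qed

lemma fourier_diff:
  assumes "integrable lebesgue f" "integrable lebesgue g"
  shows "fourier (\<lambda>x. f x - g x) p = fourier f p - fourier g p"
  using integrable_fourier_kernel[OF assms(1), of p] integrable_fourier_kernel[OF assms(2), of p]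
  by (simp add: fourier_def diff_divide_distrib left_diff_distrib)

lemma fourier_cmult: "fourier (\<lambda>x. c * f x) p = c * fourier f p"
  by (simp add: fourier_def mult.assoc)

lemma fourier_cnj: "fourier (\<lambda>x. cnj (f x)) p = cnj (fourier f (- p))"
  by (simp add: fourier_def exp_cnj flip: Bochner_Integration.integral_cnj del: integral_cnj)

text \<open>The kernel exp(-i p x) is symmetric in its two variables and has modulus 1, so it is
  integrable against f(x) g(p) and Fubini may be read in either order.\<close>

lemma fourier_duality:
  fixes f g :: "'a::euclidean_space \<Rightarrow> complex"
  assumes "integrable lebesgue f" "integrable lebesgue g"
  shows "(LINT p|lebesgue. fourier f p * g p) = (LINT x|lebesgue. f x * fourier g x)"
proof -
  obtain f' where f': "f' \<in> borel_measurable borel" "AE x in lebesgue. f x = f' x" "integrable lborel f'"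
    using integrable_borel_representative[OF assms(1)] .
  obtain g' where g': "g' \<in> borel_measurable borel" "AE x in lebesgue. g x = g' x" "integrable lborel g'"
    using integrable_borel_representative[OF assms(2)] .
  note [measurable] = f'(1) g'(1)
  have Ff: "fourier f = fourier f'" and Fg: "fourier g = fourier g'"
    using f' g' assms by (auto intro!: fourier_cong_AE)
  have gl: "f' \<in> borel_measurable lebesgue" "g' \<in> borel_measurable lebesgue"
    using f'(1) g'(1) by (auto intro!: measurable_completion)
  have mf: "fourier f' \<in> borel_measurable borel" "fourier g' \<in> borel_measurable borel"
    using borel_measurable_fourier(1)[OF assms(1)] borel_measurable_fourier(1)[OF assms(2)] Ff Fg by auto
  define K where "K x p = f' x * g' p * exp (- \<i> * complex_of_real (p \<bullet> x))" for x p
  have K: "(\<lambda>(x,p). K x p) \<in> borel_measurable (lborel \<Otimes>\<^sub>M lborel)"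
    unfolding K_def by measurable
  have i: "integrable lborel (\<lambda>p. K x p)" for x
  proof (rule Bochner_Integration.integrable_bound)
    show "integrable lborel (\<lambda>p. cmod (f' x) * cmod (g' p))" using g'(3) by auto
    show "(\<lambda>p. K x p) \<in> borel_measurable lborel" unfolding K_def by measurable
    show "AE p in lborel. norm (K x p) \<le> norm (cmod (f' x) * cmod (g' p))"
      by (simp add: K_def norm_mult norm_exp_i_real del: mult_minus_left)
  qed
  have I: "integrable (lborel \<Otimes>\<^sub>M lborel) (\<lambda>(x,p). K x p)"
  proof (rule lborel_pair.Fubini_integrable[OF K])
    have "(\<lambda>x. LINT p|lborel. norm (case (x,p) of (x,p) \<Rightarrow> K x p)) = (\<lambda>x. cmod (f' x) * (LINT p|lborel. cmod (g' p)))"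
      by (simp add: K_def norm_mult norm_exp_i_real del: mult_minus_left)
    then show "integrable lborel (\<lambda>x. LINT p|lborel. norm (case (x,p) of (x,p) \<Rightarrow> K x p))"
      using f'(3) by simp
  qed (use i in auto)
  have "(LINT p|lebesgue. fourier f p * g p) = (LINT p|lebesgue. fourier f' p * g' p)"
    unfolding Ff by (rule integral_cong_AE)
      (use assms(2) g'(2) gl borel_measurable_fourier(2)[OF assms(1)] Ff in \<open>auto intro!: borel_measurable_times\<close>)
  also have "\<dots> = (LINT p|lborel. fourier f' p * g' p)"
    by (rule integral_completion) (use mf in auto)
  also have "\<dots> = (LINT p|lborel. (LINT x|lborel. K x p)) / complex_of_real (fourier_const TYPE('a))"
  proof -
    have "(LINT x|lborel. K x p) = (LINT x|lborel. f' x * exp (- \<i> * complex_of_real (p \<bullet> x))) * g' p" for p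
      by (subst integral_mult_left_zero[symmetric]) (simp add: K_def mult_ac)
    then show ?thesis by (simp add: fourier_lborel[OF f'(1)])
  qed
  also have "(LINT p|lborel. (LINT x|lborel. K x p)) = (LINT x|lborel. (LINT p|lborel. K x p))"
    by (rule lborel_pair.Fubini_integral[OF I])
  also have "\<dots> / complex_of_real (fourier_const TYPE('a)) = (LINT x|lborel. f' x * fourier g' x)"
  proof -
    have "(LINT p|lborel. K x p) = f' x * (LINT p|lborel. g' p * exp (- \<i> * complex_of_real (x \<bullet> p)))" for x
      by (simp add: K_def[abs_def] mult.assoc inner_commute)
    then show ?thesis by (simp add: fourier_lborel[OF g'(1)])
  qed
  also have "\<dots> = (LINT x|lebesgue. f' x * fourier g' x)"
    by (rule integral_completion[symmetric]) (use mf in auto)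
  also have "\<dots> = (LINT x|lebesgue. f x * fourier g x)"
    unfolding Fg by (rule integral_cong_AE)
      (use assms(1) f'(2) gl borel_measurable_fourier(2)[OF assms(2)] Fg in \<open>auto intro!: borel_measurable_times\<close>)
  finally show ?thesis .
qed

section \<open>The convolution theorem on L1 and Young's inequality for L1 against L2\<close>

section \<open>Convolution\<close>

text \<open>The integral takes the value 0 wherever the integrand fails to be integrable, so this is
  a total function; for an L1 and an L2 factor, \<open>conv_L2\<close> shows that such points form a
  null set.\<close>

definition conv :: "('a::euclidean_space \<Rightarrow> complex) \<Rightarrow> ('a \<Rightarrow> complex) \<Rightarrow> 'a \<Rightarrow> complex" where
  "conv f g x = (LINT y|lebesgue. f (x - y) * g y)"

lemma conv_cong_AE:
  assumes "f \<in> borel_measurable lebesgue" "g \<in> borel_measurable lebesgue"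
    and "AE x in lebesgue. f x = f' x" "AE x in lebesgue. g x = g' x"
  shows "conv f g x = conv f' g' x"
    "integrable lebesgue (\<lambda>y. f (x - y) * g y) \<longleftrightarrow> integrable lebesgue (\<lambda>y. f' (x - y) * g' y)"
proof -
  have m': "f' \<in> borel_measurable lebesgue" "g' \<in> borel_measurable lebesgue"
    using borel_measurable_AE assms by blast+
  have m: "(\<lambda>y. f (x - y) * g y) \<in> borel_measurable lebesgue"
    "(\<lambda>y. f' (x - y) * g' y) \<in> borel_measurable lebesgue"
    using assms(1,2) m' by (auto intro!: borel_measurable_times borel_measurable_lebesgue_flip)
  have ae: "AE y in lebesgue. f (x - y) * g y = f' (x - y) * g' y"
    using AE_lebesgue_flip[OF assms(3), of x] assms(4) by eventually_elim simp
  show "conv f g x = conv f' g' x" unfolding conv_def by (rule integral_cong_AE[OF m ae])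
  show "integrable lebesgue (\<lambda>y. f (x - y) * g y) \<longleftrightarrow> integrable lebesgue (\<lambda>y. f' (x - y) * g' y)"
    by (rule integrable_cong_AE[OF m ae])
qed

lemma nn_integral_lborel_shift:
  fixes f :: "'a::euclidean_space \<Rightarrow> ennreal"
  assumes "f \<in> borel_measurable borel"
  shows "(\<integral>\<^sup>+x. f (x - y) \<partial>lborel) = (\<integral>\<^sup>+x. f x \<partial>lborel)"
    "(\<integral>\<^sup>+x. f (y - x) \<partial>lborel) = (\<integral>\<^sup>+x. f x \<partial>lborel)"
proof -
  have "f \<in> borel_measurable lebesgue" using assms by (intro measurable_completion) simp
  from nn_integral_lebesgue_shift[OF this, of y] nn_integral_lebesgue_flip[OF this, of y]
  show "(\<integral>\<^sup>+x. f (x - y) \<partial>lborel) = (\<integral>\<^sup>+x. f x \<partial>lborel)"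
    "(\<integral>\<^sup>+x. f (y - x) \<partial>lborel) = (\<integral>\<^sup>+x. f x \<partial>lborel)"
    by (simp_all add: nn_integral_completion)
qed

text \<open>Tonelli for the moduli gives integrability of the double integrand, after which Fubini
  factors the transform. The factor (2 pi)^(d/2) remains because the right side contains the
  normalisation twice and the left side once.\<close>

lemma conv_L1:
  fixes f g :: "'a::euclidean_space \<Rightarrow> complex"
  assumes "integrable lebesgue f" "integrable lebesgue g"
  shows "integrable lebesgue (conv f g)"
    "fourier (conv f g) p = complex_of_real (fourier_const TYPE('a)) * fourier f p * fourier g p"
proof -
  obtain f' where f': "f' \<in> borel_measurable borel" "AE x in lebesgue. f x = f' x" "integrable lborel f'"
    using integrable_borel_representative[OF assms(1)] .
  obtain g' where g': "g' \<in> borel_measurable borel" "AE x in lebesgue. g x = g' x" "integrable lborel g'"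
    using integrable_borel_representative[OF assms(2)] .
  note [measurable] = f'(1) g'(1)
  have eq: "conv f g = conv f' g'"
    using conv_cong_AE(1)[OF _ _ f'(2) g'(2)] assms by (intro ext) auto
  have Ff: "fourier f = fourier f'" and Fg: "fourier g = fourier g'"
    using f' g' assms by (auto intro!: fourier_cong_AE)
  have cl: "conv f' g' x = (LINT y|lborel. f' (x - y) * g' y)" for x
    unfolding conv_def by (rule integral_completion) measurable
  define K where "K x y = f' (x - y) * g' y" for x y
  define e where "e x = exp (- \<i> * complex_of_real (p \<bullet> x))" for x
  have [measurable]: "e \<in> borel_measurable borel"
    unfolding e_def by (intro borel_measurable_continuous_onI continuous_intros)
  have K [measurable]: "(\<lambda>(x,y). K x y) \<in> borel_measurable (lborel \<Otimes>\<^sub>M lborel)"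
    unfolding K_def by measurable
  have "(\<integral>\<^sup>+z. ennreal (norm (case z of (x,y) \<Rightarrow> K x y)) \<partial>(lborel \<Otimes>\<^sub>M lborel))
      = (\<integral>\<^sup>+y. (\<integral>\<^sup>+x. ennreal (norm (case (x,y) of (x,y) \<Rightarrow> K x y)) \<partial>lborel) \<partial>lborel)"
    by (rule lborel_pair.nn_integral_snd[symmetric]) measurable
  also have "\<dots> = (\<integral>\<^sup>+y. (\<integral>\<^sup>+x. ennreal (cmod (f' x)) \<partial>lborel) * ennreal (cmod (g' y)) \<partial>lborel)"
  proof (rule nn_integral_cong)
    fix y
    have "(\<integral>\<^sup>+x. ennreal (norm (case (x,y) of (x,y) \<Rightarrow> K x y)) \<partial>lborel)
        = (\<integral>\<^sup>+x. ennreal (cmod (f' (x - y))) * ennreal (cmod (g' y)) \<partial>lborel)"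
      by (simp add: K_def norm_mult ennreal_mult)
    also have "\<dots> = (\<integral>\<^sup>+x. ennreal (cmod (f' (x - y))) \<partial>lborel) * ennreal (cmod (g' y))"
      by (rule nn_integral_multc) measurable
    also have "(\<integral>\<^sup>+x. ennreal (cmod (f' (x - y))) \<partial>lborel) = (\<integral>\<^sup>+x. ennreal (cmod (f' x)) \<partial>lborel)"
      by (rule nn_integral_lborel_shift(1)) measurable
    finally show "(\<integral>\<^sup>+x. ennreal (norm (case (x,y) of (x,y) \<Rightarrow> K x y)) \<partial>lborel)
      = (\<integral>\<^sup>+x. ennreal (cmod (f' x)) \<partial>lborel) * ennreal (cmod (g' y))" .
  qed
  also have "\<dots> = (\<integral>\<^sup>+x. ennreal (cmod (f' x)) \<partial>lborel) * (\<integral>\<^sup>+x. ennreal (cmod (g' x)) \<partial>lborel)"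
    by (rule nn_integral_cmult) measurable
  also have "\<dots> < \<infinity>"
    using f'(3) g'(3) by (simp add: ennreal_mult_less_top integrable_iff_bounded)
  finally have IK: "integrable (lborel \<Otimes>\<^sub>M lborel) (\<lambda>(x,y). K x y)"
    using K by (intro integrableI_bounded) auto
  have IKe: "integrable (lborel \<Otimes>\<^sub>M lborel) (\<lambda>(x,y). K x y * e x)"
  proof (rule Bochner_Integration.integrable_bound[OF IK])
    show "(\<lambda>(x, y). K x y * e x) \<in> borel_measurable (lborel \<Otimes>\<^sub>M lborel)"
      unfolding K_def by measurable
  qed (auto simp: e_def norm_mult norm_exp_i_real simp del: mult_minus_left)
  have icl: "integrable lborel (conv f' g')"
    using lborel_pair.integrable_fst[OF IK] by (simp add: cl[abs_def] K_def)
  then have mcl: "conv f' g' \<in> borel_measurable borel" by auto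
  then show "integrable lebesgue (conv f g)"
    unfolding eq using icl by (subst integrable_completion) auto
  have "(LINT x|lborel. conv f' g' x * e x) = (LINT x|lborel. (LINT y|lborel. K x y * e x))"
    by (simp add: cl K_def)
  also have "\<dots> = (LINT y|lborel. (LINT x|lborel. K x y * e x))"
    by (rule lborel_pair.Fubini_integral[OF IKe, symmetric])
  also have "\<dots> = (LINT y|lborel. (LINT x|lborel. f' x * e x) * (g' y * e y))"
  proof (rule Bochner_Integration.integral_cong[OF refl])
    fix y
    \<comment> \<open>The characters are multiplicative, so translation by y separates the
      variables.\<close>
    have ee: "e x = e (x - y) * e y" for x
      by (simp add: e_def inner_diff_right algebra_simps flip: exp_add)
    have "(LINT x|lborel. K x y * e x) = (LINT x|lborel. (f' (x - y) * e (x - y)) * (g' y * e y))"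
      unfolding K_def by (subst ee) (simp add: mult_ac)
    also have "\<dots> = (LINT x|lborel. f' (x - y) * e (x - y)) * (g' y * e y)"
      by (rule integral_mult_left_zero)
    also have "(LINT x|lborel. f' (x - y) * e (x - y)) = (LINT x|lebesgue. f' (x - y) * e (x - y))"
      by (rule integral_completion[symmetric]) measurable
    also have "\<dots> = (LINT x|lebesgue. f' x * e x)"
    proof (rule integral_lebesgue_shift[of "\<lambda>x. f' x * e x"])
      have "integrable lebesgue f'" using f'(1,3) by (subst integrable_completion) auto
      then show "integrable lebesgue (\<lambda>x. f' x * e x)"
        unfolding e_def by (rule integrable_fourier_kernel)
    qed
    also have "\<dots> = (LINT x|lborel. f' x * e x)" by (rule integral_completion) measurable
    finally show "(LINT x|lborel. K x y * e x) = (LINT x|lborel. f' x * e x) * (g' y * e y)" .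
  qed
  also have "\<dots> = (LINT x|lborel. f' x * e x) * (LINT x|lborel. g' x * e x)"
    by (rule integral_mult_right_zero)
  finally show "fourier (conv f g) p = complex_of_real (fourier_const TYPE('a)) * fourier f p * fourier g p"
    unfolding eq Ff Fg fourier_lborel[OF f'(1)] fourier_lborel[OF g'(1)] fourier_lborel[OF mcl]
    by (simp add: e_def)
qed

text \<open>Young's inequality; the Cauchy--Schwarz inequality is applied to
  \<open>\<bar>f (x - y)\<bar>\<^bsup>1/2\<^esup>\<close> and \<open>\<bar>f (x - y)\<bar>\<^bsup>1/2\<^esup> \<bar>g y\<bar>\<close>.\<close>

lemma conv_L2:
  fixes f g :: "'a::euclidean_space \<Rightarrow> complex"
  assumes "integrable lebesgue f" "L2 g"
  shows "AE x in lebesgue. integrable lebesgue (\<lambda>y. f (x - y) * g y)"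
    "L2 (conv f g)" "L2_norm (conv f g) \<le> (LINT x|lebesgue. cmod (f x)) * L2_norm g"
proof -
  obtain f' where f': "f' \<in> borel_measurable borel" "AE x in lebesgue. f x = f' x" "integrable lborel f'"
    using integrable_borel_representative[OF assms(1)] .
  obtain g' where g': "g' \<in> borel_measurable borel" "AE x in lebesgue. g x = g' x"
    using borel_representative[OF L2_measurable[OF assms(2)]] .
  note [measurable] = f'(1) g'(1)
  have mg: "g \<in> borel_measurable lebesgue" and mf: "f \<in> borel_measurable lebesgue"
    using assms by (auto simp: L2_def)
  note eq = conv_cong_AE(1)[OF mf mg f'(2) g'(2)]
    and eqi = conv_cong_AE(2)[OF mf mg f'(2) g'(2)]
  have Lg: "L2 g'" "L2_norm g' = L2_norm g" using L2_cong_AE[OF assms(2) g'(2)] by auto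
  have cl: "conv f' g' x = (LINT y|lborel. f' (x - y) * g' y)" for x
    unfolding conv_def by (rule integral_completion) measurable
  define N where "N x = (\<integral>\<^sup>+y. ennreal (cmod (f' (x - y) * g' y)) \<partial>lborel)" for x
  define I where "I = (LINT x|lebesgue. cmod (f x))"
  have I: "(\<integral>\<^sup>+x. ennreal (cmod (f' x)) \<partial>lborel) = ennreal I"
  proof -
    have "(\<integral>\<^sup>+x. ennreal (cmod (f' x)) \<partial>lborel) = (\<integral>\<^sup>+x. ennreal (cmod (f' x)) \<partial>lebesgue)"
      by (simp add: nn_integral_completion)
    also have "\<dots> = (\<integral>\<^sup>+x. ennreal (cmod (f x)) \<partial>lebesgue)"
      by (rule nn_integral_cong_AE) (use f'(2) in eventually_elim, simp)
    also have "\<dots> = ennreal I"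
      unfolding I_def using assms(1) by (intro nn_integral_eq_integral) auto
    finally show ?thesis .
  qed
  have I0: "0 \<le> I" unfolding I_def by (simp add: integral_nonneg_AE)
  have Nm [measurable]: "N \<in> borel_measurable borel"
    unfolding N_def by measurable
  have N2: "(N x)\<^sup>2 \<le> ennreal I * (\<integral>\<^sup>+y. ennreal (cmod (f' (x - y))) * ennreal ((cmod (g' y))\<^sup>2) \<partial>lborel)" for x
  proof -
    have "(N x)\<^sup>2 = (\<integral>\<^sup>+y. ennreal (sqrt (cmod (f' (x - y)))) * ennreal (sqrt (cmod (f' (x - y))) * cmod (g' y)) \<partial>lborel)\<^sup>2"
      unfolding N_def by (simp add: norm_mult flip: ennreal_mult mult.assoc)
    also have "\<dots> \<le> (\<integral>\<^sup>+y. (ennreal (sqrt (cmod (f' (x - y)))))\<^sup>2 \<partial>lborel) *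
        (\<integral>\<^sup>+y. (ennreal (sqrt (cmod (f' (x - y))) * cmod (g' y)))\<^sup>2 \<partial>lborel)"
      by (rule Cauchy_Schwarz_nn_integral) measurable
    also have "\<dots> = (\<integral>\<^sup>+y. ennreal (cmod (f' (x - y))) \<partial>lborel) *
        (\<integral>\<^sup>+y. ennreal (cmod (f' (x - y))) * ennreal ((cmod (g' y))\<^sup>2) \<partial>lborel)"
      by (simp add: ennreal_power power_mult_distrib ennreal_mult)
    also have "(\<integral>\<^sup>+y. ennreal (cmod (f' (x - y))) \<partial>lborel) = ennreal I"
      unfolding I[symmetric] by (rule nn_integral_lborel_shift(2)) measurable
    finally show ?thesis .
  qed
  have "(\<integral>\<^sup>+x. (N x)\<^sup>2 \<partial>lborel)
      \<le> (\<integral>\<^sup>+x. ennreal I * (\<integral>\<^sup>+y. ennreal (cmod (f' (x - y))) * ennreal ((cmod (g' y))\<^sup>2) \<partial>lborel) \<partial>lborel)"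
    by (intro nn_integral_mono N2)
  also have "\<dots> = ennreal I * (\<integral>\<^sup>+x. (\<integral>\<^sup>+y. ennreal (cmod (f' (x - y))) * ennreal ((cmod (g' y))\<^sup>2) \<partial>lborel) \<partial>lborel)"
    by (rule nn_integral_cmult) measurable
  also have "(\<integral>\<^sup>+x. (\<integral>\<^sup>+y. ennreal (cmod (f' (x - y))) * ennreal ((cmod (g' y))\<^sup>2) \<partial>lborel) \<partial>lborel)
     = (\<integral>\<^sup>+y. (\<integral>\<^sup>+x. ennreal (cmod (f' (x - y))) * ennreal ((cmod (g' y))\<^sup>2) \<partial>lborel) \<partial>lborel)"
    by (rule lborel_pair.Fubini'[symmetric]) measurable
  also have "\<dots> = (\<integral>\<^sup>+y. ennreal I * ennreal ((cmod (g' y))\<^sup>2) \<partial>lborel)"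
  proof (rule nn_integral_cong)
    fix y
    have "(\<integral>\<^sup>+x. ennreal (cmod (f' (x - y))) * ennreal ((cmod (g' y))\<^sup>2) \<partial>lborel)
        = (\<integral>\<^sup>+x. ennreal (cmod (f' (x - y))) \<partial>lborel) * ennreal ((cmod (g' y))\<^sup>2)"
      by (rule nn_integral_multc) measurable
    also have "(\<integral>\<^sup>+x. ennreal (cmod (f' (x - y))) \<partial>lborel) = ennreal I"
      unfolding I[symmetric] by (rule nn_integral_lborel_shift(1)) measurable
    finally show "(\<integral>\<^sup>+x. ennreal (cmod (f' (x - y))) * ennreal ((cmod (g' y))\<^sup>2) \<partial>lborel)
      = ennreal I * ennreal ((cmod (g' y))\<^sup>2)" .
  qed
  also have "\<dots> = ennreal I * (\<integral>\<^sup>+y. ennreal ((cmod (g' y))\<^sup>2) \<partial>lborel)"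
    by (rule nn_integral_cmult) measurable
  also have "(\<integral>\<^sup>+y. ennreal ((cmod (g' y))\<^sup>2) \<partial>lborel) = ennreal ((L2_norm g)\<^sup>2)"
    using nn_integral_L2[OF Lg(1)] by (simp add: Lg(2) nn_integral_completion)
  also have "ennreal I * (ennreal I * ennreal ((L2_norm g)\<^sup>2)) = ennreal ((I * L2_norm g)\<^sup>2)"
    using I0 by (simp add: power2_eq_square mult_ac flip: ennreal_mult)
  finally have NN: "(\<integral>\<^sup>+x. (N x)\<^sup>2 \<partial>lborel) \<le> ennreal ((I * L2_norm g)\<^sup>2)" .
  then have "(\<integral>\<^sup>+x. (N x)\<^sup>2 \<partial>lborel) < \<infinity>" by (rule le_less_trans) simp
  then have "AE x in lborel. (N x)\<^sup>2 \<noteq> \<infinity>" by (intro nn_integral_PInf_AE) auto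
  then have Nfin: "AE x in lborel. N x < \<infinity>"
    by eventually_elim (auto simp: power2_eq_square ennreal_mult_eq_top_iff less_top)
  have "AE x in lborel. integrable lborel (\<lambda>y. f' (x - y) * g' y)"
    using Nfin
  proof eventually_elim
    case (elim x)
    show ?case
    proof (rule integrableI_bounded)
      show "(\<lambda>y. f' (x - y) * g' y) \<in> borel_measurable lborel" by measurable
    qed (use elim in \<open>simp add: N_def\<close>)
  qed
  then have "AE x in lebesgue. integrable lborel (\<lambda>y. f' (x - y) * g' y)" by (rule AE_completion)
  then show "AE x in lebesgue. integrable lebesgue (\<lambda>y. f (x - y) * g y)"
    unfolding eqi by eventually_elim (subst integrable_completion, measurable)
  have cm: "conv f' g' \<in> borel_measurable borel"
    unfolding cl[abs_def] by measurable
  then have cm': "conv f' g' \<in> borel_measurable lebesgue" by (intro measurable_completion) simp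
  have "(\<integral>\<^sup>+x. ennreal ((cmod (conv f' g' x))\<^sup>2) \<partial>lebesgue) = (\<integral>\<^sup>+x. ennreal ((cmod (conv f' g' x))\<^sup>2) \<partial>lborel)"
    by (rule nn_integral_completion)
  also have "\<dots> \<le> (\<integral>\<^sup>+x. (N x)\<^sup>2 \<partial>lborel)"
  proof (rule nn_integral_mono)
    fix x
    \<comment> \<open>This holds at every x: where the integrand is not integrable the convolution
      has the default value 0.\<close>
    have "ennreal (cmod (conv f' g' x)) \<le> N x"
      unfolding N_def cl
      by (cases "integrable lborel (\<lambda>y. f' (x - y) * g' y)")
        (auto simp: not_integrable_integral_eq intro: integral_norm_bound_ennreal)
    then show "ennreal ((cmod (conv f' g' x))\<^sup>2) \<le> (N x)\<^sup>2"
      by (simp add: power_mono flip: ennreal_power)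
  qed
  also note NN
  finally have "L2 (conv f' g')" "L2_norm (conv f' g') \<le> I * L2_norm g"
    using L2_from_nn_integral[OF cm', of "I * L2_norm g"] I0 by auto
  then show "L2 (conv f g)" "L2_norm (conv f g) \<le> (LINT x|lebesgue. cmod (f x)) * L2_norm g"
    unfolding I_def[symmetric] using eq by (simp_all add: ext[of "conv f g" "conv f' g'"])
qed

section \<open>Gaussian averages of the autocorrelation, then isometry by approximation\<close>

section \<open>Plancherel's theorem\<close>

text \<open>The exponent -|x|^2/2 is chosen so that the function is a fixed point of the unitarily
  normalised transform.\<close>

definition gauss :: "'a::euclidean_space \<Rightarrow> complex" where
  "gauss x = complex_of_real (exp (- (norm x)\<^sup>2 / 2))"

lemma gauss_prod: "gauss x = (\<Prod>b\<in>Basis. complex_of_real (exp (- (x \<bullet> b)\<^sup>2 / 2)))"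
proof -
  have "(norm x)\<^sup>2 = x \<bullet> x" by (rule power2_norm_eq_inner)
  also have "\<dots> = (\<Sum>b\<in>Basis. (x \<bullet> b)\<^sup>2)"
    by (subst euclidean_inner) (simp add: power2_eq_square)
  finally have "(norm x)\<^sup>2 = (\<Sum>b\<in>Basis. (x \<bullet> b)\<^sup>2)" .
  then have "- (norm x)\<^sup>2 / 2 = (\<Sum>b\<in>Basis. - (x \<bullet> b)\<^sup>2 / 2)"
    by (simp add: sum_negf sum_divide_distrib)
  then show ?thesis
    by (simp only: gauss_def exp_sum finite_Basis of_real_prod)
qed

lemma borel_measurable_gauss: "gauss \<in> borel_measurable borel"
  unfolding gauss_def[abs_def] by measurable

lemma integrable_gaussian_real:
  "integrable lborel (\<lambda>x::real. complex_of_real (exp (- x\<^sup>2 / 2)))"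
proof -
  have "integrable lborel (\<lambda>x. sqrt (2 * pi) * std_normal_density x)" by simp
  also have "(\<lambda>x. sqrt (2 * pi) * std_normal_density x) = (\<lambda>x. exp (- x\<^sup>2 / 2))"
    by (simp add: std_normal_density_def fun_eq_iff)
  finally show ?thesis by (rule integrable_of_real)
qed

text \<open>Up to the factor sqrt(2 pi) of the density, this is the characteristic function of the
  standard normal distribution at \<open>- t\<close>.\<close>

lemma fourier_gaussian_real:
  "(LINT x|lborel. complex_of_real (exp (- x\<^sup>2 / 2)) * exp (- \<i> * complex_of_real (t * x)))
     = complex_of_real (sqrt (2 * pi)) * complex_of_real (exp (- t\<^sup>2 / 2))"
proof -
  have "complex_of_real (exp (- t\<^sup>2 / 2)) = char std_normal_distribution (- t)"
    by (simp add: char_std_normal_distribution)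
  also have "\<dots> = (LINT x|lborel. std_normal_density x *\<^sub>R iexp (- t * x))"
    unfolding char_def by (subst integral_density) auto
  also have "\<dots> = (LINT x|lborel. complex_of_real (1 / sqrt (2 * pi)) *
      (complex_of_real (exp (- x\<^sup>2 / 2)) * exp (- \<i> * complex_of_real (t * x))))"
    by (simp add: std_normal_density_def scaleR_conv_of_real)
  also have "\<dots> = complex_of_real (1 / sqrt (2 * pi)) *
      (LINT x|lborel. complex_of_real (exp (- x\<^sup>2 / 2)) * exp (- \<i> * complex_of_real (t * x)))"
    by (rule integral_mult_right_zero)
  finally show ?thesis by (simp add: field_simps)
qed

text \<open>The Gaussian and the kernel are both products over the coordinates, and
  \<open>lborel\<close> is the image of a product measure under \<open>T\<close>, so everything
  reduces to one dimension.\<close>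

lemma integrable_gauss: "integrable lebesgue (gauss :: 'a::euclidean_space \<Rightarrow> complex)"
  and fourier_gauss: "fourier gauss = (gauss :: 'a::euclidean_space \<Rightarrow> complex)"
proof -
  interpret P: product_sigma_finite "\<lambda>_::'a. lborel::real measure" ..
  define T where "T f = (\<Sum>b\<in>(Basis::'a set). f b *\<^sub>R b)" for f :: "'a \<Rightarrow> real"
  have T [measurable]: "T \<in> (\<Pi>\<^sub>M b\<in>Basis. lborel) \<rightarrow>\<^sub>M borel" unfolding T_def by measurable
  have Tb: "T f \<bullet> b = f b" if "b \<in> Basis" for f b
    using that by (simp add: T_def inner_sum_left inner_Basis if_distrib sum.delta cong: if_cong)
  have Tp: "p \<bullet> T f = (\<Sum>b\<in>Basis. (p \<bullet> b) * f b)" for f p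
    by (simp add: T_def inner_sum_right mult.commute)
  have lb: "(lborel :: 'a measure) = distr (\<Pi>\<^sub>M b\<in>Basis. lborel) borel T"
    unfolding T_def by (rule lborel_eq)
  have Tg: "gauss (T f) = (\<Prod>b\<in>Basis. complex_of_real (exp (- (f b)\<^sup>2 / 2)))" for f
    unfolding gauss_prod by (intro prod.cong) (auto simp: Tb)
  have ig: "integrable (lborel :: 'a measure) gauss"
  proof -
    have "integrable (\<Pi>\<^sub>M b\<in>(Basis::'a set). lborel) (\<lambda>f. \<Prod>b\<in>Basis. complex_of_real (exp (- (f b)\<^sup>2 / 2)))"
      by (rule P.product_integrable_prod) (use integrable_gaussian_real in auto)
    then show ?thesis
      unfolding lb by (subst integrable_distr_eq) (auto simp: Tg borel_measurable_gauss)
  qed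
  then show "integrable lebesgue (gauss :: 'a \<Rightarrow> complex)"
    using borel_measurable_gauss by (subst integrable_completion) auto
  show "fourier gauss = (gauss :: 'a \<Rightarrow> complex)"
  proof
    fix p :: 'a
    have m: "(\<lambda>x::'a. gauss x * exp (- \<i> * complex_of_real (p \<bullet> x))) \<in> borel_measurable borel"
      by (intro borel_measurable_times borel_measurable_gauss borel_measurable_continuous_onI continuous_intros)
    have "(LINT x|lborel. gauss x * exp (- \<i> * complex_of_real (p \<bullet> x)))
        = (LINT f|(\<Pi>\<^sub>M b\<in>(Basis::'a set). lborel). gauss (T f) * exp (- \<i> * complex_of_real (p \<bullet> T f)))"
      unfolding lb by (rule integral_distr[OF T m])
    also have "\<dots> = (LINT f|(\<Pi>\<^sub>M b\<in>(Basis::'a set). lborel).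
        (\<Prod>b\<in>Basis. complex_of_real (exp (- (f b)\<^sup>2 / 2)) * exp (- \<i> * complex_of_real ((p \<bullet> b) * f b))))"
      by (simp add: Tg Tp prod.distrib exp_sum sum_distrib_left sum_negf[symmetric])
    also have "\<dots> = (\<Prod>b\<in>(Basis::'a set). LINT x|lborel. complex_of_real (exp (- x\<^sup>2 / 2)) * exp (- \<i> * complex_of_real ((p \<bullet> b) * x)))"
    proof (rule P.product_integral_prod[where f="\<lambda>b x. complex_of_real (exp (- x\<^sup>2 / 2)) * exp (- \<i> * complex_of_real ((p \<bullet> b) * x))"])
      fix b :: 'a
      show "integrable lborel (\<lambda>x. complex_of_real (exp (- x\<^sup>2 / 2)) * exp (- \<i> * complex_of_real ((p \<bullet> b) * x)))"
      proof (rule Bochner_Integration.integrable_bound[OF integrable_gaussian_real])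
        show "AE x in lborel. norm (complex_of_real (exp (- x\<^sup>2 / 2)) * exp (- \<i> * complex_of_real ((p \<bullet> b) * x)))
          \<le> norm (complex_of_real (exp (- x\<^sup>2 / 2)))"
          by (simp add: norm_mult norm_exp_i_real del: mult_minus_left of_real_mult)
      qed measurable
    qed auto
    also have "\<dots> = (\<Prod>b\<in>(Basis::'a set). complex_of_real (sqrt (2 * pi)) * complex_of_real (exp (- (p \<bullet> b)\<^sup>2 / 2)))"
      by (intro prod.cong fourier_gaussian_real refl)
    also have "\<dots> = complex_of_real (fourier_const TYPE('a)) * gauss p"
    proof -
      have "sqrt (2 * pi) ^ DIM('a) = fourier_const TYPE('a)"
        by (simp add: powr_half_sqrt[symmetric] powr_realpow[symmetric] powr_powr)
      then show ?thesis
        by (simp add: prod.distrib gauss_prod flip: of_real_power)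
    qed
    finally show "fourier gauss p = gauss p"
      unfolding fourier_lborel[OF borel_measurable_gauss] by simp
  qed
qed

lemma integral_gauss: "(LINT x|lebesgue. gauss (x::'a::euclidean_space)) = complex_of_real (fourier_const TYPE('a))"
proof -
  have "fourier gauss (0::'a) = 1" by (simp add: fourier_gauss gauss_def)
  then show ?thesis by (simp add: fourier_def)
qed

lemma cmod_gauss: "complex_of_real (cmod (gauss x)) = gauss x"
  by (simp add: gauss_def)

lemma integral_cmod_gauss: "(LINT x|lebesgue. cmod (gauss (x::'a::euclidean_space))) = fourier_const TYPE('a)"
proof -
  have "complex_of_real (LINT x|lebesgue. cmod (gauss (x::'a))) = (LINT x|lebesgue. gauss (x::'a))"
    by (simp only: integral_complex_of_real[symmetric] cmod_gauss)
  then show ?thesis unfolding integral_gauss of_real_eq_iff .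
qed

lemma lebesgue_scale:
  fixes f :: "'a::euclidean_space \<Rightarrow> complex"
  assumes "0 < (s::real)" "integrable lebesgue f"
  shows "integrable lebesgue (\<lambda>x. f (s *\<^sub>R x))"
    "(LINT x|lebesgue. f x) = complex_of_real (s ^ DIM('a)) * (LINT x|lebesgue. f (s *\<^sub>R x))"
proof -
  define T where "T = (\<lambda>x::'a. s *\<^sub>R x)"
  have eq: "(\<lambda>x::'a. 0 + (\<Sum>j\<in>Basis. (s * (x \<bullet> j)) *\<^sub>R j)) = T"
    by (simp add: T_def scaleR_sum_right[symmetric] euclidean_representation flip: scaleR_scaleR)
  have m [measurable]: "T \<in> lebesgue \<rightarrow>\<^sub>M lebesgue"
    using lebesgue_affine_measurable[of "\<lambda>_. s" "0::'a"] assms(1) unfolding eq by simp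
  have d: "lebesgue = density (distr lebesgue lebesgue T) (\<lambda>_. ennreal (s ^ DIM('a)))"
    using lebesgue_affine_euclidean[of "\<lambda>_. s" "0::'a"] assms(1) unfolding eq by simp
  have [measurable]: "f \<in> borel_measurable lebesgue" using assms by auto
  have "integrable (density (distr lebesgue lebesgue T) (\<lambda>_. ennreal (s ^ DIM('a)))) f"
    using assms(2) d by simp
  then have "integrable lebesgue (\<lambda>x. (s ^ DIM('a)) *\<^sub>R f (T x))"
    using assms(1) by (subst (asm) integrable_density) (auto simp: integrable_distr_eq)
  from integrable_scaleR_right[of "1 / s ^ DIM('a)", OF this]
  show "integrable lebesgue (\<lambda>x. f (s *\<^sub>R x))" using assms(1) by (simp add: T_def)
  have "(LINT x|lebesgue. f x) = (LINT x|density (distr lebesgue lebesgue T) (\<lambda>_. ennreal (s ^ DIM('a))). f x)"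
    using d by simp
  also have "\<dots> = (LINT x|distr lebesgue lebesgue T. (s ^ DIM('a)) *\<^sub>R f x)"
    using assms(1) by (subst integral_density) auto
  also have "\<dots> = (LINT x|lebesgue. (s ^ DIM('a)) *\<^sub>R f (T x))"
    by (subst integral_distr) auto
  finally show "(LINT x|lebesgue. f x) = complex_of_real (s ^ DIM('a)) * (LINT x|lebesgue. f (s *\<^sub>R x))"
    by (simp add: T_def scaleR_conv_of_real)
qed

text \<open>The transform is evaluated at \<open>s *\<^sub>R x\<close> because that is the form
  reached by the substitution x -> s x in \<open>fourier_power2_gauss\<close>.\<close>

lemma fourier_gauss_scale:
  assumes "0 < (s::real)"
  shows "integrable lebesgue (\<lambda>p::'a::euclidean_space. gauss (s *\<^sub>R p))"
    "fourier (\<lambda>p. gauss (s *\<^sub>R p)) (s *\<^sub>R x) = gauss (x::'a) / complex_of_real (s ^ DIM('a))"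
proof -
  show "integrable lebesgue (\<lambda>p::'a. gauss (s *\<^sub>R p))"
    by (rule lebesgue_scale(1)[OF assms integrable_gauss])
  have "(LINT p|lebesgue. gauss p * exp (- \<i> * complex_of_real (x \<bullet> p))) =
    complex_of_real (s ^ DIM('a)) * (LINT p|lebesgue. gauss (s *\<^sub>R p) * exp (- \<i> * complex_of_real (x \<bullet> (s *\<^sub>R p))))"
    by (rule lebesgue_scale(2)[OF assms integrable_fourier_kernel[OF integrable_gauss]])
  then have "fourier gauss x = complex_of_real (s ^ DIM('a)) * fourier (\<lambda>p. gauss (s *\<^sub>R p)) (s *\<^sub>R x)"
    by (simp add: fourier_def)
  then show "fourier (\<lambda>p. gauss (s *\<^sub>R p)) (s *\<^sub>R x) = gauss x / complex_of_real (s ^ DIM('a))"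
    using assms by (simp add: fourier_gauss)
qed

text \<open>The autocorrelation \<open>x \<mapsto> \<integral> cnj (f (y - x)) f y dy\<close> has Fourier transform
  a multiple of \<open>\<bar>fourier f\<bar>\<^sup>2\<close>.\<close>

lemma fourier_power2_gauss:
  fixes f :: "'a::euclidean_space \<Rightarrow> complex"
  assumes "integrable lebesgue f" "0 < s"
  defines "A \<equiv> conv (\<lambda>x. cnj (f (- x))) f"
  shows "complex_of_real (fourier_const TYPE('a)) *
      (LINT p|lebesgue. complex_of_real ((cmod (fourier f p))\<^sup>2) * gauss (s *\<^sub>R p))
    = (LINT z|lebesgue. A (s *\<^sub>R z) * gauss z)"
proof -
  let ?C = "complex_of_real (fourier_const TYPE('a))"
  have fl: "integrable lebesgue (\<lambda>x. f (- x))"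
    using integrable_lebesgue_flip[OF assms(1), of 0] by simp
  have i: "integrable lebesgue (\<lambda>x. cnj (f (- x)))" using fl by simp
  have "fourier (\<lambda>x. f (- x)) p = fourier f (- p)" for p
    using integral_lebesgue_flip[OF integrable_fourier_kernel[OF assms(1), of "- p"], of 0]
    by (simp add: fourier_def)
  then have "fourier (\<lambda>x. cnj (f (- x))) p = cnj (fourier f p)" for p
    by (simp add: fourier_cnj)
  \<comment> \<open>Reflection and conjugation together conjugate the transform, so the convolution
    theorem produces the product of the transform of \<open>f\<close> with its own
    conjugate.\<close>
  then have FA: "fourier A p = ?C * complex_of_real ((cmod (fourier f p))\<^sup>2)" for p
    unfolding A_def conv_L1(2)[OF i assms(1)]
    by (simp only: complex_norm_square mult.assoc) (simp add: mult.commute)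
  have iA: "integrable lebesgue A" unfolding A_def by (rule conv_L1(1)[OF i assms(1)])
  note g = fourier_gauss_scale[OF assms(2)]
  have "?C * (LINT p|lebesgue. complex_of_real ((cmod (fourier f p))\<^sup>2) * gauss (s *\<^sub>R p))
      = (LINT p|lebesgue. fourier A p * gauss (s *\<^sub>R p))"
    by (simp add: FA mult.assoc)
  also have "\<dots> = (LINT x|lebesgue. A x * fourier (\<lambda>p. gauss (s *\<^sub>R p)) x)"
    by (rule fourier_duality[OF iA g(1)])
  \<comment> \<open>The Jacobian s^d of this substitution cancels the s^d in the denominator of the
    scaled Gaussian's transform. What remains is a fixed Gaussian weight, with \<open>A\<close>
    sampled near 0 when s is small.\<close>
  also have "\<dots> = complex_of_real (s ^ DIM('a)) *
      (LINT x|lebesgue. A (s *\<^sub>R x) * fourier (\<lambda>p. gauss (s *\<^sub>R p)) (s *\<^sub>R x))"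
  proof (rule lebesgue_scale(2)[OF assms(2)])
    \<comment> \<open>The change of variables asks for integrability; a bounded factor times the
      integrable \<open>A\<close> provides it.\<close>
    have "bounded (range (fourier (\<lambda>p::'a. gauss (s *\<^sub>R p))))"
      using fourier_bound[OF g(1)] by (auto simp: bounded_iff)
    then obtain B where B: "\<And>x. cmod (fourier (\<lambda>p::'a. gauss (s *\<^sub>R p)) x) \<le> B"
      by (auto simp: bounded_iff)
    show "integrable lebesgue (\<lambda>x. A x * fourier (\<lambda>p. gauss (s *\<^sub>R p)) x)"
    proof (rule Bochner_Integration.integrable_bound)
      show "integrable lebesgue (\<lambda>x. B * cmod (A x))" using iA by auto
      show "(\<lambda>x. A x * fourier (\<lambda>p. gauss (s *\<^sub>R p)) x) \<in> borel_measurable lebesgue"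
        using iA borel_measurable_fourier(2)[OF g(1)] by (auto intro!: borel_measurable_times)
      show "AE x in lebesgue. norm (A x * fourier (\<lambda>p. gauss (s *\<^sub>R p)) x) \<le> norm (B * cmod (A x))"
      proof (intro AE_I2)
        fix x :: 'a
        have "0 \<le> B" using order_trans[OF norm_ge_zero B] .
        then show "norm (A x * fourier (\<lambda>p. gauss (s *\<^sub>R p)) x) \<le> norm (B * cmod (A x))"
          using mult_right_mono[OF B[of x], of "cmod (A x)"] by (simp add: norm_mult mult.commute abs_mult)
      qed
    qed
  qed
  also have "\<dots> = (LINT z|lebesgue. A (s *\<^sub>R z) * gauss z)"
    using assms(2) by (simp add: g(2))
  finally show ?thesis .
qed

lemma L2_lebesgue_affine:
  assumes "L2 f" "c = 1 \<or> c = - 1"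
  shows "L2 (\<lambda>x. f (t + c *\<^sub>R x))" "L2_norm (\<lambda>x. f (t + c *\<^sub>R x)) = L2_norm f"
proof -
  have i: "integrable lebesgue (\<lambda>x. (norm (f x))\<^sup>2)" using assms(1) by (simp add: L2_def)
  show "L2 (\<lambda>x. f (t + c *\<^sub>R x))"
    using borel_measurable_lebesgue_affine[OF assms(2) L2_measurable[OF assms(1)], of t]
      integrable_lebesgue_affine[OF assms(2) i, of t] by (simp add: L2_def)
  show "L2_norm (\<lambda>x. f (t + c *\<^sub>R x)) = L2_norm f"
    using integral_lebesgue_affine[OF assms(2) i, of t] by (simp add: L2_norm_def)
qed

lemma borel_measurable_cnj:
  assumes "f \<in> borel_measurable M"
  shows "(\<lambda>x. cnj (f x)) \<in> borel_measurable M"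
  by (rule borel_measurable_continuous_on[OF _ assms]) (intro continuous_intros)

lemma L2_cnj:
  assumes "L2 f"
  shows "L2 (\<lambda>x. cnj (f x))" "L2_norm (\<lambda>x. cnj (f x)) = L2_norm f"
  using assms by (auto simp: L2_def L2_norm_def borel_measurable_cnj)

text \<open>Cauchy--Schwarz for \<open>f\<close> and a translate of its conjugate; translation and
  conjugation preserve the norm.\<close>

lemma autocorrelation_bound:
  assumes "L2 f"
  shows "cmod (conv (\<lambda>x. cnj (f (- x))) f x) \<le> (L2_norm f)\<^sup>2"
proof -
  have h: "L2 (\<lambda>y. cnj (f (- x + y)))" "L2_norm (\<lambda>y. cnj (f (- x + y))) = L2_norm f"
    using L2_lebesgue_affine[OF L2_cnj(1)[OF assms], of 1 "- x"] L2_cnj(2)[OF assms] by auto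
  have "cmod (LINT y|lebesgue. cnj (f (- x + y)) * f y) \<le> L2_norm f * L2_norm f"
    using L2_integrable_mult(2)[OF h(1) assms] h(2) by simp
  then show ?thesis by (simp add: conv_def power2_eq_square add.commute)
qed

text \<open>A square root of the Gaussian at p/(n+1), whence the exponent -1/4: the squared modulus
  of a cut-off transform then carries exactly the weight of \<open>fourier_power2_gauss\<close>. The
  shift to n+1 keeps the scale defined and positive for n = 0.\<close>

definition gauss_cutoff :: "nat \<Rightarrow> 'a::euclidean_space \<Rightarrow> complex" where
  "gauss_cutoff n p = complex_of_real (exp (- (norm ((1 / real (Suc n)) *\<^sub>R p))\<^sup>2 / 4))"

lemma gauss_cutoff:
  "(cmod (gauss_cutoff n p))\<^sup>2 = cmod (gauss ((1 / real (Suc n)) *\<^sub>R p))"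
  "cmod (gauss_cutoff n p) \<le> 1"
  "gauss_cutoff n \<in> borel_measurable lebesgue"
  "(\<lambda>n. gauss_cutoff n p) \<longlonglongrightarrow> 1"
proof -
  show "(cmod (gauss_cutoff n p))\<^sup>2 = cmod (gauss ((1 / real (Suc n)) *\<^sub>R p))"
    unfolding gauss_cutoff_def gauss_def norm_of_real abs_exp_cancel
    by (simp only: power2_eq_square flip: exp_add) simp
  show "cmod (gauss_cutoff n p) \<le> 1"
    unfolding gauss_cutoff_def norm_of_real abs_exp_cancel by simp
  show "gauss_cutoff n \<in> borel_measurable lebesgue"
    unfolding gauss_cutoff_def[abs_def]
    by (intro measurable_completion) (simp, measurable)
  have "(\<lambda>n. complex_of_real (exp (- (norm ((1 / real (Suc n)) *\<^sub>R p))\<^sup>2 / 4)))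
      \<longlonglongrightarrow> complex_of_real (exp (- (norm (0 *\<^sub>R p))\<^sup>2 / 4))"
    using LIMSEQ_inverse_real_of_nat by (intro tendsto_intros) (simp_all add: inverse_eq_divide)
  then show "(\<lambda>n. gauss_cutoff n p) \<longlonglongrightarrow> 1" by (simp add: gauss_cutoff_def)
qed

text \<open>The transform of an integrable function is bounded, so the Gaussian weight alone puts
  the product in L2, before anything is known about square integrability of the transform
  itself.\<close>

lemma L2_gauss_cutoff_fourier:
  fixes f :: "'a::euclidean_space \<Rightarrow> complex"
  assumes "integrable lebesgue f"
  shows "L2 (\<lambda>p. gauss_cutoff n p * fourier f p)"
    "complex_of_real (fourier_const TYPE('a) * (L2_norm (\<lambda>p. gauss_cutoff n p * fourier f p))\<^sup>2)
      = (LINT z|lebesgue. conv (\<lambda>x. cnj (f (- x))) f ((1 / real (Suc n)) *\<^sub>R z) * gauss z)"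
proof -
  define s where "s = 1 / real (Suc n)"
  have s: "0 < s" by (simp add: s_def)
  note mf = borel_measurable_fourier(2)[OF assms]
  define B where "B = (LINT x|lebesgue. cmod (f x)) / fourier_const TYPE('a)"
  have B: "cmod (fourier f p) \<le> B" for p unfolding B_def by (rule fourier_bound[OF assms])
  have sq: "(cmod (gauss_cutoff n p * fourier f p))\<^sup>2 = (cmod (fourier f p))\<^sup>2 * cmod (gauss (s *\<^sub>R p))" for p
    by (simp add: norm_mult power_mult_distrib gauss_cutoff(1) s_def mult.commute)
  have m: "(\<lambda>p. gauss_cutoff n p * fourier f p) \<in> borel_measurable lebesgue"
    by (intro borel_measurable_times mf gauss_cutoff(3))
  have "integrable lebesgue (\<lambda>p. (cmod (gauss_cutoff n p * fourier f p))\<^sup>2)"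
  proof (rule Bochner_Integration.integrable_bound)
    show "integrable lebesgue (\<lambda>p::'a. B\<^sup>2 * cmod (gauss (s *\<^sub>R p)))"
      using fourier_gauss_scale(1)[OF s] by auto
    show "AE p in lebesgue. norm ((cmod (gauss_cutoff n p * fourier f p))\<^sup>2) \<le> norm (B\<^sup>2 * cmod (gauss (s *\<^sub>R p)))"
      using B by (auto simp: sq abs_mult intro!: mult_right_mono power_mono)
  qed (use m in auto)
  then show "L2 (\<lambda>p. gauss_cutoff n p * fourier f p)" using m by (simp add: L2_def)
  have "complex_of_real ((L2_norm (\<lambda>p. gauss_cutoff n p * fourier f p))\<^sup>2)
      = (LINT p|lebesgue. complex_of_real ((cmod (fourier f p))\<^sup>2) * gauss (s *\<^sub>R p))"
    unfolding L2_norm_power2 sq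
    by (simp only: integral_complex_of_real[symmetric] of_real_mult cmod_gauss)
  then show "complex_of_real (fourier_const TYPE('a) * (L2_norm (\<lambda>p. gauss_cutoff n p * fourier f p))\<^sup>2)
      = (LINT z|lebesgue. conv (\<lambda>x. cnj (f (- x))) f ((1 / real (Suc n)) *\<^sub>R z) * gauss z)"
    using fourier_power2_gauss[OF assms s] by (simp only: of_real_mult s_def)
qed

text \<open>The autocorrelation is at most the squared norm and the Gaussian has total mass (2
  pi)^(d/2), which bounds all cut-off transforms by the norm of \<open>f\<close>; Fatou removes the
  cutoff. Using only a bound on the autocorrelation gives only an inequality.\<close>

lemma L2_fourier_contraction:
  fixes f :: "'a::euclidean_space \<Rightarrow> complex"
  assumes "integrable lebesgue f" "L2 f"
  shows "L2 (fourier f)" "L2_norm (fourier f) \<le> L2_norm f"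
proof -
  let ?C = "fourier_const TYPE('a)"
  let ?A = "conv (\<lambda>x. cnj (f (- x))) f"
  have "L2_norm (\<lambda>p. gauss_cutoff n p * fourier f p) \<le> L2_norm f" for n
  proof (rule power2_le_imp_le)
    have "?C * (L2_norm (\<lambda>p. gauss_cutoff n p * fourier f p))\<^sup>2
        = cmod (complex_of_real (?C * (L2_norm (\<lambda>p. gauss_cutoff n p * fourier f p))\<^sup>2))"
      unfolding norm_of_real by simp
    also have "\<dots> = cmod (LINT z|lebesgue. ?A ((1 / real (Suc n)) *\<^sub>R z) * gauss z)"
      unfolding L2_gauss_cutoff_fourier(2)[OF assms(1)] ..
    also have "\<dots> \<le> (LINT z|lebesgue. (L2_norm f)\<^sup>2 * cmod (gauss (z::'a)))"
    proof (rule order_trans[OF integral_norm_bound integral_mono'])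
      show "integrable lebesgue (\<lambda>z::'a. (L2_norm f)\<^sup>2 * cmod (gauss z))"
        using integrable_gauss by auto
      show "cmod (?A ((1 / real (Suc n)) *\<^sub>R z) * gauss z) \<le> (L2_norm f)\<^sup>2 * cmod (gauss z)" for z
        by (simp add: norm_mult autocorrelation_bound[OF assms(2)] mult_right_mono)
    qed simp
    also have "\<dots> = ?C * (L2_norm f)\<^sup>2"
      by (simp add: integral_cmod_gauss)
    finally show "(L2_norm (\<lambda>p. gauss_cutoff n p * fourier f p))\<^sup>2 \<le> (L2_norm f)\<^sup>2" by simp
  qed simp
  moreover have "AE p in lebesgue. (\<lambda>n. gauss_cutoff n p * fourier f p) \<longlonglongrightarrow> fourier f p"
    using tendsto_mult[OF gauss_cutoff(4) tendsto_const] by (intro AE_I2) fastforce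
  ultimately show "L2 (fourier f)" "L2_norm (fourier f) \<le> L2_norm f"
    using L2_Fatou[of "\<lambda>n p. gauss_cutoff n p * fourier f p" "fourier f" "L2_norm f",
        OF L2_gauss_cutoff_fourier(1)[OF assms(1)] borel_measurable_fourier(2)[OF assms(1)]]
    by auto
qed

text \<open>The squared norms of the cut-off transforms have two limits. By continuity of the
  autocorrelation at 0, where it equals the squared norm of \<open>f\<close>, the Gaussian averages
  tend to that value; and since the transform is already known to be in L2, dominated convergence
  makes the same quantities tend to its squared norm.\<close>

lemma L2_norm_fourier_continuous:
  fixes f :: "'a::euclidean_space \<Rightarrow> complex"
  assumes "integrable lebesgue f" "L2 f" "continuous_on UNIV f" "\<And>x. cmod (f x) \<le> B"
  shows "L2_norm (fourier f) = L2_norm f"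
proof -
  let ?C = "fourier_const TYPE('a)"
  let ?A = "conv (\<lambda>x. cnj (f (- x))) f"
  let ?s = "\<lambda>n. 1 / real (Suc n)"
  have A0: "?A 0 = complex_of_real ((L2_norm f)\<^sup>2)"
    unfolding conv_def L2_norm_power2
    by (simp only: integral_complex_of_real[symmetric] complex_norm_square) (simp add: mult.commute)
  have cA: "(\<lambda>n. ?A (x n)) \<longlonglongrightarrow> ?A 0" if x: "x \<longlonglongrightarrow> 0" for x
    unfolding conv_def
  proof (rule integral_dominated_convergence[where w="\<lambda>y. B * cmod (f y)"])
    show "integrable lebesgue (\<lambda>y. B * cmod (f y))" using assms(1) by auto
    have m: "(\<lambda>y. f (t + y)) \<in> borel_measurable lebesgue" for t
      using borel_measurable_lebesgue_affine[of 1 f t] assms(1) by auto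
    show "(\<lambda>y. cnj (f (- (0 - y))) * f y) \<in> borel_measurable lebesgue"
      "(\<lambda>y. cnj (f (- (x n - y))) * f y) \<in> borel_measurable lebesgue" for n
      using m[of 0] m[of "- x n"] assms(1) by (auto intro!: borel_measurable_times borel_measurable_cnj simp: add.commute)
    show "AE y in lebesgue. (\<lambda>n. cnj (f (- (x n - y))) * f y) \<longlonglongrightarrow> cnj (f (- (0 - y))) * f y"
    proof (rule AE_I2)
      fix y
      have "isCont f (- (0 - y))"
        using assms(3) by (simp add: continuous_on_eq_continuous_at)
      moreover have "(\<lambda>n. - (x n - y)) \<longlonglongrightarrow> - (0 - y)" by (intro tendsto_intros x)
      ultimately have "(\<lambda>n. f (- (x n - y))) \<longlonglongrightarrow> f (- (0 - y))" by (rule isCont_tendsto_compose)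
      then show "(\<lambda>n. cnj (f (- (x n - y))) * f y) \<longlonglongrightarrow> cnj (f (- (0 - y))) * f y"
        by (intro tendsto_intros)
    qed
    show "AE y in lebesgue. cmod (cnj (f (- (x n - y))) * f y) \<le> B * cmod (f y)" for n
      using assms(4) by (auto simp: norm_mult intro!: mult_right_mono)
  qed
  have iA: "integrable lebesgue ?A"
    using conv_L1(1)[of "\<lambda>x. cnj (f (- x))" f] integrable_lebesgue_flip[OF assms(1), of 0] assms(1) by simp
  have "(\<lambda>n. LINT z|lebesgue. ?A (?s n *\<^sub>R z) * gauss z) \<longlonglongrightarrow> (LINT z|lebesgue. ?A 0 * gauss (z::'a))"
  proof (rule integral_dominated_convergence[where w="\<lambda>z. (L2_norm f)\<^sup>2 * cmod (gauss z)"])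
    show "integrable lebesgue (\<lambda>z::'a. (L2_norm f)\<^sup>2 * cmod (gauss z))"
      using integrable_gauss by auto
    have mg: "gauss \<in> borel_measurable (lebesgue::'a measure)"
      by (rule borel_measurable_integrable[OF integrable_gauss])
    show "(\<lambda>z::'a. ?A 0 * gauss z) \<in> borel_measurable lebesgue"
      using mg by (intro borel_measurable_times) auto
    show "(\<lambda>z. ?A (?s n *\<^sub>R z) * gauss z) \<in> borel_measurable lebesgue" for n
      using lebesgue_scale(1)[OF _ iA, of "?s n"] mg by (intro borel_measurable_times) auto
    show "AE z in lebesgue. (\<lambda>n. ?A (?s n *\<^sub>R z) * gauss z) \<longlonglongrightarrow> ?A 0 * gauss z"
    proof (rule AE_I2)
      fix z :: 'a
      have "(\<lambda>n. ?s n *\<^sub>R z) \<longlonglongrightarrow> 0 *\<^sub>R z"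
        using LIMSEQ_inverse_real_of_nat by (intro tendsto_intros) (simp add: inverse_eq_divide)
      then show "(\<lambda>n. ?A (?s n *\<^sub>R z) * gauss z) \<longlonglongrightarrow> ?A 0 * gauss z"
        by (intro tendsto_intros cA) simp
    qed
    show "AE z in lebesgue. cmod (?A (?s n *\<^sub>R z) * gauss z) \<le> (L2_norm f)\<^sup>2 * cmod (gauss z)" for n
      by (simp add: norm_mult autocorrelation_bound[OF assms(2)] mult_right_mono)
  qed
  then have "(\<lambda>n. complex_of_real (?C * (L2_norm (\<lambda>p. gauss_cutoff n p * fourier f p))\<^sup>2))
      \<longlonglongrightarrow> complex_of_real (?C * (L2_norm f)\<^sup>2)"
    by (simp only: L2_gauss_cutoff_fourier(2)[OF assms(1)] A0 integral_mult_right_zero integral_gauss)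
      (simp add: mult.commute)
  then have 1: "(\<lambda>n. ?C * (L2_norm (\<lambda>p. gauss_cutoff n p * fourier f p))\<^sup>2) \<longlonglongrightarrow> ?C * (L2_norm f)\<^sup>2"
    by (simp only: tendsto_of_real_iff)
  note Lf = L2_fourier_contraction(1)[OF assms(1,2)]
  have "tendsto_L2 (\<lambda>n p. gauss_cutoff n p * fourier f p) (fourier f)"
  proof (rule tendsto_L2_dominated[OF _ _ Lf])
    show "AE p in lebesgue. norm (gauss_cutoff n p * fourier f p) \<le> norm (fourier f p)" for n
      using mult_right_mono[OF gauss_cutoff(2) norm_ge_zero] by (intro AE_I2) (simp add: norm_mult)
    show "AE p in lebesgue. (\<lambda>n. gauss_cutoff n p * fourier f p) \<longlonglongrightarrow> fourier f p"
      using tendsto_mult[OF gauss_cutoff(4) tendsto_const] by (intro AE_I2) fastforce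
  qed (use Lf L2_gauss_cutoff_fourier(1)[OF assms(1)] in \<open>auto simp: L2_def\<close>)
  then have "(\<lambda>n. ?C * (L2_norm (\<lambda>p. gauss_cutoff n p * fourier f p))\<^sup>2) \<longlonglongrightarrow> ?C * (L2_norm (fourier f))\<^sup>2"
    by (intro tendsto_intros tendsto_L2_norm)
  with 1 have "?C * (L2_norm (fourier f))\<^sup>2 = ?C * (L2_norm f)\<^sup>2" by (rule LIMSEQ_unique[symmetric])
  then have "(L2_norm (fourier f))\<^sup>2 = (L2_norm f)\<^sup>2" by simp
  then show ?thesis by (simp add: power2_eq_iff_nonneg)
qed

lemma tendsto_L2_fourier:
  assumes "tendsto_L2 f g" "\<And>n. integrable lebesgue (f n)" "integrable lebesgue g"
  shows "tendsto_L2 (\<lambda>n. fourier (f n)) (fourier g)"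
proof (rule tendsto_L2_bound)
  have L: "L2 (f n)" "L2 g" for n using assms(1) by (auto simp: tendsto_L2_def)
  show "L2_norm (\<lambda>p. fourier (f n) p - fourier g p) \<le> L2_norm (\<lambda>x. f n x - g x)" for n
    using L2_fourier_contraction(2)[OF _ L2_diff[OF L(1)[of n] L(2)]] assms(2)[of n] assms(3)
    by (simp add: fourier_diff[OF assms(2)[of n] assms(3)] flip: fourier_diff[OF assms(2)[of n] assms(3), abs_def])
  show "(\<lambda>n. L2_norm (\<lambda>x. f n x - g x)) \<longlonglongrightarrow> 0" using assms(1) by (auto simp: tendsto_L2_def)
qed (use assms in \<open>auto simp: tendsto_L2_def intro!: L2_fourier_contraction\<close>)

text \<open>The norm identity is a closed condition under L2 convergence, because the contraction
  makes the transforms converge too. This is the tool for both approximation steps below.\<close>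

lemma L2_norm_fourier_limit:
  assumes "tendsto_L2 f g" "\<And>n. integrable lebesgue (f n)" "integrable lebesgue g"
    and "\<And>n. L2_norm (fourier (f n)) = L2_norm (f n)"
  shows "L2_norm (fourier g) = L2_norm g"
  using tendsto_L2_norm[OF tendsto_L2_fourier[OF assms(1-3)]] tendsto_L2_norm[OF assms(1)]
  unfolding assms(4) by (rule LIMSEQ_unique)

lemma indicator_cball_L2:
  fixes B :: real
  shows "L2 (\<lambda>x::'a::euclidean_space. complex_of_real (B * indicator (cball 0 R) x))"
    "integrable lebesgue (\<lambda>x::'a::euclidean_space. complex_of_real (B * indicator (cball 0 R) x))"
proof -
  have fin: "emeasure lebesgue (cball (0::'a) R) < \<infinity>"
    using emeasure_compact_finite[of "cball (0::'a) R"] by (simp add: emeasure_completion)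
  have i: "integrable lebesgue (\<lambda>x::'a. indicator (cball 0 R) x :: real)"
    using fin by (intro integrable_real_indicator) auto
  then show "integrable lebesgue (\<lambda>x::'a. complex_of_real (B * indicator (cball 0 R) x))"
    by (intro integrable_of_real integrable_mult_right)
  have "(\<lambda>x::'a. (B * indicator (cball 0 R) x)\<^sup>2) = (\<lambda>x. B\<^sup>2 * indicator (cball 0 R) x)"
    by (auto simp: fun_eq_iff indicator_def)
  with i show "L2 (\<lambda>x::'a. complex_of_real (B * indicator (cball 0 R) x))"
    unfolding L2_of_real by (simp add: L2_def)
qed

text \<open>A measurable function is an a.e. limit of continuous ones. These are modified to be
  uniformly bounded and supported in a common ball without losing continuity, so that one multiple
  of an indicator dominates them all.\<close>

lemma L2_norm_fourier_bounded:
  fixes f :: "'a::euclidean_space \<Rightarrow> complex"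
  assumes "f \<in> borel_measurable lebesgue" "B > 0"
    and b: "\<And>x. cmod (f x) \<le> B" and R: "\<And>x. R < norm x \<Longrightarrow> f x = 0"
  shows "L2_norm (fourier f) = L2_norm f"
proof -
  have "f measurable_on UNIV" using assms(1) by (rule lebesgue_measurable_imp_measurable_on[of _ UNIV, simplified])
  then obtain N g where N: "negligible N" and cg: "\<And>n. continuous_on UNIV (g n)"
    and lim: "\<And>x. x \<notin> N \<Longrightarrow> (\<lambda>n. g n x) \<longlonglongrightarrow> f x"
    unfolding measurable_on_def by auto
  \<comment> \<open>\<open>cut\<close> falls continuously from 1 on the ball of radius R to 0 at
    radius R + 1, and \<phi> retracts the complex plane radially onto the disc of radius B. Both
    leave \<open>f\<close> itself unchanged.\<close>
  define cut :: "'a \<Rightarrow> real" where "cut x = max 0 (min 1 (R + 1 - norm x))" for x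
  define \<phi> :: "complex \<Rightarrow> complex" where "\<phi> z = z / complex_of_real (max 1 (cmod z / B))" for z
  have c\<phi>: "continuous_on UNIV \<phi>"
  proof -
    have "complex_of_real (max 1 (cmod z / B)) \<noteq> 0" for z
      unfolding of_real_eq_0_iff using max.cobounded1[of 1 "cmod z / B"] by linarith
    then show ?thesis unfolding \<phi>_def using assms(2) by (intro continuous_intros) auto
  qed
  have \<phi>B: "cmod (\<phi> z) \<le> B" for z
    using assms(2) by (auto simp: \<phi>_def norm_divide max_def field_simps)
  have \<phi>id: "\<phi> z = z" if "cmod z \<le> B" for z
    using that assms(2) by (simp add: \<phi>_def max_def)
  have cut: "0 \<le> cut x" "cut x \<le> 1" "R + 1 < norm x \<Longrightarrow> cut x = 0" "norm x \<le> R \<Longrightarrow> cut x = 1" for x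
    by (auto simp: cut_def)
  define F where "F n x = complex_of_real (cut x) * \<phi> (g n x)" for n x
  define h where "h x = complex_of_real (B * indicator (cball 0 (R + 1)) x)" for x :: 'a
  have h: "L2 h" "integrable lebesgue h" unfolding h_def by (rule indicator_cball_L2)+
  have cF: "continuous_on UNIV (F n)" for n
    unfolding F_def cut_def by (intro continuous_intros continuous_on_compose2[OF c\<phi> cg]) auto
  have mF: "F n \<in> borel_measurable lebesgue" for n
    using borel_measurable_continuous_onI[OF cF] by (intro measurable_completion) simp
  have Fh: "norm (F n x) \<le> norm (h x)" for n x
  proof -
    have "norm (F n x) \<le> B" using cut(1,2)[of x] \<phi>B[of "g n x"] mult_mono[of "cut x" 1 "cmod (\<phi> (g n x))" B] assms(2)
      by (simp add: F_def norm_mult)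
    moreover have "R + 1 < norm x \<Longrightarrow> F n x = 0" using cut(3) by (simp add: F_def)
    ultimately show ?thesis using assms(2) by (auto simp: h_def norm_mult indicator_def simp del: of_real_mult)
  qed
  have fh: "norm (f x) \<le> norm (h x)" for x
    using b[of x] R[of x] assms(2) by (cases "norm x \<le> R + 1") (auto simp: h_def norm_mult)
  have iF: "integrable lebesgue (F n)" for n
    by (rule Bochner_Integration.integrable_bound[OF h(2) mF]) (use Fh in auto)
  have if': "integrable lebesgue f"
    by (rule Bochner_Integration.integrable_bound[OF h(2) assms(1)]) (use fh in auto)
  have LF: "L2 (F n)" for n by (rule L2_bound(1)[OF h(1) mF]) (use Fh in auto)
  have "tendsto_L2 F f"
  proof (rule tendsto_L2_dominated[OF mF assms(1) h(1)])
    have "N \<in> null_sets lebesgue" using N by (simp add: negligible_iff_null_sets)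
    then have "AE x in lebesgue. x \<notin> N" by (rule AE_not_in)
    then show "AE x in lebesgue. (\<lambda>n. F n x) \<longlonglongrightarrow> f x"
    proof eventually_elim
      case (elim x)
      have "isCont \<phi> (f x)" using c\<phi> by (simp add: continuous_on_eq_continuous_at)
      then have "(\<lambda>n. \<phi> (g n x)) \<longlonglongrightarrow> \<phi> (f x)"
        using lim[OF elim] by (rule isCont_tendsto_compose)
      then have "(\<lambda>n. F n x) \<longlonglongrightarrow> complex_of_real (cut x) * f x"
        unfolding F_def \<phi>id[OF b] by (intro tendsto_intros)
      moreover have "complex_of_real (cut x) * f x = f x"
        using cut(4)[of x] R[of x] by (cases "norm x \<le> R") auto
      ultimately show ?case by simp
    qed
  qed (use Fh in auto)
  then show ?thesis
  proof (rule L2_norm_fourier_limit[OF _ iF if'])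
    fix n
    have "cmod (F n x) \<le> B" for x
      using cut(1,2)[of x] \<phi>B[of "g n x"] mult_mono[of "cut x" 1 "cmod (\<phi> (g n x))" B] assms(2)
      by (simp add: F_def norm_mult)
    then show "L2_norm (fourier (F n)) = L2_norm (F n)"
      by (rule L2_norm_fourier_continuous[OF iF LF cF])
  qed
qed

text \<open>Truncating both the argument and the value reduces to the bounded, boundedly supported
  case, with \<open>f\<close> itself as the majorant.\<close>

theorem Plancherel:
  fixes f :: "'a::euclidean_space \<Rightarrow> complex"
  assumes "integrable lebesgue f" "L2 f"
  shows "L2_norm (fourier f) = L2_norm f"
proof -
  have [measurable]: "f \<in> borel_measurable lebesgue" using assms by auto
  have [measurable]: "norm \<in> borel_measurable (lebesgue :: 'a measure)"
    by (intro measurable_completion) simp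
  define F where "F n x = (if norm x \<le> real n \<and> cmod (f x) \<le> real n then f x else 0)" for n x
  have mF: "F n \<in> borel_measurable lebesgue" for n unfolding F_def by measurable
  have Ff: "norm (F n x) \<le> norm (f x)" for n x by (simp add: F_def)
  have iF: "integrable lebesgue (F n)" for n
    by (rule Bochner_Integration.integrable_bound[OF assms(1) mF]) (use Ff in auto)
  have "tendsto_L2 F f"
  proof (rule tendsto_L2_dominated[OF mF _ assms(2)])
    show "AE x in lebesgue. (\<lambda>n. F n x) \<longlonglongrightarrow> f x"
    proof (intro AE_I2 tendsto_eventually)
      fix x
      show "\<forall>\<^sub>F n in sequentially. F n x = f x"
        using eventually_ge_at_top[of "nat \<lceil>max (norm x) (cmod (f x))\<rceil>"]
        by eventually_elim (auto simp: F_def nat_le_iff ceiling_le_iff)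
    qed
  qed (use Ff in auto)
  then show ?thesis
  proof (rule L2_norm_fourier_limit[OF _ iF assms(1)])
    fix n
    show "L2_norm (fourier (F n)) = L2_norm (F n)"
      \<comment> \<open>The bound n + 1 instead of n keeps it strictly positive for n = 0.\<close>
      by (rule L2_norm_fourier_bounded[OF mF, of "real n + 1" _ "real n"]) (auto simp: F_def)
  qed
qed

section \<open>The L2 transform as a surjective isometry modulo null sets\<close>

section \<open>The Fourier transform of square integrable functions\<close>

definition ball_truncation :: "nat \<Rightarrow> ('a::euclidean_space \<Rightarrow> complex) \<Rightarrow> 'a \<Rightarrow> complex" where
  "ball_truncation n f = (\<lambda>x. if norm x \<le> real n then f x else 0)"

lemma has_L2_fourier_iff:
  "has_L2_fourier f \<phi> \<longleftrightarrow> L2 f \<and> tendsto_L2 (\<lambda>n. fourier (ball_truncation n f)) \<phi>"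
  by (simp add: has_L2_fourier_def ball_truncation_def)

lemma ball_truncation:
  assumes "L2 f"
  shows "integrable lebesgue (ball_truncation n f)" "L2 (ball_truncation n f)"
    "tendsto_L2 (\<lambda>n. ball_truncation n f) f"
proof -
  have mf: "f \<in> borel_measurable lebesgue" using assms by (simp add: L2_def)
  have [measurable]: "norm \<in> borel_measurable (lebesgue :: 'a measure)"
    by (intro measurable_completion) simp
  have m: "ball_truncation n f \<in> borel_measurable lebesgue" for n
    using mf unfolding ball_truncation_def by measurable
  have b: "norm (ball_truncation n f x) \<le> norm (f x)" for n x by (simp add: ball_truncation_def)
  show "L2 (ball_truncation n f)" by (rule L2_bound(1)[OF assms m]) (use b in auto)
  show "integrable lebesgue (ball_truncation n f)"
  proof -
    \<comment> \<open>Integrability follows from Cauchy--Schwarz, since the truncation is a product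
      of two L2 functions.\<close>
    have "ball_truncation n f = (\<lambda>x. f x * complex_of_real (1 * indicator (cball 0 (real n)) x))"
      by (auto simp: ball_truncation_def indicator_def)
    then show ?thesis using L2_integrable_mult(1)[OF assms indicator_cball_L2(1)[of 1 "real n"]] by simp
  qed
  show "tendsto_L2 (\<lambda>n. ball_truncation n f) f"
  proof (rule tendsto_L2_dominated[OF m mf assms])
    show "AE x in lebesgue. (\<lambda>n. ball_truncation n f x) \<longlonglongrightarrow> f x"
    proof (intro AE_I2 tendsto_eventually)
      fix x
      show "\<forall>\<^sub>F n in sequentially. ball_truncation n f x = f x"
        using eventually_ge_at_top[of "nat \<lceil>norm x\<rceil>"]
        by eventually_elim (auto simp: ball_truncation_def nat_le_iff ceiling_le_iff)
    qed
  qed (use b in auto)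
qed

lemma tendsto_L2_Cauchy:
  assumes "tendsto_L2 f g" "e > 0"
  shows "\<exists>N. \<forall>m\<ge>N. \<forall>n\<ge>N. L2_norm (\<lambda>x. f m x - f n x) < e"
proof -
  have L: "L2 (f n)" "L2 g" for n using assms(1) by (auto simp: tendsto_L2_def)
  have "(\<lambda>n. L2_norm (\<lambda>x. f n x - g x)) \<longlonglongrightarrow> 0" using assms(1) by (simp add: tendsto_L2_def)
  from LIMSEQ_D[OF this, of "e / 2"] assms(2)
  obtain N where N: "\<And>n. n \<ge> N \<Longrightarrow> L2_norm (\<lambda>x. f n x - g x) < e / 2" by auto
  have "L2_norm (\<lambda>x. f m x - f n x) < e" if "m \<ge> N" "n \<ge> N" for m n
    using L2_norm_triangle_diff[OF L(1)[of m] L(2) L(1)[of n]] N[OF that(1)] N[OF that(2)]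
      L2_norm_minus_commute[of g "f n"] by simp
  then show ?thesis by blast
qed

lemma L2_norm_fourier_diff:
  assumes "integrable lebesgue f" "L2 f" "integrable lebesgue g" "L2 g"
  shows "L2_norm (\<lambda>p. fourier f p - fourier g p) = L2_norm (\<lambda>x. f x - g x)"
proof -
  have "(\<lambda>p. fourier f p - fourier g p) = fourier (\<lambda>x. f x - g x)"
    using fourier_diff[OF assms(1,3)] by auto
  moreover have "L2_norm (fourier (\<lambda>x. f x - g x)) = L2_norm (\<lambda>x. f x - g x)"
    using assms by (intro Plancherel L2_diff) auto
  ultimately show ?thesis by simp
qed

text \<open>By Plancherel the transforms of the truncations are as close to each other as the
  truncations themselves, hence Cauchy; completeness provides the limit.\<close>

lemma has_L2_fourier_exists:
  assumes "L2 f"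
  obtains \<phi> where "has_L2_fourier f \<phi>"
proof -
  note T = ball_truncation[OF assms]
  have "L2 (fourier (ball_truncation n f))" for n by (rule L2_fourier_contraction(1)[OF T(1,2)])
  moreover have "\<exists>N. \<forall>m\<ge>N. \<forall>n\<ge>N. L2_norm (\<lambda>p. fourier (ball_truncation m f) p - fourier (ball_truncation n f) p) < e"
    if "e > 0" for e
    using tendsto_L2_Cauchy[OF T(3) that] by (simp add: L2_norm_fourier_diff[OF T(1,2) T(1,2)])
  ultimately obtain \<phi> where "tendsto_L2 (\<lambda>n. fourier (ball_truncation n f)) \<phi>"
    by (rule L2_complete)
  then show ?thesis using that assms by (simp add: has_L2_fourier_iff)
qed

lemma has_L2_fourier_L2:
  assumes "has_L2_fourier f \<phi>"
  shows "L2 f" "L2 \<phi>"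
  using assms by (auto simp: has_L2_fourier_iff tendsto_L2_def)

lemma has_L2_fourier_unique:
  assumes "has_L2_fourier f \<phi>" "has_L2_fourier f \<psi>"
  shows "AE p in lebesgue. \<phi> p = \<psi> p"
  using assms tendsto_L2_unique by (auto simp: has_L2_fourier_iff)

lemma tendsto_L2_cong_AE:
  assumes "tendsto_L2 f g" "AE x in lebesgue. g x = h x"
  shows "tendsto_L2 f h"
proof -
  have L: "L2 (f n)" "L2 g" for n using assms(1) by (auto simp: tendsto_L2_def)
  have "L2_norm (\<lambda>x. f n x - h x) = L2_norm (\<lambda>x. f n x - g x)" for n
    by (rule L2_cong_AE(2)[OF L2_diff[OF L]]) (use assms(2) in eventually_elim, simp)
  then show ?thesis using assms L2_cong_AE(1)[OF L(2) assms(2)] by (simp add: tendsto_L2_def)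
qed

lemma has_L2_fourier_cong_AE:
  assumes "has_L2_fourier f \<phi>" "AE x in lebesgue. f x = g x" "AE p in lebesgue. \<phi> p = \<psi> p"
  shows "has_L2_fourier g \<psi>"
proof -
  note Lf = has_L2_fourier_L2(1)[OF assms(1)]
  have "fourier (ball_truncation n g) = fourier (ball_truncation n f)" for n
    by (rule fourier_cong_AE[symmetric, OF L2_measurable[OF ball_truncation(2)[OF Lf]]])
      (use assms(2) in eventually_elim, simp add: ball_truncation_def)
  then show ?thesis
    using assms(1) L2_cong_AE(1)[OF Lf assms(2)] tendsto_L2_cong_AE[OF _ assms(3)]
    by (simp add: has_L2_fourier_iff)
qed

lemma has_L2_fourier_diff:
  assumes "has_L2_fourier f \<phi>" "has_L2_fourier g \<psi>"
  shows "has_L2_fourier (\<lambda>x. f x - g x) (\<lambda>p. \<phi> p - \<psi> p)"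
proof -
  note L = has_L2_fourier_L2(1)[OF assms(1)] has_L2_fourier_L2(1)[OF assms(2)]
  have "ball_truncation n (\<lambda>x. f x - g x) = (\<lambda>x. ball_truncation n f x - ball_truncation n g x)" for n
    by (auto simp: ball_truncation_def)
  then have "fourier (ball_truncation n (\<lambda>x. f x - g x)) =
      (\<lambda>p. fourier (ball_truncation n f) p - fourier (ball_truncation n g) p)" for n
    using fourier_diff[OF ball_truncation(1)[OF L(1)] ball_truncation(1)[OF L(2)]] by auto
  then show ?thesis
    using assms L2_diff[OF L] by (simp add: has_L2_fourier_iff tendsto_L2_diff)
qed

lemma has_L2_fourier_cmult:
  assumes "has_L2_fourier f \<phi>"
  shows "has_L2_fourier (\<lambda>x. c * f x) (\<lambda>p. c * \<phi> p)"
proof -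
  have "ball_truncation n (\<lambda>x. c * f x) = (\<lambda>x. c * ball_truncation n f x)" for n
    by (auto simp: ball_truncation_def)
  then have "fourier (ball_truncation n (\<lambda>x. c * f x)) = (\<lambda>p. c * fourier (ball_truncation n f) p)" for n
    by (intro ext) (simp add: fourier_cmult)
  then show ?thesis
    using assms L2_cmult(1)[of f c] by (simp add: has_L2_fourier_iff tendsto_L2_cmult)
qed

lemma has_L2_fourier_add:
  assumes "has_L2_fourier f \<phi>" "has_L2_fourier g \<psi>"
  shows "has_L2_fourier (\<lambda>x. f x + g x) (\<lambda>p. \<phi> p + \<psi> p)"
  using has_L2_fourier_diff[OF assms(1) has_L2_fourier_cmult[OF assms(2), of "-1"]] by simp

lemma has_L2_fourier_norm:
  assumes "has_L2_fourier f \<phi>"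
  shows "L2_norm \<phi> = L2_norm f"
proof -
  note T = ball_truncation[OF has_L2_fourier_L2(1)[OF assms]]
  have "(\<lambda>n. L2_norm (fourier (ball_truncation n f))) \<longlonglongrightarrow> L2_norm \<phi>"
    using assms by (intro tendsto_L2_norm) (simp add: has_L2_fourier_iff)
  moreover have "(\<lambda>n. L2_norm (fourier (ball_truncation n f))) \<longlonglongrightarrow> L2_norm f"
    unfolding Plancherel[OF T(1,2)] by (rule tendsto_L2_norm[OF T(3)])
  ultimately show ?thesis by (rule LIMSEQ_unique)
qed

lemma has_L2_fourier_norm_diff:
  assumes "has_L2_fourier f \<phi>" "has_L2_fourier g \<psi>"
  shows "L2_norm (\<lambda>p. \<phi> p - \<psi> p) = L2_norm (\<lambda>x. f x - g x)"
  using has_L2_fourier_norm[OF has_L2_fourier_diff[OF assms]] .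

lemma has_L2_fourier_inj:
  assumes "has_L2_fourier f \<phi>" "has_L2_fourier g \<psi>" "AE p in lebesgue. \<phi> p = \<psi> p"
  shows "AE x in lebesgue. f x = g x"
proof -
  note d = has_L2_fourier_diff[OF assms(1,2)]
  have "L2_norm (\<lambda>p. \<phi> p - \<psi> p) = L2_norm (\<lambda>p::'a. 0::complex)"
    by (rule L2_cong_AE(2)[OF L2_zero(1)]) (use assms(3) in eventually_elim, simp)
  then have "L2_norm (\<lambda>x. f x - g x) = 0" using has_L2_fourier_norm[OF d] by simp
  from L2_norm_eq_0[OF has_L2_fourier_L2(1)[OF d] this] show ?thesis by simp
qed

text \<open>The graph of the transform is closed: the isometry makes the transforms converge to any
  transform of the limit, and L2 limits are unique up to null sets.\<close>

lemma has_L2_fourier_limit: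
  assumes "tendsto_L2 f g" "\<And>n. has_L2_fourier (f n) (\<phi> n)" "tendsto_L2 \<phi> \<psi>"
  shows "has_L2_fourier g \<psi>"
proof -
  have Lg: "L2 g" using assms(1) by (simp add: tendsto_L2_def)
  obtain \<psi>' where \<psi>': "has_L2_fourier g \<psi>'" using has_L2_fourier_exists[OF Lg] .
  have "tendsto_L2 \<phi> \<psi>'"
    unfolding tendsto_L2_def has_L2_fourier_norm_diff[OF assms(2) \<psi>']
    using assms(1) has_L2_fourier_L2(2)[OF assms(2)] has_L2_fourier_L2(2)[OF \<psi>']
    by (simp add: tendsto_L2_def)
  then have "AE p in lebesgue. \<psi>' p = \<psi> p" using tendsto_L2_unique assms(3) by blast
  then show ?thesis using has_L2_fourier_cong_AE[OF \<psi>'] by simp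
qed

text \<open>Consistency of the two transforms on the functions to which both apply.\<close>

lemma has_L2_fourier_L1:
  assumes "integrable lebesgue f" "L2 f"
  shows "has_L2_fourier f (fourier f)"
  unfolding has_L2_fourier_iff
  using tendsto_L2_fourier[OF ball_truncation(3)[OF assms(2)] ball_truncation(1)[OF assms(2)] assms(1)] assms(2)
  by simp

text \<open>The L1 duality holds for truncations of both functions. The truncation of
  \<open>f\<close> is removed first and that of \<open>g\<close> second, each time because the
  pairing with a fixed L2 function is continuous.\<close>

lemma has_L2_fourier_duality:
  assumes "has_L2_fourier f \<phi>" "has_L2_fourier g \<psi>"
  shows "(LINT p|lebesgue. \<phi> p * g p) = (LINT x|lebesgue. f x * \<psi> x)"
proof -
  note Lf = has_L2_fourier_L2[OF assms(1)] and Lg = has_L2_fourier_L2[OF assms(2)]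
  note Tf = ball_truncation[OF Lf(1)] and Tg = ball_truncation[OF Lg(1)]
  have F: "tendsto_L2 (\<lambda>n. fourier (ball_truncation n f)) \<phi>"
    "tendsto_L2 (\<lambda>n. fourier (ball_truncation n g)) \<psi>"
    using assms by (auto simp: has_L2_fourier_iff)
  have 1: "(LINT p|lebesgue. \<phi> p * ball_truncation m g p) = (LINT x|lebesgue. f x * fourier (ball_truncation m g) x)" for m
  proof (rule LIMSEQ_unique)
    show "(\<lambda>n. LINT p|lebesgue. fourier (ball_truncation n f) p * ball_truncation m g p)
      \<longlonglongrightarrow> (LINT p|lebesgue. \<phi> p * ball_truncation m g p)"
      by (rule tendsto_L2_integral_mult[OF F(1) Tg(2)])
    show "(\<lambda>n. LINT p|lebesgue. fourier (ball_truncation n f) p * ball_truncation m g p)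
      \<longlonglongrightarrow> (LINT x|lebesgue. f x * fourier (ball_truncation m g) x)"
      unfolding fourier_duality[OF Tf(1) Tg(1)]
      by (rule tendsto_L2_integral_mult[OF Tf(3) L2_fourier_contraction(1)[OF Tg(1,2)]])
  qed
  show ?thesis
  proof (rule LIMSEQ_unique)
    show "(\<lambda>m. LINT p|lebesgue. \<phi> p * ball_truncation m g p) \<longlonglongrightarrow> (LINT p|lebesgue. \<phi> p * g p)"
      using tendsto_L2_integral_mult[OF Tg(3) Lf(2)] by (simp add: mult.commute)
    show "(\<lambda>m. LINT p|lebesgue. \<phi> p * ball_truncation m g p) \<longlonglongrightarrow> (LINT x|lebesgue. f x * \<psi> x)"
      unfolding 1 using tendsto_L2_integral_mult[OF F(2) Lf(1)] by (simp add: mult.commute)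
  qed
qed

lemma L2_norm_diff_power2:
  fixes f g :: "'a::euclidean_space \<Rightarrow> complex"
  assumes "L2 f" "L2 g"
  shows "(L2_norm (\<lambda>x. f x - g x))\<^sup>2
    = (L2_norm f)\<^sup>2 + (L2_norm g)\<^sup>2 - 2 * Re (LINT x|lebesgue. f x * cnj (g x))"
proof -
  have i: "integrable lebesgue (\<lambda>x. f x * cnj (g x))"
    by (rule L2_integrable_mult(1)[OF assms(1) L2_cnj(1)[OF assms(2)]])
  have "(cmod (f x - g x))\<^sup>2 = (cmod (f x))\<^sup>2 + (cmod (g x))\<^sup>2 - 2 * Re (f x * cnj (g x))" for x
    unfolding cmod_power2 by (simp add: power2_eq_square algebra_simps)
  then have "(L2_norm (\<lambda>x. f x - g x))\<^sup>2
      = (LINT x|lebesgue. (cmod (f x))\<^sup>2 + (cmod (g x))\<^sup>2 - 2 * Re (f x * cnj (g x)))"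
    unfolding L2_norm_power2 by simp
  also have "\<dots> = (L2_norm f)\<^sup>2 + (L2_norm g)\<^sup>2 - 2 * (LINT x|lebesgue. Re (f x * cnj (g x)))"
  proof -
    have "integrable lebesgue (\<lambda>x. (cmod (f x))\<^sup>2)" "integrable lebesgue (\<lambda>x. (cmod (g x))\<^sup>2)"
      "integrable lebesgue (\<lambda>x. Re (f x * cnj (g x)))"
      using assms integrable_Re[OF i] by (simp_all only: L2_def)
    then show ?thesis
      unfolding L2_norm_power2
      by (simp only: Bochner_Integration.integral_diff Bochner_Integration.integral_add
          integral_mult_right_zero integrable_mult_right Bochner_Integration.integrable_add)
  qed
  also have "(LINT x|lebesgue. Re (f x * cnj (g x))) = Re (LINT x|lebesgue. f x * cnj (g x))"
    by (rule integral_Re[OF i])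
  finally show ?thesis .
qed

text \<open>The inverse transform of \<open>\<psi>\<close> is the conjugate of the transform of the conjugate of \<open>\<psi>\<close>:
  duality computes the cross term in the expansion of the squared distance.\<close>

lemma has_L2_fourier_surj:
  assumes "L2 (\<psi> :: 'a::euclidean_space \<Rightarrow> complex)"
  obtains f where "has_L2_fourier f \<psi>"
proof -
  obtain \<eta> where \<eta>: "has_L2_fourier (\<lambda>x. cnj (\<psi> x)) \<eta>"
    using has_L2_fourier_exists[OF L2_cnj(1)[OF assms]] .
  have L\<eta>: "L2 \<eta>" "L2_norm \<eta> = L2_norm \<psi>"
    using has_L2_fourier_L2(2)[OF \<eta>] has_L2_fourier_norm[OF \<eta>] L2_cnj(2)[OF assms] by auto
  obtain \<phi> where \<phi>: "has_L2_fourier (\<lambda>x. cnj (\<eta> x)) \<phi>"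
    using has_L2_fourier_exists[OF L2_cnj(1)[OF L\<eta>(1)]] .
  have L\<phi>: "L2 \<phi>" "L2_norm \<phi> = L2_norm \<psi>"
    using has_L2_fourier_L2(2)[OF \<phi>] has_L2_fourier_norm[OF \<phi>] L2_cnj(2)[OF L\<eta>(1)] L\<eta>(2) by auto
  have "(LINT p|lebesgue. \<phi> p * cnj (\<psi> p)) = (LINT x|lebesgue. cnj (\<eta> x) * \<eta> x)"
    by (rule has_L2_fourier_duality[OF \<phi> \<eta>])
  also have "\<dots> = complex_of_real ((L2_norm \<eta>)\<^sup>2)"
    unfolding L2_norm_power2 integral_complex_of_real[symmetric] complex_norm_square
    by (simp add: mult.commute)
  \<comment> \<open>The cross term and both squared norms all equal the squared norm of \<psi>, so
    the expansion of the squared distance cancels.\<close>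
  finally have "(L2_norm (\<lambda>p. \<phi> p - \<psi> p))\<^sup>2 = 0"
    unfolding L2_norm_diff_power2[OF L\<phi>(1) assms] by (simp add: L\<phi>(2) L\<eta>(2))
  then have "AE p in lebesgue. \<phi> p - \<psi> p = 0"
    using L2_norm_eq_0[OF L2_diff[OF L\<phi>(1) assms]] by simp
  then have "has_L2_fourier (\<lambda>x. cnj (\<eta> x)) \<psi>"
    by (intro has_L2_fourier_cong_AE[OF \<phi>]) auto
  then show ?thesis by (rule that)
qed

text \<open>Used in \<open>solution_map_exists\<close> to recognise real functions: their transforms
  are those with Hermitian symmetry.\<close>

lemma has_L2_fourier_cnj:
  assumes "has_L2_fourier f \<phi>"
  shows "has_L2_fourier (\<lambda>x. cnj (f x)) (\<lambda>p. cnj (\<phi> (- p)))"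
proof -
  note L = has_L2_fourier_L2[OF assms]
  have flip: "L2 (\<lambda>p. cnj (\<psi> (- p)))" "L2_norm (\<lambda>p. cnj (\<psi> (- p))) = L2_norm \<psi>"
    if "L2 \<psi>" for \<psi> :: "'a \<Rightarrow> complex"
  proof -
    have "L2 (\<lambda>p. \<psi> (- p))" "L2_norm (\<lambda>p. \<psi> (- p)) = L2_norm \<psi>"
      using L2_lebesgue_affine[OF that, of "-1" 0] by auto
    then show "L2 (\<lambda>p. cnj (\<psi> (- p)))" "L2_norm (\<lambda>p. cnj (\<psi> (- p))) = L2_norm \<psi>"
      using L2_cnj[of "\<lambda>p. \<psi> (- p)"] by simp_all
  qed
  have "ball_truncation n (\<lambda>x. cnj (f x)) = (\<lambda>x. cnj (ball_truncation n f x))" for n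
    by (auto simp: ball_truncation_def)
  then have eq: "fourier (ball_truncation n (\<lambda>x. cnj (f x))) = (\<lambda>p. cnj (fourier (ball_truncation n f) (- p)))" for n
    by (intro ext) (simp add: fourier_cnj)
  have T: "L2 (fourier (ball_truncation n f))" for n
    using assms by (auto simp: has_L2_fourier_iff tendsto_L2_def)
  have "tendsto_L2 (\<lambda>n p. cnj (fourier (ball_truncation n f) (- p))) (\<lambda>p. cnj (\<phi> (- p)))"
  proof (rule tendsto_L2_bound)
    show "L2_norm (\<lambda>p. cnj (fourier (ball_truncation n f) (- p)) - cnj (\<phi> (- p)))
        \<le> L2_norm (\<lambda>p. fourier (ball_truncation n f) p - \<phi> p)" for n
      using flip(2)[OF L2_diff[OF T[of n] L(2)]] by simp
    show "(\<lambda>n. L2_norm (\<lambda>p. fourier (ball_truncation n f) p - \<phi> p)) \<longlonglongrightarrow> 0"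
      using assms by (simp add: has_L2_fourier_iff tendsto_L2_def)
  qed (rule flip(1)[OF T], rule flip(1)[OF L(2)])
  then show ?thesis using L2_cnj(1)[OF L(1)] by (simp add: has_L2_fourier_iff eq)
qed

text \<open>The L1 convolution theorem applies to truncations of \<open>g\<close>. Young's
  inequality controls the limit on the left, boundedness of \<open>fourier G\<close> that on the
  right, and closedness of the graph joins them.\<close>

lemma has_L2_fourier_conv:
  fixes G :: "'a::euclidean_space \<Rightarrow> complex"
  assumes "integrable lebesgue G" "has_L2_fourier g \<psi>"
  shows "has_L2_fourier (conv G g) (\<lambda>p. complex_of_real (fourier_const TYPE('a)) * fourier G p * \<psi> p)"
proof -
  note Lg = has_L2_fourier_L2[OF assms(2)]
  note T = ball_truncation[OF Lg(1)]
  note Y = conv_L2[OF assms(1)]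
  have d: "L2_norm (\<lambda>x. conv G (ball_truncation n g) x - conv G g x)
      \<le> (LINT x|lebesgue. cmod (G x)) * L2_norm (\<lambda>x. ball_truncation n g x - g x)" for n
  proof -
    \<comment> \<open>Convolution is linear only where both integrals exist, hence the detour
      through an a.e. identity.\<close>
    have "AE x in lebesgue. conv G (\<lambda>x. ball_truncation n g x - g x) x = conv G (ball_truncation n g) x - conv G g x"
      using Y(1)[OF T(2)[of n]] Y(1)[OF Lg(1)]
    proof eventually_elim
      case (elim x)
      then show ?case unfolding conv_def right_diff_distrib by (rule Bochner_Integration.integral_diff)
    qed
    note e = L2_cong_AE(2)[OF Y(2)[OF L2_diff[OF T(2)[of n] Lg(1)]] this]
    from Y(3)[OF L2_diff[OF T(2)[of n] Lg(1)]] show ?thesis by (simp only: e)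
  qed
  have "tendsto_L2 (\<lambda>n. conv G (ball_truncation n g)) (conv G g)"
  proof (rule tendsto_L2_bound[OF _ _ d])
    have "(\<lambda>n. L2_norm (\<lambda>x. ball_truncation n g x - g x)) \<longlonglongrightarrow> 0"
      using T(3) by (simp add: tendsto_L2_def)
    then show "(\<lambda>n. (LINT x|lebesgue. cmod (G x)) * L2_norm (\<lambda>x. ball_truncation n g x - g x)) \<longlonglongrightarrow> 0"
      by (rule tendsto_mult_right_zero)
  qed (rule Y(2)[OF T(2)], rule Y(2)[OF Lg(1)])
  moreover have "has_L2_fourier (conv G (ball_truncation n g))
      (\<lambda>p. complex_of_real (fourier_const TYPE('a)) * fourier G p * fourier (ball_truncation n g) p)" for n
    using has_L2_fourier_L1[OF conv_L1(1)[OF assms(1) T(1)] Y(2)[OF T(2)], of n]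
    by (simp add: conv_L1(2)[OF assms(1) T(1), abs_def])
  moreover have "tendsto_L2 (\<lambda>n p. (complex_of_real (fourier_const TYPE('a)) * fourier G p) * fourier (ball_truncation n g) p)
      (\<lambda>p. (complex_of_real (fourier_const TYPE('a)) * fourier G p) * \<psi> p)"
  proof (rule tendsto_L2_multiplier)
    show "tendsto_L2 (\<lambda>n. fourier (ball_truncation n g)) \<psi>" using assms(2) by (simp add: has_L2_fourier_iff)
    show "(\<lambda>p. complex_of_real (fourier_const TYPE('a)) * fourier G p) \<in> borel_measurable lebesgue"
      using borel_measurable_fourier(2)[OF assms(1)] by (intro borel_measurable_times) auto
    show "AE p in lebesgue. cmod (complex_of_real (fourier_const TYPE('a)) * fourier G p)
        \<le> fourier_const TYPE('a) * ((LINT x|lebesgue. cmod (G x)) / fourier_const TYPE('a))"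
    proof (rule AE_I2)
      fix p :: 'a
      have "\<bar>fourier_const TYPE('a)\<bar> * cmod (fourier G p)
          \<le> fourier_const TYPE('a) * ((LINT x|lebesgue. cmod (G x)) / fourier_const TYPE('a))"
        by (rule mult_mono[OF _ fourier_bound[OF assms(1)]]) auto
      then show "cmod (complex_of_real (fourier_const TYPE('a)) * fourier G p)
          \<le> fourier_const TYPE('a) * ((LINT x|lebesgue. cmod (G x)) / fourier_const TYPE('a))"
        by (simp only: norm_mult norm_of_real)
    qed
  qed
  ultimately show ?thesis by (rule has_L2_fourier_limit)
qed

section \<open>The equation as a contraction problem for a Fourier multiplier\<close>

section \<open>The fixed point equation\<close>

text \<open>\<open>L2_norm\<close> is only a seminorm on functions, so the contraction principle is
  run on the iterates of 0 and the fixed point equation comes out modulo null sets.\<close>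

lemma L2_Banach_fixed_point:
  fixes T :: "('a::euclidean_space \<Rightarrow> 'b::euclidean_space) \<Rightarrow> 'a \<Rightarrow> 'b"
  assumes T: "\<And>u. L2 u \<Longrightarrow> L2 (T u)"
    and lip: "\<And>u w. L2 u \<Longrightarrow> L2 w \<Longrightarrow> L2_norm (\<lambda>x. T u x - T w x) \<le> \<theta> * L2_norm (\<lambda>x. u x - w x)"
    and \<theta>: "0 \<le> \<theta>" "\<theta> < 1"
  obtains u where "L2 u" "AE x in lebesgue. T u x = u x"
proof -
  define v where "v n = (T ^^ n) (\<lambda>x. 0)" for n
  have v: "v (Suc n) = T (v n)" for n by (simp add: v_def)
  have L: "L2 (v n)" for n by (induction n) (simp_all add: v_def T)
  define d where "d = L2_norm (\<lambda>x. v 0 x - v 1 x)"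
  have d0: "0 \<le> d" by (simp add: d_def)
  have s: "L2_norm (\<lambda>x. v (Suc m) x - v (Suc n) x) \<le> \<theta> * L2_norm (\<lambda>x. v m x - v n x)" for m n
    unfolding v by (rule lip[OF L L])
  \<comment> \<open>The sum of the geometric series of step lengths; the induction closes because d
    + \<theta> d/(1 - \<theta>) = d/(1 - \<theta>).\<close>
  have b: "L2_norm (\<lambda>x. v 0 x - v j x) \<le> d / (1 - \<theta>)" for j
  proof (induction j)
    case 0
    then show ?case using d0 \<theta> by simp
  next
    case (Suc j)
    have "L2_norm (\<lambda>x. v 0 x - v (Suc j) x) \<le> d + L2_norm (\<lambda>x. v (Suc 0) x - v (Suc j) x)"
      using L2_norm_triangle_diff[OF L[of 0] L[of 1] L[of "Suc j"]] by (simp add: d_def)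
    also have "\<dots> \<le> d + \<theta> * (d / (1 - \<theta>))"
      using order_trans[OF s[of 0 j] mult_left_mono[OF Suc \<theta>(1)]] by simp
    also have "\<dots> = d / (1 - \<theta>)" using \<theta> by (simp add: field_simps)
    finally show ?case .
  qed
  have c: "L2_norm (\<lambda>x. v n x - v (n + j) x) \<le> \<theta> ^ n * (d / (1 - \<theta>))" for n j
  proof (induction n)
    case 0
    then show ?case using b by simp
  next
    case (Suc n)
    show ?case using order_trans[OF s[of n "n + j"] mult_left_mono[OF Suc \<theta>(1)]] by (simp add: mult.assoc)
  qed
  have lim: "(\<lambda>n. \<theta> ^ n * (d / (1 - \<theta>))) \<longlonglongrightarrow> 0"
    using \<theta> by (intro tendsto_mult_left_zero LIMSEQ_realpow_zero)
  obtain u where u: "tendsto_L2 v u"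
  proof (rule L2_complete[OF L])
    fix e :: real assume "e > 0"
    from order_tendstoD(2)[OF lim this] obtain N
      where N: "\<And>n. n \<ge> N \<Longrightarrow> \<theta> ^ n * (d / (1 - \<theta>)) < e" by (auto simp: eventually_sequentially)
    have "L2_norm (\<lambda>x. v m x - v n x) < e" if "m \<ge> N" "n \<ge> N" for m n
    proof (cases "m \<le> n")
      case True
      then show ?thesis using le_less_trans[OF c[of m "n - m"] N[OF that(1)]] by simp
    next
      case False
      then show ?thesis
        using le_less_trans[OF c[of n "m - n"] N[OF that(2)]] L2_norm_minus_commute[of "v m" "v n"] by simp
    qed
    then show "\<exists>N. \<forall>m\<ge>N. \<forall>n\<ge>N. L2_norm (\<lambda>x. v m x - v n x) < e" by blast
  qed
  then have Lu: "L2 u" and vu: "(\<lambda>n. L2_norm (\<lambda>x. v n x - u x)) \<longlonglongrightarrow> 0" by (auto simp: tendsto_L2_def)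
  \<comment> \<open>The shifted iterates tend to \<open>T u\<close> by the Lipschitz bound and to
    \<open>u\<close> as a tail of \<open>v\<close>.\<close>
  have "tendsto_L2 (\<lambda>n. v (Suc n)) (T u)"
  proof (rule tendsto_L2_bound[OF L T[OF Lu]])
    show "L2_norm (\<lambda>x. v (Suc n) x - T u x) \<le> \<theta> * L2_norm (\<lambda>x. v n x - u x)" for n
      unfolding v by (rule lip[OF L Lu])
    show "(\<lambda>n. \<theta> * L2_norm (\<lambda>x. v n x - u x)) \<longlonglongrightarrow> 0" by (rule tendsto_mult_right_zero[OF vu])
  qed
  moreover have "tendsto_L2 (\<lambda>n. v (Suc n)) u"
    using L Lu LIMSEQ_Suc[OF vu] by (simp add: tendsto_L2_def)
  ultimately have "AE x in lebesgue. T u x = u x" by (rule tendsto_L2_unique)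
  with Lu show ?thesis by (rule that)
qed

text \<open>The multiplier by which the transform of F(u) becomes that of u. On the sphere of radius
  \<open>exp a\<close>, division by zero assigns the value 0; this is a null set.\<close>

definition resolvent_symbol :: "real \<Rightarrow> ('a::euclidean_space \<Rightarrow> real) \<Rightarrow> 'a \<Rightarrow> complex" where
  "resolvent_symbol a G p = complex_of_real (fourier_const TYPE('a))
     * fourier (\<lambda>x. complex_of_real (G x)) p / complex_of_real (ln (norm p / exp a))"

lemma borel_measurable_resolvent_symbol:
  fixes G :: "'a::euclidean_space \<Rightarrow> real"
  assumes "integrable lebesgue G"
  shows "resolvent_symbol a G \<in> borel_measurable lebesgue"
proof -
  have "fourier (\<lambda>x. complex_of_real (G x)) \<in> borel_measurable borel"
    using assms by (intro borel_measurable_fourier) auto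
  then have "resolvent_symbol a G \<in> borel_measurable borel"
    unfolding resolvent_symbol_def[abs_def] by measurable
  then show ?thesis by (intro measurable_completion) simp
qed

lemma AE_log_nonzero: "AE p::'a::euclidean_space in lebesgue. p \<noteq> 0 \<and> ln (norm p / exp a) \<noteq> 0"
proof -
  have n: "negligible (insert (0::'a) (sphere 0 (exp a)))"
    using negligible_sphere[of "0::'a" "exp a"] by simp
  then have "insert (0::'a) (sphere 0 (exp a)) \<in> null_sets lebesgue" by (simp add: negligible_iff_null_sets)
  from AE_not_in[OF this] show ?thesis
  proof eventually_elim
    case (elim p)
    then have "norm p \<noteq> exp a" "p \<noteq> 0" "norm p / exp a > 0" by auto
    then show ?case by (simp add: ln_eq_zero_iff)
  qed
qed

text \<open>The form in which the symbol is used: the identity clears the denominator, and the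
  second conjunct permits cancelling ln|p| - a.\<close>

lemma resolvent_symbol_AE:
  fixes G :: "'a::euclidean_space \<Rightarrow> real"
  shows "AE p in lebesgue. complex_of_real (ln (norm p) - a) * resolvent_symbol a G p
      = complex_of_real (fourier_const TYPE('a)) * fourier (\<lambda>x. complex_of_real (G x)) p
    \<and> complex_of_real (ln (norm p) - a) \<noteq> 0"
  using AE_log_nonzero[of a]
proof eventually_elim
  case (elim p)
  then have "ln (norm p / exp a) = ln (norm p) - a" by (simp add: ln_div)
  with elim show ?case unfolding resolvent_symbol_def by (simp del: of_real_diff)
qed

text \<open>Hermitian symmetry: \<open>G\<close> is real and the logarithm depends on |p| only.
  Consequently the multiplier maps transforms of real functions to such transforms.\<close>

lemma resolvent_symbol_cnj: "cnj (resolvent_symbol a G (- p)) = resolvent_symbol a G p"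
  using fourier_cnj[of "\<lambda>x. complex_of_real (G x)" p] by (simp add: resolvent_symbol_def)

locale lipschitz_nonlinearity =
  fixes F :: "real \<Rightarrow> 'a::euclidean_space \<Rightarrow> real" and k l :: real and h :: "'a \<Rightarrow> real"
  assumes F_measurable: "\<And>u. F u \<in> borel_measurable lebesgue"
    and h_L2: "L2 h"
    and F_growth: "\<And>u x. \<bar>F u x\<bar> \<le> k * \<bar>u\<bar> + h x"
    and l_pos: "0 < l"
    and F_lipschitz: "\<And>u1 u2 x. \<bar>F u1 x - F u2 x\<bar> \<le> l * \<bar>u1 - u2\<bar>"
begin

text \<open>Rounding \<open>u\<close> down to multiples of 1/(n+1) leaves countably many values; on
  each level set the composition is a section of \<open>F\<close>, hence measurable. The Lipschitz
  bound makes these compositions converge.\<close>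

lemma superposition_measurable:
  assumes "u \<in> borel_measurable lebesgue"
  shows "(\<lambda>x. F (u x) x) \<in> borel_measurable lebesgue"
proof (rule borel_measurable_LIMSEQ_real)
  define s where "s n x = real_of_int \<lfloor>real (Suc n) * u x\<rfloor> / real (Suc n)" for n x
  show "(\<lambda>x. F (s n x) x) \<in> borel_measurable lebesgue" for n
    unfolding s_def
  proof (rule measurable_compose_countable[where f="\<lambda>i x. F (real_of_int i / real (Suc n)) x"])
    show "(\<lambda>x. \<lfloor>real (Suc n) * u x\<rfloor>) \<in> lebesgue \<rightarrow>\<^sub>M count_space UNIV"
      using assms by measurable
  qed (rule F_measurable)
  fix x
  have b: "\<bar>s n x - u x\<bar> \<le> 1 / real (Suc n)" for n
  proof -
    have "s n x - u x = (real_of_int \<lfloor>real (Suc n) * u x\<rfloor> - real (Suc n) * u x) / real (Suc n)"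
      by (simp add: s_def field_simps)
    moreover have "\<bar>real_of_int \<lfloor>real (Suc n) * u x\<rfloor> - real (Suc n) * u x\<bar> \<le> 1" by linarith
    ultimately show ?thesis
      using divide_right_mono[of "\<bar>real_of_int \<lfloor>real (Suc n) * u x\<rfloor> - real (Suc n) * u x\<bar>" 1 "real (Suc n)"]
      by (simp only: abs_divide abs_of_nat)
  qed
  show "(\<lambda>n. F (s n x) x) \<longlonglongrightarrow> F (u x) x"
  proof (rule LIM_zero_cancel, rule Lim_null_comparison)
    show "\<forall>\<^sub>F n in sequentially. norm (F (s n x) x - F (u x) x) \<le> l * (1 / real (Suc n))"
    proof (intro always_eventually allI)
      fix n
      show "norm (F (s n x) x - F (u x) x) \<le> l * (1 / real (Suc n))"
        using order_trans[OF F_lipschitz mult_left_mono[OF b[of n]]] l_pos by simp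
    qed
    show "(\<lambda>n. l * (1 / real (Suc n))) \<longlonglongrightarrow> 0"
      using LIMSEQ_inverse_real_of_nat by (intro tendsto_mult_right_zero) (simp add: inverse_eq_divide)
  qed
qed

lemma superposition_L2:
  assumes "L2 u"
  shows "L2 (\<lambda>x. F (u x) x)"
proof -
  have ku: "L2 (\<lambda>x. k * \<bar>u x\<bar>)"
    using assms by (auto simp: L2_def power_mult_distrib)
  show ?thesis
  proof (rule L2_bound(1)[OF L2_add[OF ku h_L2] superposition_measurable[OF L2_measurable[OF assms]]])
    show "AE x in lebesgue. norm (F (u x) x) \<le> norm (k * \<bar>u x\<bar> + h x)"
      using order_trans[OF F_growth abs_ge_self] by simp
  qed
qed

lemma superposition_lipschitz:
  assumes "L2 u" "L2 w"
  shows "L2_norm (\<lambda>x. F (u x) x - F (w x) x) \<le> l * L2_norm (\<lambda>x. u x - w x)"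
proof -
  have L: "L2 (\<lambda>x. l * (u x - w x))"
    using L2_diff[OF assms] by (auto simp: L2_def power_mult_distrib)
  have "L2_norm (\<lambda>x. F (u x) x - F (w x) x) \<le> L2_norm (\<lambda>x. l * (u x - w x))"
    using L2_diff[OF superposition_L2[OF assms(1)] superposition_L2[OF assms(2)]] F_lipschitz l_pos
    by (intro L2_bound(2)[OF L]) (auto simp: abs_mult L2_def)
  also have "\<dots> = l * L2_norm (\<lambda>x. u x - w x)"
    using l_pos by (simp add: L2_norm_def power_mult_distrib real_sqrt_mult)
  finally show ?thesis .
qed

text \<open>On the Fourier side the equation is (ln|p| - a) u^ = (2 pi)^(d/2) G^ \<phi>, and the
  first factor is a.e. nonzero. Letting \<phi> be any representative of the transform of F(u) allows
  the caller to choose it.\<close>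

lemma is_solution_iff:
  assumes G: "integrable lebesgue G" and u: "L2 u"
    and \<phi>: "has_L2_fourier (\<lambda>x. complex_of_real (F (u x) x)) \<phi>"
  shows "is_solution a G F u \<longleftrightarrow>
    has_L2_fourier (\<lambda>x. complex_of_real (u x)) (\<lambda>p. resolvent_symbol a G p * \<phi> p)"
proof -
  let ?u = "\<lambda>x. complex_of_real (u x)" and ?f = "\<lambda>x. complex_of_real (F (u x) x)"
  let ?G = "\<lambda>x. complex_of_real (G x)" and ?C = "complex_of_real (fourier_const TYPE('a))"
  have cG: "integrable lebesgue ?G" using G by auto
  note K = has_L2_fourier_conv[OF cG \<phi>]
  have conv: "complex_of_real (LINT y|lebesgue. G (x - y) * F (u y) y) = conv ?G ?f x" for x
    unfolding conv_def by (simp flip: integral_complex_of_real)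
  have int: "AE x in lebesgue. integrable lebesgue (\<lambda>y. G (x - y) * F (u y) y)"
    using conv_L2(1)[OF cG has_L2_fourier_L2(1)[OF \<phi>]]
    by (simp flip: of_real_mult add: complex_of_real_integrable_eq)
  \<comment> \<open>The only candidate for ln(-\<Delta>) u, obtained by solving the equation for
    that term.\<close>
  define v where "v x = 2 * (complex_of_real a * ?u x + conv ?G ?f x)" for x
  have v: "has_L2_fourier v (\<lambda>p. 2 * (complex_of_real a * \<phi>u p + ?C * fourier ?G p * \<phi> p))"
    if "has_L2_fourier ?u \<phi>u" for \<phi>u
    unfolding v_def
    by (rule has_L2_fourier_cmult[OF has_L2_fourier_add[OF has_L2_fourier_cmult[OF that] K]])
  show ?thesis
  proof
    assume "is_solution a G F u"
    then obtain w \<phi>u where w: "has_L2_fourier ?u \<phi>u"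
        "has_L2_fourier w (\<lambda>p. complex_of_real (2 * ln (norm p)) * \<phi>u p)"
      and eq: "AE x in lebesgue. - (1 / 2) * w x + complex_of_real (a * u x) + conv ?G ?f x = 0"
      unfolding is_solution_def has_ln_laplacian_def conv by auto
    have "AE x in lebesgue. v x = w x"
      using eq by eventually_elim (simp add: v_def algebra_simps)
    then have "has_L2_fourier w (\<lambda>p. 2 * (complex_of_real a * \<phi>u p + ?C * fourier ?G p * \<phi> p))"
      by (intro has_L2_fourier_cong_AE[OF v[OF w(1)]]) auto
    from has_L2_fourier_unique[OF this w(2)] resolvent_symbol_AE[of a G]
    have "AE p in lebesgue. \<phi>u p = resolvent_symbol a G p * \<phi> p"
    proof eventually_elim
      case (elim p)
      have "2 * (complex_of_real (ln (norm p)) * \<phi>u p) = 2 * (complex_of_real a * \<phi>u p + ?C * fourier ?G p * \<phi> p)"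
        using elim(1) by (simp only: of_real_mult of_real_numeral mult.assoc)
      then have "complex_of_real (ln (norm p)) * \<phi>u p = complex_of_real a * \<phi>u p + ?C * fourier ?G p * \<phi> p"
        by (simp only: mult_cancel_left) simp
      then have "complex_of_real (ln (norm p) - a) * \<phi>u p = (?C * fourier ?G p) * \<phi> p"
        by (simp only: of_real_diff left_diff_distrib) simp
      also have "\<dots> = complex_of_real (ln (norm p) - a) * (resolvent_symbol a G p * \<phi> p)"
        unfolding conjunct1[OF elim(2), symmetric] by (rule mult.assoc)
      finally have "complex_of_real (ln (norm p) - a) * \<phi>u p
          = complex_of_real (ln (norm p) - a) * (resolvent_symbol a G p * \<phi> p)" .
      with elim show ?case by (simp only: mult_cancel_left) blast
    qed
    then show "has_L2_fourier ?u (\<lambda>p. resolvent_symbol a G p * \<phi> p)"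
      by (intro has_L2_fourier_cong_AE[OF w(1)]) auto
  next
    assume *: "has_L2_fourier ?u (\<lambda>p. resolvent_symbol a G p * \<phi> p)"
    \<comment> \<open>This is where membership in the domain comes from: the transform of the L2
      function \<open>v\<close> turns out to be 2 ln|p| times the transform of
      \<open>u\<close>.\<close>
    have "AE p in lebesgue. 2 * (complex_of_real a * (resolvent_symbol a G p * \<phi> p) + ?C * fourier ?G p * \<phi> p)
        = complex_of_real (2 * ln (norm p)) * (resolvent_symbol a G p * \<phi> p)"
      using resolvent_symbol_AE[of a G]
    proof eventually_elim
      case (elim p)
      show ?case unfolding conjunct1[OF elim, symmetric] by (simp add: algebra_simps)
    qed
    then have "has_L2_fourier v (\<lambda>p. complex_of_real (2 * ln (norm p)) * (resolvent_symbol a G p * \<phi> p))"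
      by (rule has_L2_fourier_cong_AE[OF v[OF *] AE_I2[OF refl]])
    with * have "has_ln_laplacian ?u v" unfolding has_ln_laplacian_def by blast
    moreover have "AE x in lebesgue. integrable lebesgue (\<lambda>y. G (x - y) * F (u y) y) \<and>
       - (1 / 2) * v x + complex_of_real (a * u x) + conv ?G ?f x = 0"
      using int by eventually_elim (simp add: v_def field_simps)
    ultimately show "is_solution a G F u"
      unfolding is_solution_def conv using u by blast
  qed
qed

text \<open>Surjectivity of the transform yields a complex function \<open>w\<close>. Its transform
  has Hermitian symmetry, so \<open>w\<close> is a.e. real and may be replaced by its real
  part.\<close>

lemma solution_map_exists:
  assumes G: "integrable lebesgue G" and B: "AE p in lebesgue. cmod (resolvent_symbol a G p) \<le> B"
    and u: "L2 u"
  obtains w \<phi> where "L2 w" "has_L2_fourier (\<lambda>x. complex_of_real (F (u x) x)) \<phi>"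
    "has_L2_fourier (\<lambda>x. complex_of_real (w x)) (\<lambda>p. resolvent_symbol a G p * \<phi> p)"
proof -
  let ?f = "\<lambda>x. complex_of_real (F (u x) x)"
  have "L2 ?f" using superposition_L2[OF u] by simp
  then obtain \<phi> where \<phi>: "has_L2_fourier ?f \<phi>" by (rule has_L2_fourier_exists)
  have "L2 (\<lambda>p. resolvent_symbol a G p * \<phi> p)"
    by (rule L2_multiplier(1)[OF has_L2_fourier_L2(2)[OF \<phi>] borel_measurable_resolvent_symbol[OF G] B])
  then obtain w where w: "has_L2_fourier w (\<lambda>p. resolvent_symbol a G p * \<phi> p)" by (rule has_L2_fourier_surj)
  \<comment> \<open>Both sides are transforms of the same function, as F(u) equals its
    conjugate.\<close>
  have "AE p in lebesgue. cnj (\<phi> (- p)) = \<phi> p"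
    using has_L2_fourier_unique[OF has_L2_fourier_cnj[OF \<phi>]] \<phi> by simp
  then have "AE p in lebesgue. cnj (resolvent_symbol a G (- p) * \<phi> (- p)) = resolvent_symbol a G p * \<phi> p"
    by eventually_elim (simp add: resolvent_symbol_cnj)
  from has_L2_fourier_inj[OF has_L2_fourier_cnj[OF w] w this]
  have "AE x in lebesgue. w x = complex_of_real (Re (w x))"
    by eventually_elim (simp add: complex_eq_iff)
  then have r: "has_L2_fourier (\<lambda>x. complex_of_real (Re (w x))) (\<lambda>p. resolvent_symbol a G p * \<phi> p)"
    by (intro has_L2_fourier_cong_AE[OF w]) auto
  show ?thesis by (rule that[OF _ \<phi> r]) (use has_L2_fourier_L2(1)[OF r] in simp)
qed

text \<open>Stated for transforms instead of for a solution map, so that one estimate serves the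
  fixed point, uniqueness, and the comparison of u_m with u.\<close>

lemma solution_map_contraction:
  assumes G: "integrable lebesgue G" and B: "AE p in lebesgue. cmod (resolvent_symbol a G p) \<le> B" "0 \<le> B"
    and u: "L2 u" "has_L2_fourier (\<lambda>x. complex_of_real (F (u x) x)) \<phi>"
    and w: "L2 w" "has_L2_fourier (\<lambda>x. complex_of_real (F (w x) x)) \<psi>"
  shows "L2_norm (\<lambda>p. resolvent_symbol a G p * \<phi> p - resolvent_symbol a G p * \<psi> p)
    \<le> B * l * L2_norm (\<lambda>x. u x - w x)"
proof -
  note L = L2_diff[OF has_L2_fourier_L2(2)[OF u(2)] has_L2_fourier_L2(2)[OF w(2)]]
  have "L2_norm (\<lambda>p. resolvent_symbol a G p * \<phi> p - resolvent_symbol a G p * \<psi> p)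
      \<le> B * L2_norm (\<lambda>p. \<phi> p - \<psi> p)"
    using L2_multiplier(2)[OF L borel_measurable_resolvent_symbol[OF G] B(1)] by (simp add: right_diff_distrib)
  also have "L2_norm (\<lambda>p. \<phi> p - \<psi> p) = L2_norm (\<lambda>x. F (u x) x - F (w x) x)"
    unfolding has_L2_fourier_norm_diff[OF u(2) w(2)] of_real_diff[symmetric] L2_of_real ..
  also have "B * \<dots> \<le> B * (l * L2_norm (\<lambda>x. u x - w x))"
    by (intro mult_left_mono superposition_lipschitz u w B)
  finally show ?thesis by (simp add: mult.assoc)
qed

lemma unique_solution_exists:
  assumes G: "integrable lebesgue G" and B: "AE p in lebesgue. cmod (resolvent_symbol a G p) \<le> B" "0 \<le> B"
    and Bl: "B * l < 1"
  obtains u where "is_unique_solution a G F u"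
proof -
  let ?P = "\<lambda>u w. L2 w \<and> (\<exists>\<phi>. has_L2_fourier (\<lambda>x. complex_of_real (F (u x) x)) \<phi> \<and>
    has_L2_fourier (\<lambda>x. complex_of_real (w x)) (\<lambda>p. resolvent_symbol a G p * \<phi> p))"
  have "\<exists>w. ?P u w" if "L2 u" for u
    by (rule solution_map_exists[OF G B(1) that]) blast
  \<comment> \<open>The image is determined only up to a null set; \<open>T\<close> chooses one
    representative for each \<open>u\<close>.\<close>
  then obtain T where T: "\<And>u. L2 u \<Longrightarrow> ?P u (T u)" by metis
  have lip: "L2_norm (\<lambda>x. T u x - T w x) \<le> B * l * L2_norm (\<lambda>x. u x - w x)" if uw: "L2 u" "L2 w" for u w
  proof -
    obtain \<phi> where \<phi>: "has_L2_fourier (\<lambda>x. complex_of_real (F (u x) x)) \<phi>"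
      "has_L2_fourier (\<lambda>x. complex_of_real (T u x)) (\<lambda>p. resolvent_symbol a G p * \<phi> p)" using T[OF uw(1)] by blast
    obtain \<psi> where \<psi>: "has_L2_fourier (\<lambda>x. complex_of_real (F (w x) x)) \<psi>"
      "has_L2_fourier (\<lambda>x. complex_of_real (T w x)) (\<lambda>p. resolvent_symbol a G p * \<psi> p)" using T[OF uw(2)] by blast
    have "L2_norm (\<lambda>x. T u x - T w x)
        = L2_norm (\<lambda>p. resolvent_symbol a G p * \<phi> p - resolvent_symbol a G p * \<psi> p)"
      unfolding has_L2_fourier_norm_diff[OF \<phi>(2) \<psi>(2)] of_real_diff[symmetric] L2_of_real ..
    also note solution_map_contraction[OF G B uw(1) \<phi>(1) uw(2) \<psi>(1)]
    finally show ?thesis .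
  qed
  obtain u where u: "L2 u" "AE x in lebesgue. T u x = u x"
    by (rule L2_Banach_fixed_point[of T "B * l"]) (use T lip B(2) l_pos Bl in auto)
  obtain \<phi> where \<phi>: "has_L2_fourier (\<lambda>x. complex_of_real (F (u x) x)) \<phi>"
    "has_L2_fourier (\<lambda>x. complex_of_real (T u x)) (\<lambda>p. resolvent_symbol a G p * \<phi> p)" using T[OF u(1)] by blast
  have fu: "has_L2_fourier (\<lambda>x. complex_of_real (u x)) (\<lambda>p. resolvent_symbol a G p * \<phi> p)"
    by (rule has_L2_fourier_cong_AE[OF \<phi>(2)]) (use u(2) in eventually_elim, simp_all)
  then have su: "is_solution a G F u" by (simp add: is_solution_iff[OF G u(1) \<phi>(1)])
  have "AE x in lebesgue. w x = u x" if sw: "is_solution a G F w" for w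
  proof -
    have Lw: "L2 w" using sw by (simp add: is_solution_def)
    have "L2 (\<lambda>x. complex_of_real (F (w x) x))" using superposition_L2[OF Lw] by simp
    then obtain \<psi> where \<psi>: "has_L2_fourier (\<lambda>x. complex_of_real (F (w x) x)) \<psi>" by (rule has_L2_fourier_exists)
    have fw: "has_L2_fourier (\<lambda>x. complex_of_real (w x)) (\<lambda>p. resolvent_symbol a G p * \<psi> p)"
      using sw by (simp add: is_solution_iff[OF G Lw \<psi>])
    have "L2_norm (\<lambda>x. w x - u x)
        = L2_norm (\<lambda>p. resolvent_symbol a G p * \<psi> p - resolvent_symbol a G p * \<phi> p)"
      unfolding has_L2_fourier_norm_diff[OF fw fu] of_real_diff[symmetric] L2_of_real ..
    also have "\<dots> \<le> B * l * L2_norm (\<lambda>x. w x - u x)"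
      by (rule solution_map_contraction[OF G B Lw \<psi> u(1) \<phi>(1)])
    \<comment> \<open>The difference of two solutions is bounded by B l < 1 times itself, which
      forces its norm to vanish.\<close>
    finally have "(1 - B * l) * L2_norm (\<lambda>x. w x - u x) \<le> 0" by (simp add: algebra_simps)
    then have "L2_norm (\<lambda>x. w x - u x) \<le> 0" using Bl by (simp add: mult_le_0_iff)
    then have "L2_norm (\<lambda>x. w x - u x) = 0" using L2_norm_nonneg[of "\<lambda>x. w x - u x"] by linarith
    from L2_norm_eq_0[OF L2_diff[OF Lw u(1)] this] show ?thesis by simp
  qed
  with su have "is_unique_solution a G F u" by (simp add: is_unique_solution_def)
  then show ?thesis by (rule that)
qed

lemma solution_nontrivial:
  fixes G :: "'a \<Rightarrow> real"
  assumes G: "integrable lebesgue G" and s: "is_solution a G F u" and o: "supports_overlap (F 0) G"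
  shows "\<not> (AE x in lebesgue. u x = 0)"
proof
  assume z: "AE x in lebesgue. u x = 0"
  let ?G = "fourier (\<lambda>x. complex_of_real (G x))"
  obtain \<phi> where \<phi>: "has_L2_fourier (\<lambda>x. complex_of_real (F 0 x)) \<phi>"
    and e: "emeasure lebesgue (support_on UNIV \<phi> \<inter> support_on UNIV ?G) \<noteq> 0"
    using o unfolding supports_overlap_def by blast
  have Lu: "L2 u" using s by (simp add: is_solution_def)
  have \<phi>u: "has_L2_fourier (\<lambda>x. complex_of_real (F (u x) x)) \<phi>"
    by (rule has_L2_fourier_cong_AE[OF \<phi>]) (use z in eventually_elim, simp_all)
  have fu: "has_L2_fourier (\<lambda>x. complex_of_real (u x)) (\<lambda>p. resolvent_symbol a G p * \<phi> p)"
    using s by (simp add: is_solution_iff[OF G Lu \<phi>u])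
  have "L2_norm (\<lambda>p. resolvent_symbol a G p * \<phi> p) = L2_norm u"
    using has_L2_fourier_norm[OF fu] by simp
  also have "\<dots> = L2_norm (\<lambda>x::'a. 0::real)"
    by (rule L2_cong_AE(2)[OF L2_zero(1)]) (use z in eventually_elim, simp)
  finally have "L2_norm (\<lambda>p. resolvent_symbol a G p * \<phi> p) = 0" by simp
  \<comment> \<open>Where the logarithm is nonzero, the symbol vanishes exactly where the transform
    of \<open>G\<close> does, so dividing by it does not enlarge the overlap's complement.\<close>
  from L2_norm_eq_0[OF has_L2_fourier_L2(2)[OF fu] this] AE_log_nonzero[of a]
  have ae: "AE p in lebesgue. p \<notin> support_on UNIV \<phi> \<inter> support_on UNIV ?G"
    by eventually_elim (auto simp: resolvent_symbol_def support_on_def)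
  have [measurable]: "\<phi> \<in> borel_measurable lebesgue" "?G \<in> borel_measurable lebesgue"
    using L2_measurable[OF has_L2_fourier_L2(2)[OF \<phi>]] borel_measurable_fourier(2)[of "\<lambda>x. complex_of_real (G x)"] G
    by auto
  \<comment> \<open>Measurability of the overlap turns the a.e. statement into membership in the
    null sets.\<close>
  have "{p \<in> space lebesgue. \<phi> p \<noteq> 0 \<and> ?G p \<noteq> 0} \<in> sets lebesgue" by measurable
  also have "{p \<in> space lebesgue. \<phi> p \<noteq> 0 \<and> ?G p \<noteq> 0} = support_on UNIV \<phi> \<inter> support_on UNIV ?G"
    by (auto simp: support_on_def)
  finally have "support_on UNIV \<phi> \<inter> support_on UNIV ?G \<in> null_sets lebesgue"
    using ae by (simp add: AE_iff_null_sets)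
  with e show False by auto
qed

end

section \<open>Stability under convergence of the kernels\<close>

lemma resolvent_symbol_bound:
  fixes G :: "'a::euclidean_space \<Rightarrow> real"
  assumes "ereal ((2 * pi) powr (real DIM('a) / 2))
           * Linf_norm (\<lambda>p. fourier (\<lambda>x. complex_of_real (G x)) p
                              / complex_of_real (ln (norm p / exp a)))
           * ereal l \<le> ereal c" "0 < l"
  shows "AE p in lebesgue. cmod (resolvent_symbol a G p) \<le> c / l"
proof -
  define g where "g p = fourier (\<lambda>x. complex_of_real (G x)) p / complex_of_real (ln (norm p / exp a))" for p
  \<comment> \<open>The computation stays in \<open>ereal\<close> until only the pointwise modulus
    is left, so finiteness of the norm need not be settled first.\<close>
  have "AE p in lebesgue. ereal (cmod (g p)) \<le> Linf_norm g"
    unfolding Linf_norm_def by (rule esssup_AE)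
  then show ?thesis
  proof eventually_elim
    case (elim p)
    have "ereal (fourier_const TYPE('a)) * ereal (cmod (g p)) * ereal l
        \<le> ereal (fourier_const TYPE('a)) * Linf_norm g * ereal l"
      using elim assms(2) by (intro ereal_mult_right_mono ereal_mult_left_mono) auto
    also have "\<dots> \<le> ereal c" using assms(1) by (simp add: g_def[abs_def])
    finally have "fourier_const TYPE('a) * cmod (g p) * l \<le> c" by simp
    moreover have "cmod (resolvent_symbol a G p) = fourier_const TYPE('a) * cmod (g p)"
      by (simp add: resolvent_symbol_def g_def norm_mult norm_divide)
    ultimately show ?case using assms(2) by (simp add: field_simps)
  qed
qed

lemma resolvent_symbol_tendsto:
  fixes Gm :: "nat \<Rightarrow> 'a::euclidean_space \<Rightarrow> real"
  assumes "tendsto_L1 Gm G"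
  shows "(\<lambda>m. resolvent_symbol a (Gm m) p) \<longlonglongrightarrow> resolvent_symbol a G p"
proof -
  let ?c = "\<lambda>(g :: 'a \<Rightarrow> real) x. complex_of_real (g x)"
  have i: "integrable lebesgue (?c (Gm m))" "integrable lebesgue (?c G)" for m
    using assms by (auto simp: tendsto_L1_def)
  have "(\<lambda>m. fourier (?c (Gm m)) p) \<longlonglongrightarrow> fourier (?c G) p"
  proof (rule LIM_zero_cancel, rule Lim_null_comparison)
    show "\<forall>\<^sub>F m in sequentially. norm (fourier (?c (Gm m)) p - fourier (?c G) p)
        \<le> (LINT x|lebesgue. \<bar>Gm m x - G x\<bar>) / fourier_const TYPE('a)"
    proof (intro always_eventually allI)
      fix m
      have "integrable lebesgue (\<lambda>x. complex_of_real (Gm m x - G x))"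
        using Bochner_Integration.integrable_diff[OF i(1)[of m] i(2)] by simp
      moreover have "fourier (?c (Gm m)) p - fourier (?c G) p = fourier (\<lambda>x. complex_of_real (Gm m x - G x)) p"
        using fourier_diff[OF i(1)[of m] i(2), of p] by simp
      ultimately
      show "norm (fourier (?c (Gm m)) p - fourier (?c G) p)
        \<le> (LINT x|lebesgue. \<bar>Gm m x - G x\<bar>) / fourier_const TYPE('a)"
        using fourier_bound[of "\<lambda>x. complex_of_real (Gm m x - G x)" p] by (simp only: norm_of_real)
    qed
    show "(\<lambda>m. (LINT x|lebesgue. \<bar>Gm m x - G x\<bar>) / fourier_const TYPE('a)) \<longlonglongrightarrow> 0"
      using assms by (intro tendsto_divide_zero) (simp add: tendsto_L1_def)
  qed
  \<comment> \<open>The denominator does not depend on m; as a fixed factor \<open>inverse\<close>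
    it causes no difficulty even where it is 0, so convergence holds at every p.\<close>
  then show ?thesis unfolding resolvent_symbol_def divide_inverse by (intro tendsto_intros)
qed

theorem theorem2:
  fixes a k l \<epsilon> :: real
    and Gm :: "nat \<Rightarrow> 'a::euclidean_space \<Rightarrow> real"
    and G h :: "'a \<Rightarrow> real"
    and F :: "real \<Rightarrow> 'a \<Rightarrow> real"
  assumes "\<And>m. integrable lebesgue (Gm m)"
    and "\<And>m. integrable lebesgue (\<lambda>x. norm x * Gm m x)"
    and "tendsto_L1 Gm G"
    and "tendsto_L1 (\<lambda>m x. norm x * Gm m x) (\<lambda>x. norm x * G x)"
    and "caratheodory F"
    and "k > 0" and "L2 h" and "\<And>x. h x \<ge> 0"
    and "\<And>u x. \<bar>F u x\<bar> \<le> k * \<bar>u\<bar> + h x"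
    and "l > 0"
    and "\<And>u1 u2 x. \<bar>F u1 x - F u2 x\<bar> \<le> l * \<bar>u1 - u2\<bar>"
    and "\<And>m p. p \<in> sphere 0 (exp a) \<Longrightarrow>
           L2_inner (\<lambda>x. complex_of_real (Gm m x))
             (\<lambda>x. exp (\<i> * complex_of_real (p \<bullet> x))
                    / complex_of_real ((2 * pi) powr (real DIM('a) / 2))) = 0"
    and "0 < \<epsilon>" and "\<epsilon> < 1"
    and "\<And>m. ereal ((2 * pi) powr (real DIM('a) / 2))
           * Linf_norm (\<lambda>p. fourier (\<lambda>x. complex_of_real (Gm m x)) p
                              / complex_of_real (ln (norm p / exp a)))
           * ereal l \<le> ereal (1 - \<epsilon>)"
  shows "\<exists>um u. (\<forall>m. is_unique_solution a (Gm m) F (um m))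
           \<and> is_unique_solution a G F u
           \<and> tendsto_L2 um u
           \<and> (\<forall>m. supports_overlap (F 0) (Gm m) \<longrightarrow> \<not> (AE x in lebesgue. um m x = 0))
           \<and> (supports_overlap (F 0) G \<longrightarrow> \<not> (AE x in lebesgue. u x = 0))"
proof -
  interpret lipschitz_nonlinearity F k l h
    by unfold_locales (use assms(5,7,9,10,11) in \<open>auto simp: caratheodory_def\<close>)
  note Gm = assms(1)
  have G: "integrable lebesgue G" using assms(3) by (simp add: tendsto_L1_def)
  \<comment> \<open>Chosen so that B l = 1 - \<epsilon>, a contraction constant independent of
    m.\<close>
  define B where "B = (1 - \<epsilon>) / l"
  have B: "0 \<le> B" "B * l < 1" using assms(10,13,14) by (auto simp: B_def)
  have bm: "AE p in lebesgue. cmod (resolvent_symbol a (Gm m) p) \<le> B" for m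
    unfolding B_def by (rule resolvent_symbol_bound[OF assms(15) assms(10)])
  then have "AE p in lebesgue. \<forall>m. cmod (resolvent_symbol a (Gm m) p) \<le> B"
    by (simp add: AE_all_countable)
  \<comment> \<open>A bound valid for all m simultaneously passes to the pointwise limit, so the
    limiting equation satisfies the same hypothesis.\<close>
  then have b: "AE p in lebesgue. cmod (resolvent_symbol a G p) \<le> B"
  proof eventually_elim
    case (elim p)
    show ?case
      by (rule LIMSEQ_le_const2[OF tendsto_norm[OF resolvent_symbol_tendsto[OF assms(3)]]]) (use elim in auto)
  qed
  have "\<exists>w. is_unique_solution a (Gm m) F w" for m
    by (rule unique_solution_exists[OF Gm bm B]) blast
  then obtain um where um: "\<And>m. is_unique_solution a (Gm m) F (um m)" by metis
  obtain u where u: "is_unique_solution a G F u"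
    by (rule unique_solution_exists[OF G b B])
  have sm: "is_solution a (Gm m) F (um m)" for m using um by (simp add: is_unique_solution_def)
  have s: "is_solution a G F u" using u by (simp add: is_unique_solution_def)
  have Lm: "L2 (um m)" for m using sm by (simp add: is_solution_def)
  have L: "L2 u" using s by (simp add: is_solution_def)
  have "\<exists>\<psi>. has_L2_fourier (\<lambda>x. complex_of_real (F (w x) x)) \<psi>" if "L2 w" for w
    using has_L2_fourier_exists[of "\<lambda>x. complex_of_real (F (w x) x)"] superposition_L2[OF that] by auto
  then obtain \<psi> where \<psi>: "\<And>w. L2 w \<Longrightarrow> has_L2_fourier (\<lambda>x. complex_of_real (F (w x) x)) (\<psi> w)"
    by metis
  have fm: "has_L2_fourier (\<lambda>x. complex_of_real (um m x)) (\<lambda>p. resolvent_symbol a (Gm m) p * \<psi> (um m) p)" for m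
    using sm is_solution_iff[OF Gm Lm \<psi>[OF Lm]] by simp
  have fu: "has_L2_fourier (\<lambda>x. complex_of_real (u x)) (\<lambda>p. resolvent_symbol a G p * \<psi> u p)"
    using s is_solution_iff[OF G L \<psi>[OF L]] by simp
  note L\<psi> = has_L2_fourier_L2(2)[OF \<psi>]
  have "tendsto_L2 (\<lambda>m p. resolvent_symbol a (Gm m) p * \<psi> u p) (\<lambda>p. resolvent_symbol a G p * \<psi> u p)"
  proof (rule tendsto_L2_dominated[OF _ _ L2_cmult(1)[OF L\<psi>[OF L], of "complex_of_real B"]])
    show "(\<lambda>p. resolvent_symbol a (Gm m) p * \<psi> u p) \<in> borel_measurable lebesgue"
      "(\<lambda>p. resolvent_symbol a G p * \<psi> u p) \<in> borel_measurable lebesgue" for m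
      using L2_measurable[OF L\<psi>[OF L]] borel_measurable_resolvent_symbol[OF Gm[of m], of a]
        borel_measurable_resolvent_symbol[OF G, of a] by (auto intro: borel_measurable_times)
    show "AE p in lebesgue. norm (resolvent_symbol a (Gm m) p * \<psi> u p) \<le> norm (complex_of_real B * \<psi> u p)" for m
      using bm[of m] by eventually_elim (use B(1) in \<open>simp add: norm_mult mult_right_mono\<close>)
    show "AE p in lebesgue. (\<lambda>m. resolvent_symbol a (Gm m) p * \<psi> u p) \<longlonglongrightarrow> resolvent_symbol a G p * \<psi> u p"
      by (intro AE_I2 tendsto_mult resolvent_symbol_tendsto assms(3) tendsto_const)
  qed
  then have LM: "L2 (\<lambda>p. resolvent_symbol a (Gm m) p * \<psi> u p)"
    and r: "(\<lambda>m. L2_norm (\<lambda>p. resolvent_symbol a (Gm m) p * \<psi> u p - resolvent_symbol a G p * \<psi> u p)) \<longlonglongrightarrow> 0"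
    (is "?r \<longlonglongrightarrow> 0") for m
    by (auto simp: tendsto_L2_def)
  have "tendsto_L2 um u"
  proof (rule tendsto_L2_bound[OF Lm L])
    \<comment> \<open>The intermediate term is the m-th symbol applied to the transform of F(u). The
      contraction part, B l times the left side, is moved to the left, which produces the divisor 1
      - B l.\<close>
    show "L2_norm (\<lambda>x. um m x - u x) \<le> ?r m / (1 - B * l)" for m
    proof -
      have "L2_norm (\<lambda>x. um m x - u x)
          = L2_norm (\<lambda>p. resolvent_symbol a (Gm m) p * \<psi> (um m) p - resolvent_symbol a G p * \<psi> u p)"
        unfolding has_L2_fourier_norm_diff[OF fm fu] of_real_diff[symmetric] L2_of_real ..
      also have "\<dots> \<le> L2_norm (\<lambda>p. resolvent_symbol a (Gm m) p * \<psi> (um m) p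
          - resolvent_symbol a (Gm m) p * \<psi> u p) + ?r m"
        by (rule L2_norm_triangle_diff[OF has_L2_fourier_L2(2)[OF fm] LM has_L2_fourier_L2(2)[OF fu]])
      also have "\<dots> \<le> B * l * L2_norm (\<lambda>x. um m x - u x) + ?r m"
        using solution_map_contraction[OF Gm bm B(1) Lm \<psi>[OF Lm] L \<psi>[OF L], of m] by simp
      finally show ?thesis using B(2) by (simp add: field_simps)
    qed
    show "(\<lambda>m. ?r m / (1 - B * l)) \<longlonglongrightarrow> 0" by (rule tendsto_divide_zero[OF r])
  qed
  moreover have "\<forall>m. supports_overlap (F 0) (Gm m) \<longrightarrow> \<not> (AE x in lebesgue. um m x = 0)"
    using solution_nontrivial[OF Gm sm] by blast
  moreover have "supports_overlap (F 0) G \<longrightarrow> \<not> (AE x in lebesgue. u x = 0)"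
    using solution_nontrivial[OF G s] by blast
  ultimately show ?thesis using um u by blast
qed

end
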